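(* Let $\mathbb{F}$ be a field with $\mathrm{char}\,\mathbb{F}\neq2$, let $\Phi\subset\{0,1\}$ and $\eta\in\mathbb{F}\setminus\{0,1\}$, and let $M_\Phi$ be the universal 2-generated $\mathcal{F}_\Phi(\eta)$-axial algebra over $\mathbb{F}$. Then: (1) If $\Phi\neq\{0,1\}$ and $\eta\neq\frac12$, then $M_\Phi$ is isomorphic to $\widehat{\mathrm{3C}^{00}}(\eta)$. (2) Assume $\eta=\frac12$. If $\Phi=\emptyset$, or if $\mathrm{char}\,\mathbb{F}$ is neither $3$ nor $5$, then $M_\Phi$ is isomorphic to $\mathrm{Z}_{\mathrm{np}}(\frac12)$. Here "isomorphic" means isomorphic as axial algebras, i.e. via an algebra isomorphism carrying the generating pair of axes to the generating pair of axes.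
   Context: Algebras are commutative, not necessarily associative or unital. For an algebra $M$, $a\in M$, $s\in\mathbb{F}$ put $M(a,s)=\{x\in M: ax=sx\}$. The fusion rule $\mathcal{F}_\Phi(\eta)$ is the set $\{0,1,\eta\}$ with the symmetric operation $0\star0=\{0\}$, $1\star1=\{1\}$, $0\star1=\Phi$, $0\star\eta=1\star\eta=\{\eta\}$, $\eta\star\eta=\{0,1\}$. An $\mathcal{F}_\Phi(\eta)$-axis of $M$ is an idempotent $a$ with $M=M(a,0)\oplus M(a,1)\oplus M(a,\eta)$ and $M(a,s)M(a,t)\subset\bigoplus_{u\in s\star t}M(a,u)$ for all $s,t\in\{0,1,\eta\}$. A 2-generated $\mathcal{F}_\Phi(\eta)$-axial algebra is a pair $(M,(a_0,a_1))$ where $a_0,a_1$ are $\mathcal{F}_\Phi(\eta)$-axes generating the algebra $M$. The universal one, $M_\Phi$, is the initial object: for every 2-generated $\mathcal{F}_\Phi(\eta)$-axial algebra $(N,(b_0,b_1))$ there is a unique algebra homomorphism $M_\Phi\to N$ with $a_i\mapsto b_i$ for $i=0,1$. $\widehat{\mathrm{3C}}(\eta)$ is the algebra with basis $\hat q,\hat a_{-1},\hat a_0,\hat a_1$ and products $\hat qx=(\eta+1)x$ for all $x$; $\hat a_i\hat a_i=\hat a_i$; and $\hat a_i\hat a_{j}=-\frac12\hat q+\frac{\eta+1}{2}(\hat a_i+\hat a_j)+\frac{1-\eta}{2}\hat a_k$ whenever $\{i,j,k\}=\{-1,0,1\}$. $\mathrm{2A}$ is the algebra $\mathbb{F}s_0\oplus\mathbb{F}s_1$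 with $s_0s_0=s_0$, $s_1s_1=s_1$, $s_0s_1=0$. $\widehat{\mathrm{3C}^{00}}(\eta)$ is the direct sum of algebras $\widehat{\mathrm{3C}}(\eta)\oplus\mathrm{2A}$ with generating axes $(\hat a_0+s_0,\hat a_1+s_1)$. $\mathrm{Z}_{\mathrm{np}}(\frac12)$ is the algebra with basis $\{\hat p_i\}_{i\in\mathbb{Z}_{>0}}\cup\{\hat a_i\}_{i\in\mathbb{Z}}$ and, with the convention $\hat p_0=0$, products $\hat a_i\hat a_j=\hat p_{|i-j|}+\frac12(\hat a_i+\hat a_j)$, $\hat a_i\hat p_j=\frac12\hat p_j-\frac14\hat a_i+\frac18(\hat a_{i-j}+\hat a_{i+j})$, $\hat p_i\hat p_j=-\frac14(\hat p_i+\hat p_j)+\frac18(\hat p_{i+j}+\hat p_{|i-j|})$; its generating axes are $(\hat a_0,\hat a_1)$. *)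

theory Defs
  imports
    Complex_Main
    "HOL-Library.Poly_Mapping"
    "HOL-Library.Product_Plus"
    "HOL-Library.FuncSet"
    "HOL-Library.Countable_Set"
begin

section \<open>Commutative nonassociative algebras\<close>

text \<open>
  An algebra lives on a linear subspace of an ambient vector space: the addition is that of the
  ambient type, the scalar multiplication and the product are explicit. The product only matters
  on the carrier.
\<close>

record ('f, 'v) alg =
  carrier :: "'v set"
  smul :: "'f \<Rightarrow> 'v \<Rightarrow> 'v"
  mul :: "'v \<Rightarrow> 'v \<Rightarrow> 'v"

locale comm_alg = vector_space "smul A"
  for A :: "('f::field, 'v::ab_group_add) alg" +
  assumes subspace_carrier: "subspace (carrier A)"
    and mul_closed: "\<And>x y. x \<in> carrier A \<Longrightarrow> y \<in> carrier A \<Longrightarrow> mul A x y \<in> carrier A"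
    and mul_commute: "\<And>x y. x \<in> carrier A \<Longrightarrow> y \<in> carrier A \<Longrightarrow> mul A x y = mul A y x"
    and mul_add: "\<And>x y z. x \<in> carrier A \<Longrightarrow> y \<in> carrier A \<Longrightarrow> z \<in> carrier A \<Longrightarrow>
        mul A x (y + z) = mul A x y + mul A x z"
    and mul_smul: "\<And>c x y. x \<in> carrier A \<Longrightarrow> y \<in> carrier A \<Longrightarrow>
        mul A x (smul A c y) = smul A c (mul A x y)"

definition subalgebra :: "('f::field, 'v::ab_group_add) alg \<Rightarrow> 'v set \<Rightarrow> bool" where
  "subalgebra A B \<longleftrightarrow> B \<subseteq> carrier A \<and> module.subspace (smul A) B \<and>
     (\<forall>x\<in>B. \<forall>y\<in>B. mul A x y \<in> B)"

definition generates :: "('f::field, 'v::ab_group_add) alg \<Rightarrow> 'v set \<Rightarrow> bool" where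
  "generates A S \<longleftrightarrow> S \<subseteq> carrier A \<and> subalgebra A hull S = carrier A"

definition alg_hom ::
  "('f::field, 'v::ab_group_add) alg \<Rightarrow> ('f, 'w::ab_group_add) alg \<Rightarrow> ('v \<Rightarrow> 'w) \<Rightarrow> bool" where
  "alg_hom A B f \<longleftrightarrow> f \<in> carrier A \<rightarrow> carrier B \<and>
     (\<forall>x\<in>carrier A. \<forall>y\<in>carrier A. f (x + y) = f x + f y) \<and>
     (\<forall>c. \<forall>x\<in>carrier A. f (smul A c x) = smul B c (f x)) \<and>
     (\<forall>x\<in>carrier A. \<forall>y\<in>carrier A. f (mul A x y) = mul B (f x) (f y))"

definition direct_sum_alg ::
  "('f, 'v) alg \<Rightarrow> ('f, 'w) alg \<Rightarrow> ('f, 'v \<times> 'w) alg" where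
  "direct_sum_alg A B = \<lparr>carrier = carrier A \<times> carrier B,
     smul = (\<lambda>c (x, y). (smul A c x, smul B c y)),
     mul = (\<lambda>(x, y) (x', y'). (mul A x x', mul B y y'))\<rparr>"


section \<open>Axes and axial algebras\<close>

definition fusion_rule :: "'f::field set \<Rightarrow> 'f \<Rightarrow> 'f \<Rightarrow> 'f \<Rightarrow> 'f set" where
  "fusion_rule \<Phi> \<eta> s t =
    (if s = 0 \<and> t = 0 then {0}
     else if s = 1 \<and> t = 1 then {1}
     else if {s, t} = {0, 1} then \<Phi>
     else if {s, t} = {0, \<eta>} \<or> {s, t} = {1, \<eta>} then {\<eta>}
     else if s = \<eta> \<and> t = \<eta> then {0, 1}
     else {})"

definition eigsp :: "('f::field, 'v::ab_group_add) alg \<Rightarrow> 'v \<Rightarrow> 'f \<Rightarrow> 'v set" where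
  "eigsp A a s = {x \<in> carrier A. mul A a x = smul A s x}"

definition eigsp_sum :: "('f::field, 'v::ab_group_add) alg \<Rightarrow> 'v \<Rightarrow> 'f set \<Rightarrow> 'v set" where
  "eigsp_sum A a S = {\<Sum>s\<in>S. x s | x. \<forall>s\<in>S. x s \<in> eigsp A a s}"

definition eigsp_independent :: "('f::field, 'v::ab_group_add) alg \<Rightarrow> 'v \<Rightarrow> 'f set \<Rightarrow> bool" where
  "eigsp_independent A a S \<longleftrightarrow>
     (\<forall>x. (\<forall>s\<in>S. x s \<in> eigsp A a s) \<and> (\<Sum>s\<in>S. x s) = 0 \<longrightarrow> (\<forall>s\<in>S. x s = 0))"

definition is_axis ::
  "'f::field set \<Rightarrow> 'f \<Rightarrow> ('f, 'v::ab_group_add) alg \<Rightarrow> 'v \<Rightarrow> bool" where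
  "is_axis \<Phi> \<eta> A a \<longleftrightarrow> a \<in> carrier A \<and> mul A a a = a \<and>
     carrier A = eigsp_sum A a {0, 1, \<eta>} \<and> eigsp_independent A a {0, 1, \<eta>} \<and>
     (\<forall>s\<in>{0, 1, \<eta>}. \<forall>t\<in>{0, 1, \<eta>}. \<forall>x\<in>eigsp A a s. \<forall>y\<in>eigsp A a t.
        mul A x y \<in> eigsp_sum A a (fusion_rule \<Phi> \<eta> s t))"

definition axial_alg2 ::
  "'f::field set \<Rightarrow> 'f \<Rightarrow> ('f, 'v::ab_group_add) alg \<Rightarrow> 'v \<times> 'v \<Rightarrow> bool" where
  "axial_alg2 \<Phi> \<eta> A = (\<lambda>(a0, a1). comm_alg A \<and> is_axis \<Phi> \<eta> A a0 \<and> is_axis \<Phi> \<eta> A a1 \<and>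
     generates A {a0, a1})"

definition axial_hom ::
  "('f::field, 'v::ab_group_add) alg \<Rightarrow> 'v \<times> 'v \<Rightarrow> ('f, 'w::ab_group_add) alg \<Rightarrow> 'w \<times> 'w \<Rightarrow>
   ('v \<Rightarrow> 'w) \<Rightarrow> bool" where
  "axial_hom A a B b f \<longleftrightarrow> alg_hom A B f \<and> f (fst a) = fst b \<and> f (snd a) = snd b"

definition axial_isomorphic ::
  "('f::field, 'v::ab_group_add) alg \<Rightarrow> 'v \<times> 'v \<Rightarrow> ('f, 'w::ab_group_add) alg \<Rightarrow> 'w \<times> 'w \<Rightarrow>
   bool" where
  "axial_isomorphic A a B b \<longleftrightarrow>
     (\<exists>f. axial_hom A a B b f \<and> bij_betw f (carrier A) (carrier B))"

text \<open>
  The test algebras N range over all algebras carried by subspaces of a space of countable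
  dimension. A 2-generated algebra is spanned by the countably many products of its generators,
  so each of them occurs up to isomorphism; the lemma universal_axial_alg2D at the end of this
  theory proves that the defining property then holds for test algebras over every type.
  Homomorphisms are made unique as functions by requiring them to be extensional.
\<close>

definition universal_axial_alg2 ::
  "'f::field set \<Rightarrow> 'f \<Rightarrow> ('f, 'v::ab_group_add) alg \<Rightarrow> 'v \<times> 'v \<Rightarrow> bool" where
  "universal_axial_alg2 \<Phi> \<eta> M a \<longleftrightarrow> axial_alg2 \<Phi> \<eta> M a \<and>
     (\<forall>(N :: ('f, nat \<Rightarrow>\<^sub>0 'f) alg) b. axial_alg2 \<Phi> \<eta> N b \<longrightarrow>
        (\<exists>!f. f \<in> extensional (carrier M) \<and> axial_hom M a N b f))"


section \<open>Algebras given by a basis and structure constants\<close>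

definition pscale :: "'f::field \<Rightarrow> ('b \<Rightarrow>\<^sub>0 'f) \<Rightarrow> ('b \<Rightarrow>\<^sub>0 'f)" where
  "pscale c x = Poly_Mapping.map ((*) c) x"

abbreviation bvec :: "'b \<Rightarrow> ('b \<Rightarrow>\<^sub>0 'f::field)" where
  "bvec b \<equiv> Poly_Mapping.single b 1"

definition basis_alg :: "'b set \<Rightarrow> ('b \<Rightarrow> 'b \<Rightarrow> ('b \<Rightarrow>\<^sub>0 'f::field)) \<Rightarrow> ('f, 'b \<Rightarrow>\<^sub>0 'f) alg" where
  "basis_alg B t = \<lparr>carrier = {x. Poly_Mapping.keys x \<subseteq> B}, smul = pscale,
     mul = (\<lambda>x y. \<Sum>i\<in>Poly_Mapping.keys x. \<Sum>j\<in>Poly_Mapping.keys y.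
              pscale (Poly_Mapping.lookup x i * Poly_Mapping.lookup y j) (t i j))\<rparr>"

datatype idx3 = IM1 | I0 | I1  \<comment> \<open>the indices $-1, 0, 1$\<close>

datatype basis_3C = Q3 | A3 idx3

fun table_3C :: "'f::field \<Rightarrow> basis_3C \<Rightarrow> basis_3C \<Rightarrow> (basis_3C \<Rightarrow>\<^sub>0 'f)" where
  "table_3C \<eta> Q3 y = pscale (\<eta> + 1) (bvec y)"
| "table_3C \<eta> (A3 i) Q3 = pscale (\<eta> + 1) (bvec (A3 i))"
| "table_3C \<eta> (A3 i) (A3 j) =
    (if i = j then bvec (A3 i)
     else pscale (- (1/2)) (bvec Q3) + pscale ((\<eta> + 1) / 2) (bvec (A3 i) + bvec (A3 j))
       + pscale ((1 - \<eta>) / 2) (bvec (A3 (THE k. {i, j, k} = {IM1, I0, I1}))))"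

definition alg_3C_hat :: "'f::field \<Rightarrow> ('f, basis_3C \<Rightarrow>\<^sub>0 'f) alg" where
  "alg_3C_hat \<eta> = basis_alg UNIV (table_3C \<eta>)"

datatype basis_2A = S0 | S1

definition alg_2A :: "('f::field, basis_2A \<Rightarrow>\<^sub>0 'f) alg" where
  "alg_2A = basis_alg UNIV (\<lambda>i j. if i = j then bvec i else 0)"

definition alg_3C00_hat :: "'f::field \<Rightarrow> ('f, (basis_3C \<Rightarrow>\<^sub>0 'f) \<times> (basis_2A \<Rightarrow>\<^sub>0 'f)) alg" where
  "alg_3C00_hat \<eta> = direct_sum_alg (alg_3C_hat \<eta>) alg_2A"

definition axes_3C00_hat ::
  "((basis_3C \<Rightarrow>\<^sub>0 'f::field) \<times> (basis_2A \<Rightarrow>\<^sub>0 'f)) \<times> ((basis_3C \<Rightarrow>\<^sub>0 'f) \<times> (basis_2A \<Rightarrow>\<^sub>0 'f))" where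
  "axes_3C00_hat = ((bvec (A3 I0), bvec S0), (bvec (A3 I1), bvec S1))"

datatype basis_Z = PZ nat | AZ int  \<comment> \<open>\<open>PZ 0\<close> is not a basis vector of the algebra, see \<open>alg_Znp\<close>\<close>

definition pZ :: "nat \<Rightarrow> (basis_Z \<Rightarrow>\<^sub>0 'f::field)" where
  "pZ i = (if i = 0 then 0 else bvec (PZ i))"

definition aZ :: "int \<Rightarrow> (basis_Z \<Rightarrow>\<^sub>0 'f::field)" where
  "aZ i = bvec (AZ i)"

definition prod_ap :: "int \<Rightarrow> nat \<Rightarrow> (basis_Z \<Rightarrow>\<^sub>0 'f::field)" where
  "prod_ap i j = pscale (1/2) (pZ j) - pscale (1/4) (aZ i)
     + pscale (1/8) (aZ (i - int j) + aZ (i + int j))"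

fun table_Z :: "basis_Z \<Rightarrow> basis_Z \<Rightarrow> (basis_Z \<Rightarrow>\<^sub>0 'f::field)" where
  "table_Z (AZ i) (AZ j) = pZ (nat \<bar>i - j\<bar>) + pscale (1/2) (aZ i + aZ j)"
| "table_Z (AZ i) (PZ j) = prod_ap i j"
| "table_Z (PZ j) (AZ i) = prod_ap i j"
| "table_Z (PZ i) (PZ j) = pscale (- (1/4)) (pZ i + pZ j)
     + pscale (1/8) (pZ (i + j) + pZ (nat \<bar>int i - int j\<bar>))"

definition alg_Znp :: "('f::field, basis_Z \<Rightarrow>\<^sub>0 'f) alg" where
  "alg_Znp = basis_alg ({PZ i | i. i > 0} \<union> {AZ i | i. True}) table_Z"


section \<open>The universal property for test algebras over an arbitrary type\<close>

lemma lookup_pscale [simp]: "Poly_Mapping.lookup (pscale c x) i = c * Poly_Mapping.lookup x i"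
  by (simp add: pscale_def map.rep_eq when_def)

lemma vector_space_pscale: "vector_space pscale"
  by unfold_locales (auto intro!: poly_mapping_eqI simp: lookup_add algebra_simps)

lemma axial_alg2_iso:
  assumes fin: "finite \<Phi>" and A: "axial_alg2 \<Phi> \<eta> A a" and B: "comm_alg B"
    and f: "axial_hom A a B b f" and bij: "bij_betw f (carrier A) (carrier B)"
  shows "axial_alg2 \<Phi> \<eta> B b"
proof -
  interpret A: comm_alg A using A by (auto simp: axial_alg2_def)
  interpret B: comm_alg B by (rule B)
  have inj: "inj_on f (carrier A)" and im: "f ` carrier A = carrier B"
    using bij by (auto simp: bij_betw_def)
  have fadd: "f (x + y) = f x + f y" if "x \<in> carrier A" "y \<in> carrier A" for x y
    using f that by (auto simp: axial_hom_def alg_hom_def)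
  have fsm: "f (smul A c x) = smul B c (f x)" if "x \<in> carrier A" for c x
    using f that by (auto simp: axial_hom_def alg_hom_def)
  have fmul: "f (mul A x y) = mul B (f x) (f y)" if "x \<in> carrier A" "y \<in> carrier A" for x y
    using f that by (auto simp: axial_hom_def alg_hom_def)
  have zA: "0 \<in> carrier A" using A.subspace_carrier by (rule A.subspace_0)
  have f0: "f 0 = 0" using fadd[OF zA zA] by simp
  have fsum: "f (\<Sum>s\<in>S. x s) = (\<Sum>s\<in>S. f (x s))" if "finite S" "\<And>s. s \<in> S \<Longrightarrow> x s \<in> carrier A"
    for S :: "'a set" and x
    using that
    by (induction S rule: finite_induct) (auto simp: f0 fadd A.subspace_sum[OF A.subspace_carrier])
  have eig: "eigsp B (f c) s = f ` eigsp A c s" if c: "c \<in> carrier A" for c s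
  proof -
    have "mul B (f c) (f x) = smul B s (f x) \<longleftrightarrow> mul A c x = smul A s x" if x: "x \<in> carrier A" for x
    proof -
      have "mul A c x \<in> carrier A" "smul A s x \<in> carrier A"
        using A.mul_closed c x A.subspace_scale[OF A.subspace_carrier] by auto
      then show ?thesis
        using c x inj by (metis fmul fsm inj_onD)
    qed
    then show ?thesis
      unfolding eigsp_def im[symmetric] by auto
  qed
  have eigsub: "eigsp A c s \<subseteq> carrier A" for c s by (auto simp: eigsp_def)
  have eigsum: "eigsp_sum B (f c) S = f ` eigsp_sum A c S" if c: "c \<in> carrier A" and S: "finite S" for c S
  proof (rule set_eqI, rule iffI)
    fix y assume "y \<in> eigsp_sum B (f c) S"
    then obtain x where y: "y = (\<Sum>s\<in>S. x s)" and x: "\<forall>s\<in>S. x s \<in> f ` eigsp A c s"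
      using eig[OF c] by (auto simp: eigsp_sum_def)
    then obtain z where z: "\<forall>s\<in>S. x s = f (z s) \<and> z s \<in> eigsp A c s"
      unfolding image_iff by metis
    have "y = f (\<Sum>s\<in>S. z s)"
      using z eigsub unfolding y by (subst fsum[OF S]) auto
    then show "y \<in> f ` eigsp_sum A c S" using z by (auto simp: eigsp_sum_def)
  next
    fix y assume "y \<in> f ` eigsp_sum A c S"
    then obtain z where "y = f (\<Sum>s\<in>S. z s)" and z: "\<forall>s\<in>S. z s \<in> eigsp A c s"
      by (auto simp: eigsp_sum_def)
    then have "y = (\<Sum>s\<in>S. f (z s))" using eigsub by (subst fsum[OF S, symmetric]) auto
    then show "y \<in> eigsp_sum B (f c) S" using z eig[OF c] unfolding eigsp_sum_def
      by (intro CollectI exI[of _ "\<lambda>s. f (z s)"]) auto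
  qed
  have axis: "is_axis \<Phi> \<eta> B (f c)" if ax: "is_axis \<Phi> \<eta> A c" for c
  proof -
    have c: "c \<in> carrier A" "mul A c c = c" using ax by (auto simp: is_axis_def)
    have "eigsp_independent B (f c) {0, 1, \<eta>}"
      unfolding eigsp_independent_def
    proof (intro allI impI, elim conjE)
      fix x assume x: "\<forall>s\<in>{0, 1, \<eta>}. x s \<in> eigsp B (f c) s" and s0: "(\<Sum>s\<in>{0, 1, \<eta>}. x s) = 0"
      then obtain z where z: "\<forall>s\<in>{0, 1, \<eta>}. x s = f (z s) \<and> z s \<in> eigsp A c s"
        unfolding eig[OF c(1)] image_iff by metis
      have zc: "z s \<in> carrier A" if "s \<in> {0, 1, \<eta>}" for s using z eigsub that by blast
      have "f (\<Sum>s\<in>{0, 1, \<eta>}. z s) = (\<Sum>s\<in>{0, 1, \<eta>}. f (z s))"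
        using zc by (intro fsum) auto
      also have "\<dots> = f 0" using s0 z f0 by (metis (mono_tags, lifting) sum.cong)
      finally have "(\<Sum>s\<in>{0, 1, \<eta>}. z s) = 0"
        using inj zA A.subspace_sum[OF A.subspace_carrier, of "{0, 1, \<eta>}" z] zc by (meson inj_onD)
      then have "\<forall>s\<in>{0, 1, \<eta>}. z s = 0"
        using ax z unfolding is_axis_def eigsp_independent_def by blast
      then show "\<forall>s\<in>{0, 1, \<eta>}. x s = 0" using z f0 by simp
    qed
    moreover have "mul B x y \<in> eigsp_sum B (f c) (fusion_rule \<Phi> \<eta> s t)"
      if st: "s \<in> {0, 1, \<eta>}" "t \<in> {0, 1, \<eta>}" and "x \<in> eigsp B (f c) s" "y \<in> eigsp B (f c) t" for s t x y
    proof -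
      from that obtain x' y' where xy: "x = f x'" "y = f y'" "x' \<in> eigsp A c s" "y' \<in> eigsp A c t"
        using eig[OF c(1)] by blast
      then have "mul A x' y' \<in> eigsp_sum A c (fusion_rule \<Phi> \<eta> s t)"
        using ax st by (auto simp: is_axis_def)
      moreover have "mul B x y = f (mul A x' y')" using xy eigsub fmul by (metis subsetD)
      moreover have "finite (fusion_rule \<Phi> \<eta> s t)" using fin by (auto simp: fusion_rule_def)
      ultimately show ?thesis using eigsum[OF c(1)] by auto
    qed
    moreover have "carrier B = eigsp_sum B (f c) {0, 1, \<eta>}"
      using ax im eigsum[OF c(1), of "{0, 1, \<eta>}"] by (simp add: is_axis_def)
    moreover have "f c \<in> carrier B" "mul B (f c) (f c) = f c"
      using c im fmul[OF c(1) c(1)] by auto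
    ultimately show ?thesis unfolding is_axis_def by blast
  qed
  have gen: "generates B (f ` S)" if S: "generates A S" for S
  proof -
    have Sc: "S \<subseteq> carrier A" and H: "subalgebra A hull S = carrier A"
      using S by (auto simp: generates_def)
    have "carrier B \<subseteq> C" if C: "subalgebra B C" "f ` S \<subseteq> C" for C
    proof -
      let ?D = "{x \<in> carrier A. f x \<in> C}"
      have sC: "B.subspace C" using C by (simp add: subalgebra_def)
      have "A.subspace ?D"
        using A.subspace_carrier sC fadd fsm f0 by (auto simp: A.subspace_def B.subspace_def)
      then have "subalgebra A ?D"
        using C A.mul_closed fmul by (auto simp: subalgebra_def)
      moreover have "S \<subseteq> ?D" using Sc C by auto
      ultimately have "carrier A \<subseteq> ?D" using hull_minimal H by metis
      then show ?thesis unfolding im[symmetric] by auto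
    qed
    moreover have "subalgebra B (carrier B)"
      using B.subspace_carrier B.mul_closed by (auto simp: subalgebra_def)
    moreover have "f ` S \<subseteq> carrier B" using Sc im by auto
    ultimately show ?thesis
      unfolding generates_def by (intro conjI hull_unique) auto
  qed
  obtain a0 a1 where a: "a = (a0, a1)" by (cases a)
  have b: "b = (f a0, f a1)" using f a by (simp add: axial_hom_def prod_eq_iff)
  show ?thesis
    using A axis gen[of "{a0, a1}"] B by (simp add: a b axial_alg2_def)
qed

datatype gen_word = Gen bool | Prod gen_word gen_word

instance gen_word :: countable
  by countable_datatype

fun eval_word :: "('f, 'v) alg \<Rightarrow> 'v \<times> 'v \<Rightarrow> gen_word \<Rightarrow> 'v" where
  "eval_word A a (Gen c) = (if c then snd a else fst a)"
| "eval_word A a (Prod u v) = mul A (eval_word A a u) (eval_word A a v)"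

lemma (in comm_alg) span_words:
  assumes "generates A {a0, a1}"
  shows "span (range (eval_word A (a0, a1))) = carrier A"
    and "range (eval_word A (a0, a1)) \<subseteq> carrier A"
proof -
  let ?T = "range (eval_word A (a0, a1))"
  have gens: "a0 \<in> carrier A" "a1 \<in> carrier A" using assms by (auto simp: generates_def)
  have "eval_word A (a0, a1) w \<in> carrier A" for w
    by (induction w) (auto simp: gens mul_closed)
  then show T: "?T \<subseteq> carrier A" by auto
  then have sub: "span ?T \<subseteq> carrier A" using span_minimal subspace_carrier by blast
  have mul1: "y \<in> carrier A \<and> mul A x y \<in> span ?T" if x: "x \<in> ?T" and "y \<in> span ?T" for x y
    using that(2)
  proof (induction rule: span_induct_alt)
    case base
    have "mul A x (smul A 0 x) = smul A 0 (mul A x x)" using x T by (intro mul_smul) auto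
    then show ?case using subspace_0[OF subspace_carrier] by (simp add: span_zero)
  next
    case (step c y z)
    from x step(1) obtain u v where uv: "x = eval_word A (a0, a1) u" "y = eval_word A (a0, a1) v"
      by auto
    then have "mul A x y = eval_word A (a0, a1) (Prod u v)" by simp
    then have xy: "mul A x y \<in> span ?T" by (metis rangeI span_base)
    have c: "x \<in> carrier A" "y \<in> carrier A" "z \<in> carrier A" "smul A c y \<in> carrier A"
      using x step T sub subspace_scale[OF subspace_carrier] by auto
    show ?case
      using c xy step by (simp add: subspace_add[OF subspace_carrier] mul_add mul_smul span_add span_scale)
  qed
  have mul2: "x \<in> carrier A \<and> mul A y x \<in> span ?T" if "x \<in> span ?T" and y: "y \<in> span ?T" for x y
    using that(1)
  proof (induction rule: span_induct_alt)
    case base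
    have "mul A y (smul A 0 y) = smul A 0 (mul A y y)" using y sub by (intro mul_smul) auto
    then show ?case using subspace_0[OF subspace_carrier] by (simp add: span_zero)
  next
    case (step c x z)
    have c: "x \<in> carrier A" "y \<in> carrier A" "z \<in> carrier A" "smul A c x \<in> carrier A"
      using y step T sub subspace_scale[OF subspace_carrier] by auto
    have "mul A y x \<in> span ?T" using mul1[OF step(1) y] mul_commute c by simp
    then show ?case
      using c step by (simp add: subspace_add[OF subspace_carrier] mul_add mul_smul span_add span_scale)
  qed
  have "subalgebra A (span ?T)"
    using sub mul2 by (auto simp: subalgebra_def)
  moreover have "{a0, a1} \<subseteq> span ?T"
    using span_base[of a0 ?T] span_base[of a1 ?T] rangeI[of "eval_word A (a0, a1)" "Gen False"]
      rangeI[of "eval_word A (a0, a1)" "Gen True"] by auto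
  ultimately have "subalgebra A hull {a0, a1} \<subseteq> span ?T" by (intro hull_minimal)
  then show "span ?T = carrier A" using sub assms by (auto simp: generates_def)
qed

lemma (in vector_space) countable_coordinates:
  assumes "countable T"
  obtains \<phi> :: "'b \<Rightarrow> (nat \<Rightarrow>\<^sub>0 'a)" where "inj_on \<phi> (span T)"
    "\<And>x y. x \<in> span T \<Longrightarrow> y \<in> span T \<Longrightarrow> \<phi> (x + y) = \<phi> x + \<phi> y"
    "\<And>c x. x \<in> span T \<Longrightarrow> \<phi> (scale c x) = pscale c (\<phi> x)"
proof -
  obtain B where B: "B \<subseteq> T" "independent B" "T \<subseteq> span B"
    using maximal_independent_subset by blast
  have spB: "span B = span T" using B by (metis span_eq span_superset subset_trans span_mono)
  have "countable B" using B(1) assms countable_subset by blast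
  then obtain g :: "'b \<Rightarrow> nat" where g: "inj_on g B" by (auto simp: countable_def)
  define r where "r x n = (if n \<in> g ` B then representation B x (the_inv_into B g n) else 0)" for x n
  have fin: "finite {n. r x n \<noteq> 0}" for x
  proof (rule finite_subset)
    show "{n. r x n \<noteq> 0} \<subseteq> g ` {b. representation B x b \<noteq> 0}"
      using g by (auto simp: r_def the_inv_into_f_f split: if_splits)
    show "finite (g ` {b. representation B x b \<noteq> 0})"
      by (simp add: finite_representation)
  qed
  define \<phi> where "\<phi> x = Abs_poly_mapping (r x)" for x
  have l: "Poly_Mapping.lookup (\<phi> x) = r x" for x
    using fin by (simp add: \<phi>_def)
  show ?thesis
  proof
    show "inj_on \<phi> (span T)"
    proof (rule inj_onI)
      fix x y assume xy: "x \<in> span T" "y \<in> span T" and "\<phi> x = \<phi> y"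
      then have rr: "r x n = r y n" for n using l by metis
      have "representation B x b = representation B y b" if "b \<in> B" for b
        using rr[of "g b"] that g by (simp add: r_def the_inv_into_f_f)
      moreover have "representation B x b = representation B y b" if "b \<notin> B" for b
        using that by (metis representation_ne_zero)
      ultimately have "representation B x = representation B y" by auto
      then show "x = y"
        using sum_nonzero_representation_eq[OF B(2)] xy spB by metis
    qed
    show "\<phi> (x + y) = \<phi> x + \<phi> y" if "x \<in> span T" "y \<in> span T" for x y
      using that B(2) spB
      by (intro poly_mapping_eqI) (simp add: l lookup_add r_def representation_add)
    show "\<phi> (scale c x) = pscale c (\<phi> x)" if "x \<in> span T" for c x
      using that B(2) spB
      by (intro poly_mapping_eqI) (simp add: l r_def representation_scale)
  qed
qed

lemma universal_axial_alg2D: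
  fixes \<Phi> :: "'f::field set" and N :: "('f, 'w::ab_group_add) alg"
  assumes fin: "finite \<Phi>" and M: "universal_axial_alg2 \<Phi> \<eta> M a" and N: "axial_alg2 \<Phi> \<eta> N b"
  shows "\<exists>!f. f \<in> extensional (carrier M) \<and> axial_hom M a N b f"
proof -
  obtain b0 b1 where b: "b = (b0, b1)" by (cases b)
  interpret N: comm_alg N using N by (auto simp: axial_alg2_def b)
  have gen: "generates N {b0, b1}" using N by (simp add: axial_alg2_def b)
  obtain \<phi> :: "'w \<Rightarrow> (nat \<Rightarrow>\<^sub>0 'f)" where inj: "inj_on \<phi> (carrier N)"
    and add: "\<And>x y. x \<in> carrier N \<Longrightarrow> y \<in> carrier N \<Longrightarrow> \<phi> (x + y) = \<phi> x + \<phi> y"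
    and sm: "\<And>c x. x \<in> carrier N \<Longrightarrow> \<phi> (smul N c x) = pscale c (\<phi> x)"
    by (rule N.countable_coordinates[of "range (eval_word N (b0, b1))",
          unfolded N.span_words(1)[OF gen], OF countableI_type[THEN countable_image]]) blast
  define \<psi> where "\<psi> = the_inv_into (carrier N) \<phi>"
  have \<psi>\<phi>: "\<psi> (\<phi> x) = x" if "x \<in> carrier N" for x
    using inj that by (simp add: \<psi>_def the_inv_into_f_f)
  define N' where "N' = \<lparr>carrier = \<phi> ` carrier N, smul = pscale,
    mul = (\<lambda>x y. \<phi> (mul N (\<psi> x) (\<psi> y)))\<rparr>"
  have simps: "carrier N' = \<phi> ` carrier N" "smul N' = pscale"
    "mul N' x y = \<phi> (mul N (\<psi> x) (\<psi> y))" for x y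
    by (simp_all add: N'_def)
  note closed = N.subspace_0[OF N.subspace_carrier] N.subspace_add[OF N.subspace_carrier]
    N.subspace_scale[OF N.subspace_carrier] N.mul_closed
  have \<phi>0: "\<phi> 0 = 0" using add[of 0 0] closed(1) by (metis add_0_right add_left_cancel)
  interpret P: vector_space "smul N'" unfolding simps by (rule vector_space_pscale)
  have N': "comm_alg N'"
  proof
    show "P.subspace (carrier N')"
      unfolding P.subspace_def unfolding simps
    proof (intro conjI ballI allI)
      show "0 \<in> \<phi> ` carrier N" using closed(1) \<phi>0 by force
    next
      fix x y assume "x \<in> \<phi> ` carrier N" "y \<in> \<phi> ` carrier N"
      then show "x + y \<in> \<phi> ` carrier N" using closed(2) by (auto simp: add[symmetric])
    next
      fix c x assume "x \<in> \<phi> ` carrier N"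
      then show "pscale c x \<in> \<phi> ` carrier N" using closed(3) by (auto simp: sm[symmetric])
    qed
  next
    fix x y assume "x \<in> carrier N'" "y \<in> carrier N'"
    then obtain u v where uv: "x = \<phi> u" "y = \<phi> v" "u \<in> carrier N" "v \<in> carrier N"
      by (auto simp: simps)
    show "mul N' x y \<in> carrier N'" using uv by (simp add: simps \<psi>\<phi> closed)
    show "mul N' x y = mul N' y x" using uv by (simp add: simps \<psi>\<phi> N.mul_commute[of u v])
    show "mul N' x (smul N' c y) = smul N' c (mul N' x y)" for c
      using uv by (simp add: simps \<psi>\<phi> closed N.mul_smul flip: sm)
    fix z assume "z \<in> carrier N'"
    then obtain w where "z = \<phi> w" "w \<in> carrier N" by (auto simp: simps)
    then show "mul N' x (y + z) = mul N' x y + mul N' x z"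
      using uv by (simp add: simps \<psi>\<phi> closed N.mul_add flip: add)
  qed
  have hom: "axial_hom N b N' (\<phi> b0, \<phi> b1) \<phi>"
    by (auto simp: axial_hom_def alg_hom_def simps \<psi>\<phi> add sm b)
  have bij: "bij_betw \<phi> (carrier N) (carrier N')"
    using inj by (simp add: bij_betw_def simps)
  have "axial_alg2 \<Phi> \<eta> N' (\<phi> b0, \<phi> b1)"
    by (rule axial_alg2_iso[OF fin N N' hom bij])
  then have ex: "\<exists>!f. f \<in> extensional (carrier M) \<and> axial_hom M a N' (\<phi> b0, \<phi> b1) f"
    using M by (auto simp: universal_axial_alg2_def)
  interpret M: comm_alg M using M by (auto simp: universal_axial_alg2_def axial_alg2_def)
  have cM: "fst a \<in> carrier M" "snd a \<in> carrier M"
    using M by (auto simp: universal_axial_alg2_def axial_alg2_def is_axis_def)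
  have cN: "b0 \<in> carrier N" "b1 \<in> carrier N" using gen by (auto simp: generates_def)
  note closedM = M.subspace_add[OF M.subspace_carrier]
    M.subspace_scale[OF M.subspace_carrier] M.mul_closed
  have down: "axial_hom M a N b (restrict (\<psi> \<circ> f) (carrier M))"
    if f: "axial_hom M a N' (\<phi> b0, \<phi> b1) f" for f
  proof -
    have "\<exists>h. (\<forall>x\<in>carrier M. h x \<in> carrier N \<and> f x = \<phi> (h x))"
      using f by (intro bchoice) (auto simp: axial_hom_def alg_hom_def simps Pi_def image_iff)
    then obtain h where h: "h x \<in> carrier N" "f x = \<phi> (h x)" if "x \<in> carrier M" for x by blast
    have eq: "x = y" if "\<phi> x = \<phi> y" "x \<in> carrier N" "y \<in> carrier N" for x y
      using that inj by (auto dest: inj_onD)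
    have fh: "f (x + y) = f x + f y" "f (smul M c x) = pscale c (f x)"
      "f (mul M x y) = mul N' (f x) (f y)" if "x \<in> carrier M" "y \<in> carrier M" for x y c
      using f that by (auto simp: axial_hom_def alg_hom_def simps)
    have "h (x + y) = h x + h y" "h (smul M c x) = smul N c (h x)" "h (mul M x y) = mul N (h x) (h y)"
      if "x \<in> carrier M" "y \<in> carrier M" for x y c
    proof -
      have hc: "h x \<in> carrier N" "h y \<in> carrier N" using h that by auto
      show "h (x + y) = h x + h y"
        by (rule eq) (use fh(1)[OF that] h that hc closedM closed in \<open>simp_all add: add\<close>)
      show "h (smul M c x) = smul N c (h x)"
        by (rule eq) (use fh(2)[OF that] h that hc closedM closed in \<open>simp_all add: sm\<close>)
      show "h (mul M x y) = mul N (h x) (h y)"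
        by (rule eq) (use fh(3)[OF that] h that hc closedM closed in \<open>simp_all add: simps \<psi>\<phi>\<close>)
    qed
    moreover have "h (fst a) = b0" "h (snd a) = b1"
      using f h[OF cM(1)] h[OF cM(2)] cN by (simp_all add: axial_hom_def eq)
    ultimately show ?thesis
      using cM closedM closed h by (auto simp: axial_hom_def alg_hom_def \<psi>\<phi> b)
  qed
  have up: "axial_hom M a N' (\<phi> b0, \<phi> b1) (restrict (\<phi> \<circ> f) (carrier M))"
    if f: "axial_hom M a N b f" for f
    using f cM closedM by (auto simp: axial_hom_def alg_hom_def simps \<psi>\<phi> add sm b Pi_def)
  show ?thesis
  proof (rule ex_ex1I)
    show "\<exists>f. f \<in> extensional (carrier M) \<and> axial_hom M a N b f"
      using ex down by (meson restrict_extensional)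
  next
    fix f g
    assume fg: "f \<in> extensional (carrier M) \<and> axial_hom M a N b f"
      "g \<in> extensional (carrier M) \<and> axial_hom M a N b g"
    then have "restrict (\<phi> \<circ> f) (carrier M) = restrict (\<phi> \<circ> g) (carrier M)"
      using ex up by (metis restrict_extensional)
    then have "\<phi> (f x) = \<phi> (g x)" if "x \<in> carrier M" for x
      using that by (metis comp_apply restrict_apply')
    then have "f x = g x" if "x \<in> carrier M" for x
      using that fg inj by (auto simp: axial_hom_def alg_hom_def Pi_def dest: inj_onD)
    then show "f = g" using fg by (meson extensionalityI)
  qed
qed

end

theory Submission
  imports Defs "HOL-Computational_Algebra.Primes"
begin

text \<open>
  The Miyamoto involutions of two axes \<open>a(0)\<close> and \<open>a(1)\<close> generate a dihedral group, which produces
  axes \<open>a(i)\<close> for all integers \<open>i\<close>. The elements \<open>p(i,j) = a(i) a(j) - \<eta> (a(i) + a(j))\<close> are fixed by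
  the involutions of \<open>a(i)\<close> and \<open>a(j)\<close>, and the eigencomponents of \<open>a(j)\<close> with respect to \<open>a(i)\<close> are
  linear combinations of \<open>p(i,j)\<close>, \<open>a(i)\<close>, \<open>a(j)\<close> and the reflection of \<open>a(j)\<close>. So every fusion rule
  becomes an identity between these elements.

  For \<open>\<eta> = 1/2\<close> these identities force \<open>p(i,j)\<close> to depend on \<open>|i - j|\<close> only, and the products of
  \<open>Z\<^sub>n\<^sub>p\<close> follow. Each step of this argument divides by 2, 3 or 5 or, when \<open>\<Phi>\<close> is empty, shows that
  \<open>p(i,i+n)\<close> is a periodic arithmetic progression in \<open>i\<close>.

  For \<open>\<eta> \<noteq> 1/2\<close> and \<open>1 \<notin> \<Phi>\<close>, comparing the expressions for the square of \<open>p(0,1)\<close> obtained at \<open>a(0)\<close>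
  and at \<open>a(1)\<close> gives linear recurrences for the sequence \<open>a\<close>, which imply
  \<open>a(i+3) - a(i) = \<plusminus> (a(3) - a(0))\<close>; then \<open>a(i) a(i+3)\<close> and \<open>a(i) - a(i) a(i+3)\<close> satisfy the relations
  of \<open>3C\<^sup>0\<^sup>0\<close>. The case \<open>0 \<notin> \<Phi>\<close> reduces to this one by replacing every axis \<open>a\<close> by \<open>1 - a\<close> in the
  unital hull, which replaces \<open>\<eta>\<close> by \<open>1 - \<eta>\<close>.
\<close>

section \<open>Commutative algebras on a whole type\<close>

text \<open>The fusion rules at an axis say nothing directly about a product such as
  \<open>p\<close> times \<open>p\<close>; they only restrict products of eigencomponents at that
  axis. The way out is to find a combination of such products from which the unknown one drops out
  and which the axis maps to one that contains it. This evaluates the unknown product once for every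
  centre \<open>a(c)\<close>. The left side does not depend on c, and comparing centres produces the
  recurrences. The relations obtained give a homomorphism from the concrete algebra to
  \<open>M\<close>; the concrete algebra is axial, so universality gives one back, and both
  composites are determined on the generators. The relations are derived for products defined on a
  whole vector space, which removes all carrier conditions. A product on a subspace is therefore
  first extended along a linear projection and then, since the duality needs a unit, to the unital
  hull. The homomorphism returns from the hull to \<open>M\<close> because the two axes generate its
  source.\<close>

locale total_alg = vector_space scale
  for scale :: "'f::field \<Rightarrow> 'v::ab_group_add \<Rightarrow> 'v" (infixr \<open>*s\<close> 75) +
  fixes times :: "'v \<Rightarrow> 'v \<Rightarrow> 'v" (infixl \<open>\<odot>\<close> 70)
  assumes times_comm: "x \<odot> y = y \<odot> x"
    and times_add_right: "x \<odot> (y + z) = x \<odot> y + x \<odot> z"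
    and times_scale_right: "x \<odot> (c *s y) = c *s (x \<odot> y)"
begin

text \<open>Coordinates with respect to some basis turn vector identities into identities in the field.\<close>

definition coord :: "'v \<Rightarrow> 'v \<Rightarrow> 'f" where
  "coord b x = representation (extend_basis {}) x b"

lemma basis_extend: "independent (extend_basis {})" "span (extend_basis {}) = UNIV"
  by (simp_all add: independent_empty independent_extend_basis span_extend_basis)

lemma coord_add: "coord b (x + y) = coord b x + coord b y"
  and coord_scale: "coord b (c *s x) = c * coord b x"
  and coord_zero: "coord b 0 = 0"
  and coord_minus: "coord b (- x) = - coord b x"
  and coord_diff: "coord b (x - y) = coord b x - coord b y"
  by (simp_all add: coord_def basis_extend representation_add representation_scale
      representation_zero representation_neg representation_diff)

lemmas coord_linear = coord_add coord_scale coord_zero coord_minus coord_diff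

lemma coord_eqI:
  assumes "\<And>b. coord b x = coord b y"
  shows "x = y"
proof -
  have "representation (extend_basis {}) x = representation (extend_basis {}) y"
    using assms by (auto simp: coord_def)
  then show ?thesis
    using sum_nonzero_representation_eq[OF basis_extend(1)] basis_extend(2) by (metis UNIV_I)
qed

lemma times_add_left: "(x + y) \<odot> z = x \<odot> z + y \<odot> z"
  by (metis times_comm times_add_right)

lemma times_scale_left: "(c *s x) \<odot> y = c *s (x \<odot> y)"
  by (metis times_comm times_scale_right)

lemma times_zero_right [simp]: "x \<odot> 0 = 0"
  using times_scale_right[of x 0 0] by simp

lemma times_zero_left [simp]: "0 \<odot> x = 0"
  by (metis times_comm times_zero_right)

lemma times_minus_right: "x \<odot> (- y) = - (x \<odot> y)"
  using times_scale_right[of x "-1" y] by simp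

lemma times_minus_left: "(- x) \<odot> y = - (x \<odot> y)"
  by (metis times_comm times_minus_right)

lemma times_diff_right: "x \<odot> (y - z) = x \<odot> y - x \<odot> z"
  using times_add_right[of x y "- z"] by (simp add: times_minus_right)

lemma times_diff_left: "(x - y) \<odot> z = x \<odot> z - y \<odot> z"
  by (metis times_comm times_diff_right)

lemmas times_bilinear = times_add_left times_add_right times_scale_left times_scale_right
  times_minus_left times_minus_right times_diff_left times_diff_right

text \<open>The condition \<open>a \<odot> (a \<odot> z) = a \<odot> z\<close> says that z has
  components for 0 and 1 only, namely \<open>z - a \<odot> z\<close> and \<open>a \<odot> z\<close>.
  The set \<open>\<Phi>\<close> enters through two implications; for empty \<open>\<Phi>\<close>
  both apply and together force \<open>x \<odot> y = 0\<close>.\<close>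

definition axis :: "'f set \<Rightarrow> 'f \<Rightarrow> 'v \<Rightarrow> bool" where
  "axis \<Phi> \<eta> a \<longleftrightarrow> a \<odot> a = a \<and>
     (\<forall>x. \<exists>x0 x1 xh. x = x0 + x1 + xh \<and> a \<odot> x0 = 0 \<and> a \<odot> x1 = x1 \<and> a \<odot> xh = \<eta> *s xh) \<and>
     (\<forall>x y. a \<odot> x = 0 \<longrightarrow> a \<odot> y = 0 \<longrightarrow> a \<odot> (x \<odot> y) = 0) \<and>
     (\<forall>x y. a \<odot> x = x \<longrightarrow> a \<odot> y = y \<longrightarrow> a \<odot> (x \<odot> y) = x \<odot> y) \<and>
     (\<forall>x y. a \<odot> x = 0 \<longrightarrow> a \<odot> y = y \<longrightarrow> a \<odot> (a \<odot> (x \<odot> y)) = a \<odot> (x \<odot> y) \<and>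
        (0 \<notin> \<Phi> \<longrightarrow> a \<odot> (x \<odot> y) = x \<odot> y) \<and> (1 \<notin> \<Phi> \<longrightarrow> a \<odot> (x \<odot> y) = 0)) \<and>
     (\<forall>x y. a \<odot> x = 0 \<longrightarrow> a \<odot> y = \<eta> *s y \<longrightarrow> a \<odot> (x \<odot> y) = \<eta> *s (x \<odot> y)) \<and>
     (\<forall>x y. a \<odot> x = x \<longrightarrow> a \<odot> y = \<eta> *s y \<longrightarrow> a \<odot> (x \<odot> y) = \<eta> *s (x \<odot> y)) \<and>
     (\<forall>x y. a \<odot> x = \<eta> *s x \<longrightarrow> a \<odot> y = \<eta> *s y \<longrightarrow> a \<odot> (a \<odot> (x \<odot> y)) = a \<odot> (x \<odot> y))"

lemma axisD:
  assumes "axis \<Phi> \<eta> a"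
  shows axis_idem: "a \<odot> a = a"
    and axis_decomp: "\<exists>x0 x1 xh. x = x0 + x1 + xh \<and> a \<odot> x0 = 0 \<and> a \<odot> x1 = x1 \<and> a \<odot> xh = \<eta> *s xh"
    and axis_00: "a \<odot> x = 0 \<Longrightarrow> a \<odot> y = 0 \<Longrightarrow> a \<odot> (x \<odot> y) = 0"
    and axis_11: "a \<odot> x = x \<Longrightarrow> a \<odot> y = y \<Longrightarrow> a \<odot> (x \<odot> y) = x \<odot> y"
    and axis_01: "a \<odot> x = 0 \<Longrightarrow> a \<odot> y = y \<Longrightarrow> a \<odot> (a \<odot> (x \<odot> y)) = a \<odot> (x \<odot> y)"
    and axis_01_no0: "a \<odot> x = 0 \<Longrightarrow> a \<odot> y = y \<Longrightarrow> 0 \<notin> \<Phi> \<Longrightarrow> a \<odot> (x \<odot> y) = x \<odot> y"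
    and axis_01_no1: "a \<odot> x = 0 \<Longrightarrow> a \<odot> y = y \<Longrightarrow> 1 \<notin> \<Phi> \<Longrightarrow> a \<odot> (x \<odot> y) = 0"
    and axis_0h: "a \<odot> x = 0 \<Longrightarrow> a \<odot> y = \<eta> *s y \<Longrightarrow> a \<odot> (x \<odot> y) = \<eta> *s (x \<odot> y)"
    and axis_1h: "a \<odot> x = x \<Longrightarrow> a \<odot> y = \<eta> *s y \<Longrightarrow> a \<odot> (x \<odot> y) = \<eta> *s (x \<odot> y)"
    and axis_hh: "a \<odot> x = \<eta> *s x \<Longrightarrow> a \<odot> y = \<eta> *s y \<Longrightarrow> a \<odot> (a \<odot> (x \<odot> y)) = a \<odot> (x \<odot> y)"
  using assms unfolding axis_def by blast+

definition automorphism :: "('v \<Rightarrow> 'v) \<Rightarrow> bool" where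
  "automorphism f \<longleftrightarrow> bij f \<and> (\<forall>x y. f (x + y) = f x + f y) \<and> (\<forall>c x. f (c *s x) = c *s f x) \<and>
     (\<forall>x y. f (x \<odot> y) = f x \<odot> f y)"

lemma automorphismD:
  assumes "automorphism f"
  shows "bij f" "f (x + y) = f x + f y" "f (c *s x) = c *s f x" "f (x \<odot> y) = f x \<odot> f y"
    "f 0 = 0" "f (x - y) = f x - f y"
proof -
  have *: "f (x + y) = f x + f y" for x y using assms by (auto simp: automorphism_def)
  show "bij f" "f (x + y) = f x + f y" "f (c *s x) = c *s f x" "f (x \<odot> y) = f x \<odot> f y"
    using assms by (auto simp: automorphism_def)
  show "f 0 = 0" using *[of 0 0] by simp
  show "f (x - y) = f x - f y" using *[of "x - y" y] by (simp add: algebra_simps)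
qed

lemma axis_automorphism:
  assumes f: "automorphism f" and a: "axis \<Phi> \<eta> a"
  shows "axis \<Phi> \<eta> (f a)"
proof -
  note F = automorphismD(2-)[OF f]
  have surj: "\<exists>x. y = f x" for y using automorphismD(1)[OF f] by (auto simp: bij_def surj_def)
  have inj: "f x = f y \<longleftrightarrow> x = y" for x y using automorphismD(1)[OF f] by (auto simp: bij_def inj_eq)
  have all: "\<forall>y. P y" if "\<And>x. P (f x)" for P using that surj by metis
  have f0: "f z = 0 \<longleftrightarrow> z = 0" for z using F(4) inj by metis
  show ?thesis
    unfolding axis_def
  proof (intro conjI)
    show "f a \<odot> f a = f a" using axis_idem[OF a] by (simp flip: F)
    show "\<forall>x. \<exists>x0 x1 xh. x = x0 + x1 + xh \<and> f a \<odot> x0 = 0 \<and> f a \<odot> x1 = x1 \<and> f a \<odot> xh = \<eta> *s xh"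
    proof (rule all)
      fix x
      obtain x0 x1 xh where "x = x0 + x1 + xh" "a \<odot> x0 = 0" "a \<odot> x1 = x1" "a \<odot> xh = \<eta> *s xh"
        using axis_decomp[OF a, of x] by blast
      then show "\<exists>x0 x1 xh. f x = x0 + x1 + xh \<and> f a \<odot> x0 = 0 \<and> f a \<odot> x1 = x1 \<and> f a \<odot> xh = \<eta> *s xh"
        by (intro exI[of _ "f x0"] exI[of _ "f x1"] exI[of _ "f xh"])
          (simp add: F(1) F(2)[symmetric] F(3)[symmetric] F(4))
    qed
    show "\<forall>x y. f a \<odot> x = 0 \<longrightarrow> f a \<odot> y = 0 \<longrightarrow> f a \<odot> (x \<odot> y) = 0"
      by (rule all, rule all, unfold F(2,3)[symmetric] inj f0, use axis_00[OF a] in blast)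
    show "\<forall>x y. f a \<odot> x = x \<longrightarrow> f a \<odot> y = y \<longrightarrow> f a \<odot> (x \<odot> y) = x \<odot> y"
      by (rule all, rule all, unfold F(2,3)[symmetric] inj f0, use axis_11[OF a] in blast)
    show "\<forall>x y. f a \<odot> x = 0 \<longrightarrow> f a \<odot> y = y \<longrightarrow> f a \<odot> (f a \<odot> (x \<odot> y)) = f a \<odot> (x \<odot> y) \<and> (0 \<notin> \<Phi>
        \<longrightarrow> f a \<odot> (x \<odot> y) = x \<odot> y) \<and> (1 \<notin> \<Phi> \<longrightarrow> f a \<odot> (x \<odot> y) = 0)"
      by (rule all, rule all, unfold F(2,3)[symmetric] inj f0,
          use axis_01[OF a] axis_01_no0[OF a] axis_01_no1[OF a] in blast)
    show "\<forall>x y. f a \<odot> x = 0 \<longrightarrow> f a \<odot> y = \<eta> *s y \<longrightarrow> f a \<odot> (x \<odot> y) = \<eta> *s (x \<odot> y)"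
      by (rule all, rule all, unfold F(2,3)[symmetric] inj f0, use axis_0h[OF a] in blast)
    show "\<forall>x y. f a \<odot> x = x \<longrightarrow> f a \<odot> y = \<eta> *s y \<longrightarrow> f a \<odot> (x \<odot> y) = \<eta> *s (x \<odot> y)"
      by (rule all, rule all, unfold F(2,3)[symmetric] inj f0, use axis_1h[OF a] in blast)
    show "\<forall>x y. f a \<odot> x = \<eta> *s x \<longrightarrow> f a \<odot> y = \<eta> *s y \<longrightarrow> f a \<odot> (f a \<odot> (x \<odot> y)) = f a \<odot> (x \<odot> y)"
      by (rule all, rule all, unfold F(2,3)[symmetric] inj f0, use axis_hh[OF a] in blast)
  qed
qed

section \<open>Miyamoto involutions\<close>

text \<open>The polynomial \<open>1 - 2 (t^2 - t) / (\<eta>^2 - \<eta>)\<close> takes the values 1,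
  1, -1 at t = 0, 1, \<eta>. Applied to multiplication by \<open>a\<close> it changes the sign of
  the \<eta>-component, without any choice of a decomposition.\<close>

definition miyamoto :: "'f \<Rightarrow> 'v \<Rightarrow> 'v \<Rightarrow> 'v" where
  "miyamoto \<eta> a x = x - (2 / (\<eta> * \<eta> - \<eta>)) *s (a \<odot> (a \<odot> x) - a \<odot> x)"

lemma miyamoto_automorphism_commute:
  assumes "automorphism f"
  shows "f (miyamoto \<eta> a x) = miyamoto \<eta> (f a) (f x)"
  by (simp add: miyamoto_def automorphismD[OF assms])

lemma miyamoto_linear:
  "miyamoto \<eta> a (x + y) = miyamoto \<eta> a x + miyamoto \<eta> a y"
  "miyamoto \<eta> a (c *s x) = c *s miyamoto \<eta> a x"
  by (rule coord_eqI; simp add: miyamoto_def times_bilinear coord_linear algebra_simps)+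

lemma miyamoto_plus: "a \<odot> (a \<odot> x) = a \<odot> x \<Longrightarrow> miyamoto \<eta> a x = x"
  by (simp add: miyamoto_def)

lemma miyamoto_minus:
  assumes "\<eta> \<noteq> 0" "\<eta> \<noteq> 1" "a \<odot> x = \<eta> *s x"
  shows "miyamoto \<eta> a x = - x"
proof -
  have ne: "\<eta> * \<eta> - \<eta> \<noteq> 0" using assms(1,2) by (simp add: right_diff_distrib[symmetric])
  have "miyamoto \<eta> a x = x - (2 / (\<eta> * \<eta> - \<eta>)) *s ((\<eta> * \<eta> - \<eta>) *s x)"
    by (simp add: miyamoto_def assms(3) times_scale_right scale_left_diff_distrib)
  also have "\<dots> = x - 2 *s x" unfolding scale_scale by (subst nonzero_eq_divide_eq[THEN iffD1,
      OF ne refl]) (rule refl)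
  also have "\<dots> = - x" by (rule coord_eqI) (simp add: coord_linear)
  finally show ?thesis .
qed

lemma axis_decomp_graded:
  assumes "axis \<Phi> \<eta> a"
  obtains y z where "x = y + z" "a \<odot> (a \<odot> y) = a \<odot> y" "a \<odot> z = \<eta> *s z"
proof -
  obtain x0 x1 xh where x: "x = x0 + x1 + xh" "a \<odot> x0 = 0" "a \<odot> x1 = x1" "a \<odot> xh = \<eta> *s xh"
    using axis_decomp[OF assms, of x] by blast
  show ?thesis by (rule that[of "x0 + x1" xh]) (simp_all add: x times_bilinear)
qed

lemma axis_even_even:
  assumes ax: "axis \<Phi> \<eta> a" and y: "a \<odot> (a \<odot> y) = a \<odot> y" and z: "a \<odot> (a \<odot> z) = a \<odot> z"
  shows "a \<odot> (a \<odot> (y \<odot> z)) = a \<odot> (y \<odot> z)"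
proof -
  define y0 y1 z0 z1 where d: "y0 = y - a \<odot> y" "y1 = a \<odot> y" "z0 = z - a \<odot> z" "z1 = a \<odot> z"
  have e: "a \<odot> y0 = 0" "a \<odot> y1 = y1" "a \<odot> z0 = 0" "a \<odot> z1 = z1" "y = y0 + y1" "z = z0 + z1"
    using y z by (simp_all add: d times_bilinear)
  have "a \<odot> (y0 \<odot> z0) = 0" "a \<odot> (y1 \<odot> z1) = y1 \<odot> z1"
    "a \<odot> (a \<odot> (y0 \<odot> z1)) = a \<odot> (y0 \<odot> z1)" "a \<odot> (a \<odot> (y1 \<odot> z0)) = a \<odot> (y1 \<odot> z0)"
    using axisD[OF ax] e by (auto simp: times_comm[of y1 z0])
  then show ?thesis unfolding e(5,6) by (simp add: times_bilinear)
qed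

lemma axis_even_odd:
  assumes ax: "axis \<Phi> \<eta> a" and y: "a \<odot> (a \<odot> y) = a \<odot> y" and z: "a \<odot> z = \<eta> *s z"
  shows "a \<odot> (y \<odot> z) = \<eta> *s (y \<odot> z)"
proof -
  define y0 y1 where d: "y0 = y - a \<odot> y" "y1 = a \<odot> y"
  have e: "a \<odot> y0 = 0" "a \<odot> y1 = y1" "y = y0 + y1"
    using y z by (simp_all add: d times_bilinear)
  have "a \<odot> (y0 \<odot> z) = \<eta> *s (y0 \<odot> z)" "a \<odot> (y1 \<odot> z) = \<eta> *s (y1 \<odot> z)"
    using axisD[OF ax] e z by auto
  then show ?thesis unfolding e(3) by (simp add: times_bilinear scale_right_distrib)
qed

context
  fixes \<eta> :: 'f
  assumes \<eta>01: "\<eta> \<noteq> 0" "\<eta> \<noteq> 1"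
begin

lemma miyamoto_graded:
  assumes "a \<odot> (a \<odot> y) = a \<odot> y" "a \<odot> z = \<eta> *s z"
  shows "miyamoto \<eta> a (y + z) = y - z"
  using assms \<eta>01 by (simp add: miyamoto_linear miyamoto_plus miyamoto_minus)

lemma miyamoto_involution:
  assumes ax: "axis \<Phi> \<eta> a"
  shows "miyamoto \<eta> a (miyamoto \<eta> a x) = x"
proof -
  obtain y z where x: "x = y + z" "a \<odot> (a \<odot> y) = a \<odot> y" "a \<odot> z = \<eta> *s z"
    using axis_decomp_graded[OF ax] by blast
  have "miyamoto \<eta> a (y - z) = y + z"
    using miyamoto_graded[of a y "- z"] x by (simp add: times_bilinear)
  then show ?thesis using x miyamoto_graded[OF x(2,3)] by simp
qed

text \<open>The fusion rules are graded by Z/2, with 0 and 1 even and \<eta> odd, and the map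
  changes the sign of the odd part.\<close>

lemma miyamoto_automorphism:
  assumes ax: "axis \<Phi> \<eta> a"
  shows "automorphism (miyamoto \<eta> a)"
  unfolding automorphism_def
proof (intro conjI allI)
  show "bij (miyamoto \<eta> a)"
    by (rule involuntory_imp_bij) (rule miyamoto_involution[OF ax])
  show "miyamoto \<eta> a (x + y) = miyamoto \<eta> a x + miyamoto \<eta> a y" for x y
    by (rule miyamoto_linear)
  show "miyamoto \<eta> a (c *s x) = c *s miyamoto \<eta> a x" for c x
    by (rule miyamoto_linear)
  fix x x'
  obtain y z where x: "x = y + z" "a \<odot> (a \<odot> y) = a \<odot> y" "a \<odot> z = \<eta> *s z"
    using axis_decomp_graded[OF ax] by blast
  obtain y' z' where x': "x' = y' + z'" "a \<odot> (a \<odot> y') = a \<odot> y'" "a \<odot> z' = \<eta> *s z'"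
    using axis_decomp_graded[OF ax] by blast
  have "a \<odot> (a \<odot> (y \<odot> y' + z \<odot> z')) = a \<odot> (y \<odot> y' + z \<odot> z')"
    using axis_even_even[OF ax x(2) x'(2)] axis_hh[OF ax x(3) x'(3)] by (simp add: times_bilinear)
  moreover have "a \<odot> (y \<odot> z' + y' \<odot> z) = \<eta> *s (y \<odot> z' + y' \<odot> z)"
    using axis_even_odd[OF ax x(2) x'(3)] axis_even_odd[OF ax x'(2) x(3)]
    by (simp add: times_bilinear scale_right_distrib)
  ultimately have "miyamoto \<eta> a ((y \<odot> y' + z \<odot> z') + (y \<odot> z' + y' \<odot> z))
      = (y \<odot> y' + z \<odot> z') - (y \<odot> z' + y' \<odot> z)"
    by (rule miyamoto_graded)
  moreover have "x \<odot> x' = (y \<odot> y' + z \<odot> z') + (y \<odot> z' + y' \<odot> z)"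
    by (simp add: x x' times_bilinear times_comm[of y' z])
  moreover have "miyamoto \<eta> a x \<odot> miyamoto \<eta> a x' = (y \<odot> y' + z \<odot> z') - (y \<odot> z' + y' \<odot> z)"
    unfolding x(1) x'(1) miyamoto_graded[OF x(2,3)] miyamoto_graded[OF x'(2,3)]
    by (simp add: times_bilinear times_comm[of y' z])
  ultimately show "miyamoto \<eta> a (x \<odot> x') = miyamoto \<eta> a x \<odot> miyamoto \<eta> a x'" by simp
qed

end

end

text \<open>As a constant, one half is an indeterminate \<open>h\<close> with \<open>2 h = 1\<close> for \<open>algebra\<close>, which cannot
  clear denominators in an arbitrary field.\<close>

definition hf :: "'f::field" where
  "hf = 1 / 2"

lemma hf_simps: "x / 2 = hf * x" "x / 4 = hf * (hf * x)" "x / 8 = hf * (hf * (hf * x))"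
  "x / 16 = hf * (hf * (hf * (hf * x)))" for x :: "'f::field"
proof -
  have "(4 :: 'f) = 2 * 2" "(8 :: 'f) = 2 * 2 * 2" "(16 :: 'f) = 2 * 2 * 2 * 2" by simp_all
  then show "x / 2 = hf * x" "x / 4 = hf * (hf * x)" "x / 8 = hf * (hf * (hf * x))"
    "x / 16 = hf * (hf * (hf * (hf * x)))"
    by (simp_all only: hf_def times_divide_times_eq mult_1 times_divide_eq_left mult.assoc
        divide_divide_eq_left)
qed

section \<open>Dihedral sequences of axes\<close>

locale axial_sequence = total_alg +
  fixes \<Phi> :: "'a set" and \<eta> :: 'a and a :: "int \<Rightarrow> 'b"
  assumes two_neq_0: "(2 :: 'a) \<noteq> 0"
    and \<eta>_neq: "\<eta> \<noteq> 0" "\<eta> \<noteq> 1"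
    and axis: "axis \<Phi> \<eta> (a i)"
    and miyamoto_a: "miyamoto \<eta> (a i) (a j) = a (2 * i - j)"

section \<open>The dihedral sequence through two given axes\<close>

context total_alg
begin

text \<open>The state is a pair of consecutive axes. Reflecting the older one in the newer one
  yields the next axis, so the first entries run through the sequence.\<close>

definition dihedral_pair :: "'f \<Rightarrow> 'v \<times> 'v \<Rightarrow> nat \<Rightarrow> 'v \<times> 'v" where
  "dihedral_pair \<eta> xy n = ((\<lambda>(x, y). (y, miyamoto \<eta> y x)) ^^ n) xy"

lemma axial_sequence_exists:
  assumes two: "(2 :: 'f) \<noteq> 0" and \<eta>: "\<eta> \<noteq> 0" "\<eta> \<noteq> 1"
    and a0: "axis \<Phi> \<eta> a0" and a1: "axis \<Phi> \<eta> a1"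
  obtains a where "axial_sequence (*s) (\<odot>) \<Phi> \<eta> a" "a 0 = a0" "a 1 = a1"
proof -
  let ?D = "\<lambda>x y n. fst (dihedral_pair \<eta> (x, y) n)"
  have D0: "?D x y 0 = x" and D1: "?D x y (Suc 0) = y"
    and DS: "?D x y (Suc (Suc n)) = miyamoto \<eta> (?D x y (Suc n)) (?D x y n)" for x y n
    by (simp_all add: dihedral_pair_def split: prod.split)
  have ax_mi: "axis \<Phi> \<eta> (miyamoto \<eta> x y)" if "axis \<Phi> \<eta> x" "axis \<Phi> \<eta> y" for x y
    using axis_automorphism[OF miyamoto_automorphism[OF \<eta> that(1)] that(2)] .
  have axD: "axis \<Phi> \<eta> (?D x y n) \<and> axis \<Phi> \<eta> (?D x y (Suc n))"
    if "axis \<Phi> \<eta> x" "axis \<Phi> \<eta> y" for x y n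
    by (induction n) (use that ax_mi in \<open>auto simp: D0 D1 DS\<close>)
  \<comment> \<open>Two one-sided runs are glued: forwards from \<open>(a0, a1)\<close> and
    backwards from \<open>(a1, a0)\<close>, where index i sits at position \<open>1 - i\<close>.
    Both runs contain \<open>a0\<close> and \<open>a1\<close>, so the backward formula is valid up
    to index 1, and the recursion crosses the seam.\<close>
  define a where "a i = (if i \<ge> 0 then ?D a0 a1 (nat i) else ?D a1 a0 (nat (1 - i)))" for i
  have neg: "a i = ?D a1 a0 (nat (1 - i))" if "i \<le> 1" for i
  proof -
    have "i < 0 \<or> i = 0 \<or> i = 1" using that by arith
    then show ?thesis by (elim disjE) (simp_all add: a_def D0 D1 numeral_eq_Suc)
  qed
  have axes: "axis \<Phi> \<eta> (a i)" for i
    unfolding a_def using axD[OF a0 a1] axD[OF a1 a0] by simp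
  note inv = miyamoto_involution[OF \<eta> axes]
  have step: "miyamoto \<eta> (a i) (a (i - 1)) = a (i + 1)" for i
  proof (cases "i \<ge> 1")
    case True
    define n where "n = nat (i - 1)"
    have "a (i - 1) = ?D a0 a1 n" "a i = ?D a0 a1 (Suc n)" "a (i + 1) = ?D a0 a1 (Suc (Suc n))"
      using True by (simp_all add: a_def n_def nat_diff_distrib Suc_nat_eq_nat_zadd1 add.commute)
    then show ?thesis by (simp add: DS)
  next
    case False
    define n where "n = nat (- i)"
    have "nat (1 - (i - 1)) = Suc (Suc n)" "nat (1 - i) = Suc n" "nat (1 - (i + 1)) = n"
      using False by (simp_all add: n_def)
    then have "a (i - 1) = ?D a1 a0 (Suc (Suc n))" "a i = ?D a1 a0 (Suc n)" "a (i + 1) = ?D a1 a0 n"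
      using False by (simp_all add: neg)
    then have "a (i - 1) = miyamoto \<eta> (a i) (a (i + 1))" by (simp add: DS)
    then show ?thesis using inv by simp
  qed
  \<comment> \<open>The reflection at \<open>a i\<close> is an automorphism, so it carries the
    reflection at \<open>a (i + k + 1)\<close> to the one at \<open>a (i - k - 1)\<close>. Two
    neighbouring distances are proved at once because the recursion has order two.\<close>
  have refl: "miyamoto \<eta> (a i) (a (i + int k)) = a (i - int k) \<and>
      miyamoto \<eta> (a i) (a (i + int k + 1)) = a (i - int k - 1)" for i k
  proof (induction k)
    case 0
    have "miyamoto \<eta> (a i) (a i) = a i"
      by (rule miyamoto_plus) (simp add: axis_idem[OF axes])
    moreover have "miyamoto \<eta> (a i) (a (i + 1)) = a (i - 1)" using step[of i] inv by metis
    ultimately show ?case by simp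
  next
    case (Suc k)
    let ?j = "i + int k + 1" and ?l = "i - int k - 1"
    have "miyamoto \<eta> (a i) (a (?j + 1)) = miyamoto \<eta> (a i) (miyamoto \<eta> (a ?j) (a (?j - 1)))"
      by (simp only: step)
    also have "\<dots> = miyamoto \<eta> (a ?l) (a (?l + 1))"
      using Suc by (subst miyamoto_automorphism_commute[OF miyamoto_automorphism[OF \<eta> axes]]) simp
    also have "\<dots> = a (?l - 1)" using step[of ?l] inv by metis
    finally show ?case using Suc by (simp add: algebra_simps)
  qed
  have "miyamoto \<eta> (a i) (a j) = a (2 * i - j)" for i j
  proof (cases "i \<le> j")
    case True
    then show ?thesis using refl[of i "nat (j - i)"] by simp
  next
    case False
    then have "miyamoto \<eta> (a i) (a (2 * i - j)) = a j" using refl[of i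
        "nat (i - j)"] by (simp add: algebra_simps)
    then show ?thesis using inv by metis
  qed
  then have "axial_sequence (*s) (\<odot>) \<Phi> \<eta> a"
    using two \<eta> axes by unfold_locales auto
  moreover have "a 0 = a0" "a 1 = a1" by (simp_all add: a_def D0 D1)
  ultimately show ?thesis by (rule that)
qed

end

section \<open>Eigencomponents of one axis at another\<close>

context axial_sequence
begin

lemma two_hf: "2 * hf = (1 :: 'a)"
  using two_neq_0 by (simp add: hf_def)

definition p :: "int \<Rightarrow> int \<Rightarrow> 'b" where
  "p i j = a i \<odot> a j - \<eta> *s (a i + a j)"

lemma a_times_a: "a i \<odot> a j = p i j + \<eta> *s (a i + a j)"
  by (simp add: p_def)

lemma p_commute: "p i j = p j i"
  by (simp add: p_def times_comm[of "a i"] add.commute)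

text \<open>Write \<open>a j = x0 + x1 + xh\<close> with respect to \<open>a i\<close>. The
  reflected axis is \<open>x0 + x1 - xh\<close>, so \<open>x0 + x1\<close> is half the sum of the
  two axes, and \<open>p i j = (1 - \<eta>) *s x1 - \<eta> *s x0 - \<eta> *s a i\<close>. Solving
  for \<open>x0\<close> and \<open>x1\<close> gives this formula and that of
  \<open>a_part1\<close>.\<close>

definition a_part0 :: "int \<Rightarrow> int \<Rightarrow> 'b" where
  "a_part0 i j = ((1 - \<eta>) / 2) *s (a j + a (2 * i - j)) - p i j - \<eta> *s a i"

definition a_part1 :: "int \<Rightarrow> int \<Rightarrow> 'b" where
  "a_part1 i j = (\<eta> / 2) *s (a j + a (2 * i - j)) + p i j + \<eta> *s a i"

lemma a_decomp:
  obtains xh where "a i \<odot> a_part0 i j = 0" "a i \<odot> a_part1 i j = a_part1 i j" "a i \<odot> xh = \<eta> *s xh"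
    "a j = a_part0 i j + a_part1 i j + xh" "a (2 * i - j) = a_part0 i j + a_part1 i j - xh"
proof -
  obtain x0 x1 xh where x: "a j = x0 + x1 + xh"
    and e: "a i \<odot> x0 = 0" "a i \<odot> x1 = x1" "a i \<odot> xh = \<eta> *s xh"
    using axis_decomp[OF axis] by blast
  have r: "a (2 * i - j) = x0 + x1 - xh"
    using miyamoto_graded[OF \<eta>_neq, of "a i" "x0 + x1" xh] e
        by (simp add: times_bilinear x miyamoto_a[symmetric])
  have p: "p i j = (1 - \<eta>) *s x1 - \<eta> *s x0 - \<eta> *s a i"
    unfolding p_def x by (rule coord_eqI) (simp add: times_bilinear e coord_linear algebra_simps)
  have "a_part0 i j = x0" "a_part1 i j = x1"
    unfolding a_part0_def a_part1_def r unfolding x p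
    by (rule coord_eqI, simp only: coord_linear hf_simps, (algebra | use two_hf in algebra))+
  then show ?thesis using that e x r by metis
qed

lemma a_part_eig: "a i \<odot> a_part0 i j = 0" "a i \<odot> a_part1 i j = a_part1 i j"
  by (metis a_decomp)+

text \<open>In \<open>a i \<odot> a j - \<eta> *s a j\<close> the \<eta>-component of
  \<open>a j\<close> cancels, and the reflected axis differs from \<open>a j\<close> only in the
  sign of that component.\<close>

lemma p_refl: "p i (2 * i - j) = p i j"
proof -
  obtain xh where x: "a i \<odot> a_part0 i j = 0" "a i \<odot> a_part1 i j = a_part1 i j" "a i \<odot> xh = \<eta> *s xh"
    "a j = a_part0 i j + a_part1 i j + xh" "a (2 * i - j) = a_part0 i j + a_part1 i j - xh"
    by (rule a_decomp)
  show ?thesis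
    unfolding p_def x(4,5) by (rule coord_eqI) (simp add: times_bilinear x(1-3) coord_linear
        algebra_simps)
qed

lemma a_times_p:
  "a i \<odot> p i j = (1 - \<eta>) *s p i j - (\<eta> * \<eta>) *s a i + (\<eta> * (1 - \<eta>) / 2) *s (a j + a (2 * i - j))"
proof -
  have "p i j = (1 - \<eta>) *s a_part1 i j - \<eta> *s a_part0 i j - \<eta> *s a i"
    by (rule coord_eqI, simp only: a_part0_def a_part1_def coord_linear hf_simps,
        (algebra | use two_hf in algebra))
  then have "a i \<odot> p i j = (1 - \<eta>) *s a_part1 i j - \<eta> *s a i"
    by (simp add: times_bilinear a_part_eig axis_idem[OF axis])
  also have "\<dots> = (1 - \<eta>) *s p i j - (\<eta> * \<eta>) *s a i + (\<eta> * (1 - \<eta>) / 2) *s (a j + a (2 * i - j))"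
    by (rule coord_eqI, simp only: a_part1_def coord_linear hf_simps, (algebra | use two_hf in algebra))
  finally show ?thesis .
qed

lemma a_times_z: "a i \<odot> (a j + a (2 * i - j)) = 2 *s a_part1 i j"
proof -
  obtain xh where x: "a i \<odot> a_part0 i j = 0" "a i \<odot> a_part1 i j = a_part1 i j" "a i \<odot> xh = \<eta> *s xh"
    "a j = a_part0 i j + a_part1 i j + xh" "a (2 * i - j) = a_part0 i j + a_part1 i j - xh"
    by (rule a_decomp)
  show ?thesis
    unfolding x(4,5) by (rule coord_eqI) (simp add: times_bilinear x(1-3) coord_linear algebra_simps)
qed

lemma p_refl_shift: "p m (m - n) = p m (m + n)"
  using p_refl[of m "m + n"] by simp

text \<open>For fixed k the function \<open>p i (i + k)\<close> of i has period k. For k = 1 it is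
  constant, for k = 2 it depends on the parity of i.\<close>

lemma p_shift: "p i (i + k) = p (i - k) i"
  using p_refl[of i "i + k"] by (simp add: p_commute)

lemma p_const: "p (i + 1) (i + 2) = p i (i + 1)"
  using p_shift[of "i + 1" 1] by (simp add: add.commute)

lemma p_adjacent: "p i (i + 1) = p 0 1"
proof (induction i rule: int_induct[where k = 0])
  case (step1 i)
  then show ?case using p_const[of i] by (simp add: algebra_simps)
next
  case (step2 i)
  then show ?case using p_const[of "i - 1"] by (simp add: algebra_simps)
qed simp

end

section \<open>The case of eigenvalue one half\<close>

locale axial_sequence_half = axial_sequence +
  assumes half: "\<eta> = 1 / 2"
begin

definition const :: "int \<Rightarrow> bool" where
  "const n \<longleftrightarrow> (\<forall>m. p m (m + n) = p 0 n)"

lemma half_simps: "\<eta> *s x = (1 / 2) *s x" "\<eta> / 2 = 1 / 4" "\<eta> * \<eta> = 1 / 4" "1 - \<eta> = 1 / 2"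
  "\<eta> * (1 - \<eta>) / 2 = 1 / 8" "(1 - \<eta>) / 2 = 1 / 4"
  using two_hf unfolding half hf_simps by (simp, algebra?)+

lemma a_a: "a i \<odot> a j = p i j + (1 / 2) *s (a i + a j)"
  using a_times_a by (simp add: half_simps)

lemma p_period: "p (m + n) (m + n + n) = p m (m + n)"
  using p_shift[of "m + n" n] by simp

lemma const_minus:
  assumes "const n"
  shows "const (- n)"
  using assms p_refl_shift[of _ n] p_refl_shift[of 0 n] by (simp add: const_def)

lemma a_p: "a m \<odot> p m (m + n) = (1 / 2) *s p m (m + n) - (1 / 4) *s a m + (1 / 8) *s (a (m + n) + a (m
    - n))"
  using a_times_p[of m "m + n"] unfolding half_simps(5) unfolding half_simps(1,3,4) by simp

lemma a_p_const:
  assumes "const n"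
  shows "a m \<odot> p 0 n = (1 / 2) *s p 0 n - (1 / 4) *s a m + (1 / 8) *s (a (m + n) + a (m - n))"
  using a_p[of m n] assms by (simp add: const_def)

lemma p_self: "p m m = 0"
  unfolding p_def axis_idem[OF axis] half_simps(1)
  by (rule coord_eqI, simp only: coord_linear hf_simps, (algebra | use two_hf in algebra))

text \<open>The eigencomponents of \<open>a (c + i)\<close> and \<open>a (c + j)\<close> at the
  centre \<open>a c\<close> are multiplied. By \<open>const i\<close> and \<open>const j\<close> the
  left side does not depend on c, whereas the right side samples \<open>p\<close> around c at the
  distances \<open>i + j\<close> and \<open>i - j\<close>.\<close>

lemma p_p_const:
  assumes i: "const i" and j: "const j"
  shows "p 0 i \<odot> p 0 j = - ((1 / 4) *s (p 0 i + p 0 j)) + (1 / 4) *s (p c (c + (i + j)) + p c (c + (i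
      - j)))
    - (1 / 16) *s (p (c + i) (c + j) + p (c + i) (c - j) + p (c - i) (c + j) + p (c - i) (c - j))"
    (is "?L = ?R")
proof -
  define u0 u1 v0 v1 where d: "u0 = (1 / 4) *s (a (c + i) + a (c - i)) - p 0 i - (1 / 2) *s a c"
    "u1 = (1 / 4) *s (a (c + i) + a (c - i)) + p 0 i + (1 / 2) *s a c"
    "v0 = (1 / 4) *s (a (c + j) + a (c - j)) - p 0 j - (1 / 2) *s a c"
    "v1 = (1 / 4) *s (a (c + j) + a (c - j)) + p 0 j + (1 / 2) *s a c"
  have pc: "p c (c + i) = p 0 i" "p c (c + j) = p 0 j" "p c (c - i) = p 0 i" "p c (c - j) = p 0 j"
    "p (c + i) c = p 0 i" "p (c + j) c = p 0 j" "p (c - i) c = p 0 i" "p (c - j) c = p 0 j"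
    using i j p_refl_shift by (simp_all add: const_def p_commute[of _ c])
  have "u0 = a_part0 c (c + i)" "u1 = a_part1 c (c + i)" "v0 = a_part0 c (c + j)"
      "v1 = a_part1 c (c + j)"
    unfolding d a_part0_def a_part1_def half_simps pc by simp_all
  then have "a c \<odot> (u0 \<odot> v0) = 0" "a c \<odot> (u1 \<odot> v1) = u1 \<odot> v1"
    using axis_00[OF axis] axis_11[OF axis] a_part_eig by simp_all
  \<comment> \<open>The unknown \<open>p 0 i \<odot> p 0 j\<close> has the same coefficient in
    \<open>u0 \<odot> v0\<close> and in \<open>u1 \<odot> v1\<close>. It cancels in the difference
    and survives only on the right, so the equation can be solved for it.\<close>
  then have X: "a c \<odot> (u1 \<odot> v1 - u0 \<odot> v0) = u1 \<odot> v1" by (simp add: times_bilinear)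
  have r: "p c (c - (i + j)) = p c (c + (i + j))" "p c (c - (i - j)) = p c (c + (i - j))"
    by (rule p_refl_shift)+
  have q: "a m \<odot> p 0 i = (1 / 2) *s p 0 i - (1 / 4) *s a m + (1 / 8) *s (a (m + i) + a (m - i))"
    "p 0 i \<odot> a m = (1 / 2) *s p 0 i - (1 / 4) *s a m + (1 / 8) *s (a (m + i) + a (m - i))"
    "a m \<odot> p 0 j = (1 / 2) *s p 0 j - (1 / 4) *s a m + (1 / 8) *s (a (m + j) + a (m - j))"
    "p 0 j \<odot> a m = (1 / 2) *s p 0 j - (1 / 4) *s a m + (1 / 8) *s (a (m + j) + a (m - j))" for m
    using a_p_const[OF i] a_p_const[OF j] by (simp_all add: times_comm)
  have idx: "c + i + j = c + (i + j)" "c + j + i = c + (i + j)" "c + i - j = c + (i - j)"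
      "c - j + i = c + (i - j)"
    "c + j - i = c - (i - j)" "c - i + j = c - (i - j)" "c - i - j = c - (i + j)"
        "c - j - i = c - (i + j)"
    by simp_all
  have S: "u1 \<odot> v1 - u0 \<odot> v0 = p 0 i + p 0 j + (1 / 2) *s a c
      + (1 / 8) *s (a (c + (i + j)) + a (c - (i + j)) + a (c + (i - j)) + a (c - (i - j)))"
  proof -
    have "u1 \<odot> v1 - u0 \<odot> v0 = (1 / 2) *s ((p 0 i + (1 / 2) *s a c) \<odot> (a (c + j) + a (c - j))
        + (p 0 j + (1 / 2) *s a c) \<odot> (a (c + i) + a (c - i)))"
      unfolding d times_bilinear times_comm[of "a (c + i)"] times_comm[of "a (c - i)"]
      by (rule coord_eqI, simp only: coord_linear hf_simps, (algebra | use two_hf in algebra))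
    also have "\<dots> = p 0 i + p 0 j + (1 / 2) *s a c
      + (1 / 8) *s (a (c + (i + j)) + a (c - (i + j)) + a (c + (i - j)) + a (c - (i - j)))"
      unfolding times_bilinear q a_a pc idx
      by (rule coord_eqI, simp only: coord_linear hf_simps, (algebra | use two_hf in algebra))
    finally show ?thesis .
  qed
  have "u1 \<odot> v1 - a c \<odot> (u1 \<odot> v1 - u0 \<odot> v0) = ?L - ?R"
    unfolding S unfolding d times_bilinear q a_a pc r idx p_self
    by (rule coord_eqI, simp only: coord_linear hf_simps, (algebra | use two_hf in algebra))
  then show ?thesis using X by simp
qed

text \<open>In \<open>p_p_const\<close> the values at distance \<open>i - j\<close> are constant by
  assumption. What remains involves only the distance \<open>i + j\<close>, and it equals an
  expression in which c does not occur.\<close>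

lemma p_sum_const:
  assumes i: "const i" and j: "const j" and ij: "const (i - j)"
  obtains K where "\<And>c. 4 *s p c (c + (i + j)) - p (c - j) (c - j + (i + j)) - p (c + j) (c + j + (i
      + j)) = K"
proof -
  have "4 *s p c (c + (i + j)) - p (c - j) (c - j + (i + j)) - p (c + j) (c + j + (i + j))
      = 16 *s (p 0 i \<odot> p 0 j + (1 / 4) *s (p 0 i + p 0 j)) - 2 *s p 0 (i - j)" (is "?L c = ?R") for c
  proof -
    have "p c (c + (i - j)) = p 0 (i - j)" "p (c + j) (c + i) = p 0 (i - j)"
      using ij unfolding const_def by (auto dest: spec[of _ "c + j"])
    moreover have "p (c - i) (c - j) = p 0 (i - j)"
      using ij unfolding const_def by (auto dest: spec[of _ "c - i"])
    moreover have "p (c + i) (c + j) = p (c + j) (c + i)"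
        "p (c + i) (c - j) = p (c - j) (c - j + (i + j))"
      using p_commute[of "c + i"] by (simp_all add: algebra_simps)
    \<comment> \<open>The base points \<open>c - i\<close> and \<open>c + j\<close> differ by
      \<open>i + j\<close>, which is a period at this distance.\<close>
    moreover have "p (c - i) (c + j) = p (c + j) (c + j + (i + j))"
      using p_period[of "c - i" "i + j"] by (simp add: algebra_simps)
    ultimately have E: "p 0 i \<odot> p 0 j = - ((1 / 4) *s (p 0 i + p 0 j)) + (1 / 4) *s (p c (c + (i + j))
        + p 0 (i - j))
        - (1 / 16) *s (p 0 (i - j) + p (c - j) (c - j + (i + j)) + p (c + j) (c + j + (i + j)) + p 0
            (i - j))"
      using p_p_const[OF i j, of c] by simp
    show ?thesis
    proof (rule coord_eqI)
      fix b
      from E[THEN arg_cong, of "coord b"] two_hf show "coord b (?L c) = coord b ?R"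
        unfolding coord_linear hf_simps by algebra
    qed
  qed
  then show ?thesis by (rule that)
qed

lemma constI:
  assumes "\<And>m. p (m + 1) (m + 1 + n) = p m (m + n)"
  shows "const n"
proof -
  have "p m (m + n) = p 0 n" for m
  proof (induction m rule: int_induct[where k = 0])
    case (step1 m)
    then show ?case using assms[of m] by simp
  next
    case (step2 m)
    then show ?case using assms[of "m - 1"] by simp
  qed simp
  then show ?thesis by (simp add: const_def)
qed

lemma const_0: "const 0"
  by (simp add: const_def p_self)

lemma const_1: "const 1"
  using p_adjacent by (simp add: const_def)

text \<open>Let D be the increments of \<open>P m = p m (m + n)\<close>. All smaller distances are
  constant by induction, so \<open>p_sum_const\<close> gives
  \<open>4 D(c) = D(c - j) + D(c + j)\<close> for 0 < j < n. Periodicity of P makes the sum of D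
  over n consecutive places vanish, which gives \<open>6 D = 0\<close> for n = 2 and
  \<open>5 D = 0\<close> for n = 3. For larger n, the relation for j = 1 used twice gives
  \<open>16 D(c) = D(c - 2) + 2 D(c) + D(c + 2)\<close>; by the relation for j = 2 the right side is
  \<open>6 D(c)\<close>, so \<open>10 D = 0\<close>. This is where the primes 3 and 5 come
  from.\<close>

lemma const_by_char:
  assumes 3: "(3 :: 'a) \<noteq> 0" and 5: "(5 :: 'a) \<noteq> 0"
  shows "const (int n)"
proof (induction n rule: less_induct)
  case (less n)
  define P where "P m = p m (m + int n)" for m
  define D where "D m = P (m + 1) - P m" for m
  have rec: "4 *s D c = D (c - int j) + D (c + int j)" if j: "0 < j" "j < n" for j c
  proof -
    have "const (int (n - j))" "const (int j)" by (rule less, use j in simp)+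
    moreover have "const (int (n - j) - int j)"
    proof (cases "j \<le> n - j")
      case True
      then show ?thesis using less[of "n - j - j"] j by (simp add: of_nat_diff)
    next
      case False
      then have "const (- int (j - (n - j)))" using less[of "j - (n - j)"] j by (intro const_minus) simp
      then show ?thesis using False j by (simp add: of_nat_diff algebra_simps)
    qed
    moreover have "int (n - j) + int j = int n" using j by simp
    ultimately obtain K where K: "\<And>c. 4 *s P c - P (c - int j) - P (c + int j) = K"
      using p_sum_const[of "int (n - j)" "int j"] unfolding P_def by metis
    show ?thesis
      unfolding D_def using K[of c] K[of "c + 1"]
      by (simp add: algebra_simps scale_right_diff_distrib)
  qed
  have per: "P (m + int n) = P m" for m using p_period[of m "int n"] by (simp add: P_def)
  have "D m = 0" if "n \<ge> 2" for m
  proof -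
    consider "n = 2" | "n = 3" | "n \<ge> 4" using \<open>n \<ge> 2\<close> by linarith
    then show ?thesis
    proof cases
      case 1
      have "D (m - 1) = - D m" "D (m + 1) = - D m"
        using per[of "m - 1"] per[of m] 1 by (simp_all add: D_def add.commute)
      then have "4 *s D m = - D m - D m" using rec[of 1 m] 1 by simp
      then have "6 *s D m = 0"
        using scale_left_distrib[of 4 2 "D m"] scale_left_distrib[of 1 1 "D m"] by simp
      moreover have "(6 :: 'a) = 2 * 3" by simp
      ultimately show ?thesis using 3 two_neq_0 by (metis mult_eq_0_iff scale_eq_0_iff)
    next
      case 2
      have "D (m - 1) + D m + D (m + 1) = 0"
        using per[of "m - 1"] 2 by (simp add: D_def)
      then have "4 *s D m + D m = 0" using rec[of 1 m] 2 by (simp add: algebra_simps)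
      then have "5 *s D m = 0" using scale_left_distrib[of 4 1 "D m"] by simp
      then show ?thesis using 5 by simp
    next
      case 3
      have "10 *s D m = 0"
      proof (rule coord_eqI)
        fix b
        note eqs = rec[of 1 "m - 1"] rec[of 1 "m + 1"] rec[of 1 m] rec[of 2 m]
        from eqs[THEN arg_cong[where f = "coord b"]] 3
        show "coord b (10 *s D m) = coord b 0"
          by (simp add: coord_linear algebra_simps) algebra
      qed
      moreover have "(10 :: 'a) = 2 * 5" by simp
      ultimately show ?thesis using 5 two_neq_0 by (metis mult_eq_0_iff scale_eq_0_iff)
    qed
  qed
  then have "const (int n)" if "n \<ge> 2"
    using that by (intro constI) (simp add: D_def P_def)
  moreover have "const (int n)" if "n < 2"
    using that const_0 const_1 by (cases "n = 0") (auto simp: less_2_cases_iff)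
  ultimately show ?case by linarith
qed

text \<open>For empty \<open>\<Phi>\<close> the product of a 0-eigenvector and a 1-eigenvector is
  zero. These extra equations eliminate the products that can only be evaluated when distance j is
  already known to be constant, so the identity holds for every j.\<close>

lemma p_second_difference:
  assumes empty: "\<Phi> = {}"
  shows "p (c + 1) (c + j) + p (c + 1) (c - j) + p (c - 1) (c + j) + p (c - 1) (c - j)
    = 2 *s (p c (c + (j + 1)) + p c (c + (j - 1)))"
proof -
  define u v z w where d: "u = p 0 1 + (1 / 2) *s a c" "v = p c (c + j) + (1 / 2) *s a c"
    "z = a (c + 1) + a (c - 1)" "w = a (c + j) + a (c - j)"
  define u0 u1 v0 v1 where e: "u0 = (1 / 4) *s z - u" "u1 = (1 / 4) *s z + u"
    "v0 = (1 / 4) *s w - v" "v1 = (1 / 4) *s w + v"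
  have pc: "p c (c + 1) = p 0 1" "p c (c - 1) = p 0 1" "p (c + 1) c = p 0 1" "p (c - 1) c = p 0 1"
    "p c (c - j) = p c (c + j)"
    using const_1 p_refl_shift by (simp_all add: const_def p_commute[of _ c])
  have "u0 = a_part0 c (c + 1)" "u1 = a_part1 c (c + 1)" "v0 = a_part0 c (c + j)"
      "v1 = a_part1 c (c + j)"
    unfolding d e a_part0_def a_part1_def half_simps pc by (simp_all add: algebra_simps)
  then have eig: "a c \<odot> u0 = 0" "a c \<odot> u1 = u1" "a c \<odot> v0 = 0" "a c \<odot> v1 = v1"
    using a_part_eig by simp_all
  have "u0 \<odot> v1 = 0" "v0 \<odot> u1 = 0"
    using axis_01_no0[OF axis eig(1,4)] axis_01_no1[OF axis eig(1,4)]
      axis_01_no0[OF axis eig(3,2)] axis_01_no1[OF axis eig(3,2)] empty by simp_all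
  then have uv: "u0 \<odot> v1 = 0" "u1 \<odot> v0 = 0" by (simp_all add: times_comm)
  have "a c \<odot> (u0 \<odot> v0) = 0" "a c \<odot> (u1 \<odot> v1) = u1 \<odot> v1"
    using axis_00[OF axis] axis_11[OF axis] eig by simp_all
  then have X: "a c \<odot> (u1 \<odot> v1 - u0 \<odot> v0) = u1 \<odot> v1" by (simp add: times_bilinear)
  \<comment> \<open>Adding and subtracting the two vanishing products gives
    \<open>u \<odot> v = (1 / 16) *s (z \<odot> w)\<close> and
    \<open>z \<odot> v = u \<odot> w\<close>. So the unknown products of \<open>v\<close> with
    \<open>u\<close> and \<open>z\<close> are replaced by products of axes and by products of
    \<open>p 0 1\<close> with axes.\<close>
  have s: "u1 \<odot> v1 - u0 \<odot> v0 = u \<odot> w" "u1 \<odot> v1 = (1 / 8) *s (z \<odot> w) + (1 / 2) *s (u \<odot> w)"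
    using uv unfolding atomize_conj
  proof -
    have D: "coord b (u0 \<odot> v1) = 0" "coord b (u1 \<odot> v0) = 0" for b using uv by (simp_all add: coord_zero)
    have "coord b (u1 \<odot> v1 - u0 \<odot> v0) = coord b (u \<odot> w)"
      "coord b (u1 \<odot> v1) = coord b ((1 / 8) *s (z \<odot> w) + (1 / 2) *s (u \<odot> w))" for b
      using D[of b] two_hf unfolding e times_bilinear coord_linear hf_simps by algebra+
    then show "u1 \<odot> v1 - u0 \<odot> v0 = u \<odot> w \<and> u1 \<odot> v1 = (1 / 8) *s (z \<odot> w) + (1 / 2) *s (u \<odot> w)"
      by (intro conjI coord_eqI)
  qed
  have r: "p c (c - (j + 1)) = p c (c + (j + 1))" "p c (c - (j - 1)) = p c (c + (j - 1))"
    by (rule p_refl_shift)+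
  have q: "a m \<odot> p 0 1 = (1 / 2) *s p 0 1 - (1 / 4) *s a m + (1 / 8) *s (a (m + 1) + a (m - 1))"
    "p 0 1 \<odot> a m = (1 / 2) *s p 0 1 - (1 / 4) *s a m + (1 / 8) *s (a (m + 1) + a (m - 1))" for m
    using a_p_const[OF const_1] by (simp_all add: times_comm)
  have idx: "c + j + 1 = c + (j + 1)" "c + j - 1 = c + (j - 1)" "c - j + 1 = c - (j - 1)"
      "c - j - 1 = c - (j + 1)"
    by simp_all
  have uw: "u \<odot> w = p 0 1 + p c (c + j) + (1 / 2) *s a c
      + (1 / 8) *s (a (c + (j + 1)) + a (c - (j + 1)) + a (c + (j - 1)) + a (c - (j - 1)))"
    unfolding d times_bilinear q a_a pc idx
    by (rule coord_eqI, simp only: coord_linear hf_simps, use two_hf in algebra)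
  have "8 *s (u1 \<odot> v1 - a c \<odot> (u1 \<odot> v1 - u0 \<odot> v0)) = p (c + 1) (c + j) + p (c + 1) (c - j) + p (c
      - 1) (c + j)
      + p (c - 1) (c - j) - 2 *s (p c (c + (j + 1)) + p c (c + (j - 1)))"
    unfolding s(1) unfolding s(2) uw unfolding d times_bilinear q a_a pc a_p r p_self
    by (rule coord_eqI, simp only: coord_linear hf_simps, use two_hf in algebra)
  then show ?thesis using X by simp
qed

text \<open>The increment of \<open>p c (c + n)\<close> in c is independent of c, since
  \<open>p_second_difference\<close> with j = n - 1 relates the distances n and n - 2. By period n,
  n times this increment is zero. The remaining n, those that vanish in the field, are reached from
  the distances n - 1 and n - 2.\<close>

lemma const_by_empty:
  assumes empty: "\<Phi> = {}"
  shows "const (int n)"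
proof -
  have ap: "p (c + 1) (c + 1 + int n) + p (c - 1) (c - 1 + int n) = 2 *s p c (c + int n)" for n c
  proof (induction n rule: less_induct)
    case (less n)
    have two: "x + x = 2 *s x" for x using scale_left_distrib[of 1 1 x] by simp
    consider "n = 0" | "n = 1" | "n \<ge> 2" by linarith
    then show ?case
    proof cases
      case 1
      then show ?thesis by (simp add: p_self)
    next
      case 2
      have "p (c + 1) (c + 1 + 1) = p 0 1" "p (c - 1) (c - 1 + 1) = p 0 1" "p c (c + 1) = p 0 1"
        using const_1 unfolding const_def by blast+
      then show ?thesis using 2 by (simp add: two)
    next
      case 3
      then have "int (n - 2) = int n - 2" by simp
      \<comment> \<open>The second difference at distance n - 2 vanishes by induction; it is
        subtracted below from the identity that contains both distances.\<close>
      then have L: "p (c + 1) (c + int n - 1) + p (c - 1) (c + int n - 3) = 2 *s p c (c + int n - 2)"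
        using less.IH[of "n - 2"] 3 by (simp add: algebra_simps)
      have R: "p (c + 1) (c - int n + 1) = p (c + 1) (c + 1 + int n)"
        "p (c - 1) (c - int n + 1) = p (c - 1) (c + int n - 3)"
        using p_refl_shift[of "c + 1" "int n"] p_refl_shift[of "c - 1"
            "int n - 2"] by (simp_all add: algebra_simps)
      have "p (c + 1) (c + (int n - 1)) + p (c + 1) (c - (int n - 1)) + p (c - 1) (c + (int n - 1))
          + p (c - 1) (c - (int n - 1))
          = 2 *s (p c (c + int n) + p c (c + int n - 2))"
        using p_second_difference[OF empty, of c "int n - 1"] by (simp add: algebra_simps)
      then have "p (c + 1) (c + 1 + int n) + p (c - 1) (c - 1 + int n) + 2 *s p c (c + int n - 2)
          = 2 *s p c (c + int n) + 2 *s p c (c + int n - 2)"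
        using R unfolding L[symmetric] by (simp add: algebra_simps) (use L in \<open>simp add: algebra_simps\<close>)
      then show ?thesis by simp
    qed
  qed
  have nonzero: "const (int n)" if n: "of_nat n \<noteq> (0 :: 'a)" for n
  proof (rule constI)
    fix m
    define P where "P c = p c (c + int n)" for c
    have "P (c + 1) + P (c - 1) = P c + P c" for c
      using ap[of c n] scale_left_distrib[of 1 1 "P c"] by (simp add: P_def)
    then have "P (c + 1) = P c + P c - P (c - 1)" for c by (simp add: eq_diff_eq)
    then have D: "P (c + 1) - P c = P c - P (c - 1)" for c by simp
    have D': "P (m + int k + 1) - P (m + int k) = P (m + 1) - P m" for k
    proof (induction k)
      case (Suc k)
      have "m + int (Suc k) = m + int k + 1" by simp
      then show ?case using D[of "m + int k + 1"] Suc by (simp only: add_diff_cancel_right')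
    qed simp
    have "P (m + int k) = P m + of_nat k *s (P (m + 1) - P m)" for k
    proof (induction k)
      case (Suc k)
      have "P (m + int (Suc k)) = P (m + int k) + (P (m + 1) - P m)"
        using D'[of k] by (simp add: algebra_simps)
      then show ?case using Suc by (simp add: scale_left_distrib algebra_simps)
    qed simp
    from this[of n] have "of_nat n *s (P (m + 1) - P m) = 0"
      using p_period[of m "int n"] by (simp add: P_def)
    then have "P (m + 1) = P m" using n by (simp only: scale_eq_0_iff) simp
    then show "p (m + 1) (m + 1 + int n) = p m (m + int n)" by (simp add: P_def)
  qed
  show ?thesis
  proof (cases "of_nat n = (0 :: 'a)")
    case False
    then show ?thesis by (rule nonzero)
  next
    case True
    show ?thesis
    proof (cases "n = 0")
      case True
      then show ?thesis using const_0 by simp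
    next
      case False
      have "n \<noteq> 1" "n \<noteq> 2" using True two_neq_0 by auto
      then have n: "n \<ge> 3" using False by linarith
      have e: "of_nat (n - 1) = (of_nat n :: 'a) - 1" "of_nat (n - 2) = (of_nat n :: 'a) - 2"
        using n by (simp_all add: of_nat_diff)
      \<comment> \<open>In the field, n - 1 and n - 2 are -1 and -2, hence nonzero. So
        \<open>p_sum_const\<close> applies with j = 1. Its combination of three values collapses to
        twice the middle one, because the values form an arithmetic progression.\<close>
      have "const (int (n - 1))" "const (int (n - 2))"
        using e True two_neq_0 by (auto intro!: nonzero)
      moreover have "int (n - 1) - 1 = int (n - 2)" "int (n - 1) + 1 = int n" using n by simp_all
      ultimately obtain K where K: "\<And>c. 4 *s p c (c + int n) - p (c - 1) (c - 1 + int n) - p (c + 1) (c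
          + 1 + int n) = K"
        using p_sum_const[of "int (n - 1)" 1] const_1 by metis
      have "2 *s p c (c + int n) = K" for c
        using K[of c] ap[of c n] scale_left_distrib[of 2 2 "p c (c + int n)"]
            by (simp add: algebra_simps)
      then have "2 *s p c (c + int n) = 2 *s p 0 (int n)" for c by (metis add_0)
      then show ?thesis using two_neq_0 by (simp add: const_def)
    qed
  qed
qed

lemma const_all:
  assumes "\<Phi> = {} \<or> ((3 :: 'a) \<noteq> 0 \<and> (5 :: 'a) \<noteq> 0)"
  shows "const n"
proof -
  have "const (int k)" for k using assms const_by_empty const_by_char by blast
  then show ?thesis using const_minus by (cases n rule: int_cases2) auto
qed

theorem half_relations:
  assumes "\<Phi> = {} \<or> ((3 :: 'a) \<noteq> 0 \<and> (5 :: 'a) \<noteq> 0)"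
  shows "a i \<odot> a j = p 0 \<bar>i - j\<bar> + (1 / 2) *s (a i + a j)"
    and "a i \<odot> p 0 n = (1 / 2) *s p 0 n - (1 / 4) *s a i + (1 / 8) *s (a (i - n) + a (i + n))"
    and "p 0 m \<odot> p 0 n = - ((1 / 4) *s (p 0 m + p 0 n)) + (1 / 8) *s (p 0 (m + n) + p 0 \<bar>m - n\<bar>)"
proof -
  note C = const_all[OF assms]
  have diff: "p i j = p 0 (j - i)" for i j using C[of "j - i"] unfolding const_def
      by (metis add_diff_cancel_left' add.commute diff_add_cancel)
  have neg: "p 0 (- n) = p 0 n" for n using p_refl_shift[of 0 n] by simp
  have abs: "p 0 \<bar>n\<bar> = p 0 n" for n using neg by (simp add: abs_if)
  have abs': "p i j = p 0 \<bar>i - j\<bar>" for i j using diff[of i j] abs[of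
      "j - i"] by (simp add: abs_minus_commute)
  show "a i \<odot> a j = p 0 \<bar>i - j\<bar> + (1 / 2) *s (a i + a j)" using a_a abs' by metis
  show "a i \<odot> p 0 n = (1 / 2) *s p 0 n - (1 / 4) *s a i + (1 / 8) *s (a (i - n) + a (i + n))"
    using a_p_const[OF C] by (simp add: add.commute)
  have "p 0 m \<odot> p 0 n = - ((1 / 4) *s (p 0 m + p 0 n)) + (1 / 4) *s (p 0 (m + n) + p 0 (m - n))
    - (1 / 16) *s (p 0 (m - n) + p 0 (m + n) + p 0 (m + n) + p 0 (m - n))"
  proof -
    have "p m n = p 0 (m - n)" "p m (- n) = p 0 (m + n)" "p (- m) n = p 0 (m + n)"
        "p (- m) (- n) = p 0 (m - n)"
      using diff[of m n] diff[of m "- n"] diff[of "- m" n] diff[of "- m" "- n"] neg[of "n + m"] neg[of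
          "m - n"]
      by (simp_all add: add.commute minus_diff_commute[of n m])
    then show ?thesis using p_p_const[OF C C, of m n 0] by simp
  qed
  also have "\<dots> = - ((1 / 4) *s (p 0 m + p 0 n)) + (1 / 8) *s (p 0 (m + n) + p 0 (m - n))"
    by (rule coord_eqI, simp only: coord_linear hf_simps, use two_hf in algebra)
  finally show "p 0 m \<odot> p 0 n = - ((1 / 4) *s (p 0 m + p 0 n)) + (1 / 8) *s (p 0 (m + n) + p 0 \<bar>m - n\<bar>)"
    by (simp add: abs)
qed

end

section \<open>The generic case\<close>

locale axial_sequence_no1 = axial_sequence +
  assumes no1: "1 \<notin> \<Phi>" and not_half: "2 * \<eta> \<noteq> 1"
begin

abbreviation P :: 'b where "P \<equiv> p 0 1"

lemma p_succ: "p m (m + 1) = P" "p m (m - 1) = P" "p (m + 1) m = P" "p (m - 1) m = P"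
  using p_adjacent[of m] p_adjacent[of "m - 1"] by (simp_all add: p_commute)

lemma p_two: "p (m + 2) (m + 4) = p m (m + 2)" "p (m - 1) (m + 1) = p (m + 1) (m + 3)"
  using p_shift[of "m + 2" 2] p_shift[of "m + 1" 2] by (simp_all add: add.commute)

lemma a_P: "a m \<odot> P = (1 - \<eta>) *s P - (\<eta> * \<eta>) *s a m + (\<eta> * (1 - \<eta>) / 2) *s (a (m + 1) + a (m - 1))"
  and P_a: "P \<odot> a m = (1 - \<eta>) *s P - (\<eta> * \<eta>) *s a m + (\<eta> * (1 - \<eta>) / 2) *s (a (m + 1) + a (m - 1))"
  using a_times_p[of m "m + 1"] p_succ(1)[of m] by (simp_all add: times_comm)

lemma a_E: "a m \<odot> p m (m + 2) = (1 - \<eta>) *s p m (m + 2) - (\<eta> * \<eta>) *s a m + (\<eta> * (1 - \<eta>) / 2) *s (a (m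
    + 2) + a (m - 2))"
  using a_times_p[of m "m + 2"] by simp

lemma p_self: "p m m = (1 - 2 * \<eta>) *s a m"
  unfolding p_def axis_idem[OF axis] by (rule coord_eqI, simp only: coord_linear, algebra)

text \<open>Put \<open>z = a (c + 1) + a (c - 1) = 2 (x0 + x1)\<close>. As 1 is not in
  \<open>\<Phi>\<close>, the axis kills \<open>x0 \<odot> x1\<close>; hence it kills
  \<open>x0 \<odot> z\<close> and maps \<open>x1 \<odot> z\<close> to
  \<open>2 *s (x1 \<odot> x1)\<close>. Neither product with z involves \<open>P \<odot> P\<close>.
  The first equation determines the product of \<open>a c\<close> with
  \<open>p (c - 1) (c + 1)\<close>, which enters through \<open>z \<odot> z\<close>; the second one
  then yields \<open>P \<odot> P\<close>.\<close>

lemma a_times_o: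
  "a c \<odot> p (c - 1) (c + 1) = (1 - 2 * \<eta>) *s P + \<eta> *s p c (c + 2) - (\<eta> * \<eta>) *s a c
    + (\<eta> / 2 * (1 - 2 * \<eta>)) *s (a (c + 1) + a (c - 1)) + (\<eta> * \<eta> / 2) *s (a (c + 2) + a (c - 2))"
    (is "?L = ?R")
  and P_times_P:
  "P \<odot> P = (1 - 4 * \<eta> + 2 * \<eta> * \<eta>) *s P - (\<eta> * \<eta> / 2) *s p (c - 1) (c + 1) + (\<eta> / 2) *s p c (c + 2)
    + (\<eta> * \<eta> * (2 * \<eta> - 1) / 4) *s (a (c + 2) + a (c - 2))
    + (\<eta> * (2 - \<eta>) * (1 - 2 * \<eta>) / 4) *s (a (c + 1) + a (c - 1))
    + (\<eta> * (1 - \<eta>) * (1 - 2 * \<eta>) / 2) *s a c"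
    (is "_ = ?R'")
proof -
  define z where d: "z = a (c + 1) + a (c - 1)"
  define x0 x1 where e: "x0 = ((1 - \<eta>) / 2) *s z - P - \<eta> *s a c" "x1 = (\<eta> / 2) *s z + P + \<eta> *s a c"
  have x: "x0 = a_part0 c (c + 1)" "x1 = a_part1 c (c + 1)"
    unfolding d e a_part0_def a_part1_def p_succ by simp_all
  have eig: "a c \<odot> x0 = 0" "a c \<odot> x1 = x1" unfolding x by (rule a_part_eig)+
  have z: "z = x0 + x0 + x1 + x1"
    unfolding e by (rule coord_eqI, simp only: coord_linear hf_simps, use two_hf in algebra)
  have X: "a c \<odot> (x0 \<odot> z) = 0"
    using axis_00[OF axis eig(1,1)] axis_01_no1[OF axis eig no1] unfolding z
        by (simp add: times_bilinear)
  have Y: "a c \<odot> (x1 \<odot> z) = 2 *s (x1 \<odot> x1)"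
    using axis_11[OF axis eig(2,2)] axis_01_no1[OF axis eig no1] unfolding z
    by (simp add: times_bilinear times_comm[of x1 x0] scale_left_distrib[of 1 1, simplified])
  have idx: "c + 1 + 1 = c + 2" "c - 1 - 1 = c - 2" "c + 1 - 1 = c" "c - 1 + 1 = c" by simp_all
  have pz: "P \<odot> z = (2 * (1 - \<eta>)) *s P - (\<eta> * \<eta>) *s z + (\<eta> * (1 - \<eta>) / 2) *s (2 *s a c + a (c + 2)
      + a (c - 2))"
    unfolding d times_bilinear P_a idx by (rule coord_eqI, simp only: coord_linear hf_simps, algebra)
  have az: "a c \<odot> z = 2 *s P + (2 * \<eta>) *s a c + \<eta> *s z"
    unfolding d times_bilinear a_times_a p_succ by (rule coord_eqI, simp only: coord_linear, algebra)
  have zz: "z \<odot> z = (1 + 2 * \<eta>) *s z + 2 *s p (c - 1) (c + 1)"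
    unfolding d times_bilinear axis_idem[OF axis] a_times_a p_commute[of "c + 1"] p_self
    by (rule coord_eqI, simp only: coord_linear, algebra)
  have az2: "a c \<odot> (a (c + 2) + a (c - 2)) = 2 *s p c (c + 2) + (2 * \<eta>) *s a c + \<eta> *s (a (c + 2) + a (c
      - 2))"
    unfolding times_bilinear a_times_a p_refl_shift by (rule coord_eqI, simp only: coord_linear,
        algebra)
  have x0z: "x0 \<odot> z = ((1 - \<eta>) / 2) *s (z \<odot> z) - P \<odot> z - \<eta> *s (a c \<odot> z)"
    and x1z: "x1 \<odot> z = (\<eta> / 2) *s (z \<odot> z) + P \<odot> z + \<eta> *s (a c \<odot> z)"
    unfolding e by (simp_all add: times_bilinear)
  \<comment> \<open>Bilinear expansion splits the sum \<open>a (c + 2) + a (c - 2)\<close>, so its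
    product with \<open>a c\<close> is recorded as a rule for one of the summands.\<close>
  have az2': "a c \<odot> a (c + 2) = 2 *s p c (c + 2) + (2 * \<eta>) *s a c + \<eta> *s (a (c + 2) + a (c - 2))
      - a c \<odot> a (c - 2)"
    using az2 by (simp add: times_bilinear algebra_simps)
  have "a c \<odot> (x0 \<odot> z) = (1 - \<eta>) *s (?L - ?R)"
    unfolding x0z zz pz az unfolding times_bilinear axis_idem[OF axis] a_P az az2' unfolding d
    by (rule coord_eqI, simp only: coord_linear hf_simps, use two_hf in algebra)
  then show o: "?L = ?R" using X \<eta>_neq by simp
  have sq: "x1 \<odot> x1 = (\<eta> * \<eta> / 4) *s (z \<odot> z) + P \<odot> P + (\<eta> * \<eta>) *s a c + \<eta> *s (P \<odot> z)
      + (\<eta> * \<eta>) *s (a c \<odot> z) + (2 * \<eta>) *s (a c \<odot> P)"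
    unfolding e times_bilinear axis_idem[OF axis] times_comm[of z P] times_comm[of z
        "a c"] times_comm[of P "a c"]
    by (rule coord_eqI, simp only: coord_linear hf_simps, use two_hf in algebra)
  have "x1 \<odot> x1 - (1 / 2) *s (a c \<odot> (x1 \<odot> z)) = P \<odot> P - ?R'"
    unfolding sq x1z zz pz az unfolding times_bilinear axis_idem[OF axis] a_P az az2' o unfolding d
    by (rule coord_eqI, simp only: coord_linear hf_simps, use two_hf in algebra)
  moreover have "(1 / 2) *s (a c \<odot> (x1 \<odot> z)) = x1 \<odot> x1" unfolding Y using two_neq_0 by simp
  ultimately show "P \<odot> P = ?R'" by simp
qed

section \<open>Linear recurrences for the axes\<close>

lemma E_diff:
  "(2 * (1 + \<eta>)) *s (p c (c + 2) - p (c + 1) (c + 3))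
    = (1 - 2 * \<eta>) *s (\<eta> *s (a (c - 2) + a c - a (c + 1) - a (c + 3)) + 2 *s (a (c + 2) - a (c - 1)))"
    (is "?L = ?R")
proof -
  have idx: "c + 1 - 1 = c" "c + 1 + 1 = c + 2" "c + 1 + 2 = c + 3" "c + 1 - 2 = c - 1" by simp_all
  define R where "R x y z2 z a = (1 - 4 * \<eta> + 2 * \<eta> * \<eta>) *s P - (\<eta> * \<eta> / 2) *s x + (\<eta> / 2) *s y
    + (\<eta> * \<eta> * (2 * \<eta> - 1) / 4) *s z2 + (\<eta> * (2 - \<eta>) * (1 - 2 * \<eta>) / 4) *s z
    + (\<eta> * (1 - \<eta>) * (1 - 2 * \<eta>) / 2) *s a" for x y z2 z a
  \<comment> \<open>\<open>P\<close> is the same element at every centre, so its square may be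
    evaluated at c and at c + 1. By \<open>p_two\<close> the two parities of
    \<open>p c (c + 2)\<close> exchange their roles between these centres, which leaves a multiple
    of their difference.\<close>
  have PP: "P \<odot> P = R (p (c - 1) (c + 1)) (p c (c + 2)) (a (c + 2) + a (c - 2)) (a (c + 1) + a (c
      - 1)) (a c)" for c
    unfolding R_def by (rule P_times_P)
  have "(\<eta> / 4) *s (?L - ?R) = R (p (c + 1) (c + 3)) (p c (c + 2)) (a (c + 2) + a (c - 2)) (a (c + 1)
      + a (c - 1)) (a c)
      - R (p c (c + 2)) (p (c + 1) (c + 3)) (a (c + 3) + a (c - 1)) (a (c + 2) + a c) (a (c + 1))"
    unfolding R_def by (rule coord_eqI, simp only: coord_linear hf_simps, use two_hf in algebra)
  also have "\<dots> = 0" using PP[of c] PP[of "c + 1"] unfolding idx p_two by simp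
  finally have "(\<eta> / 4) *s (?L - ?R) = 0" .
  moreover have "(4 :: 'a) \<noteq> 0" using two_neq_0 mult_eq_0_iff[of "2 :: 'a" 2] by simp
  ultimately show ?thesis using \<eta>_neq by simp
qed

text \<open>This is the sum of the two consecutive three-step differences
  \<open>a (k + 2) - a (k - 1)\<close> and \<open>a (k + 1) - a (k - 2)\<close>. The goal
  \<open>g k = 0\<close> thus says that three-step differences alternate in sign, which makes the
  sequence periodic with period 6.\<close>

definition g :: "int \<Rightarrow> 'b" where
  "g k = a (k + 2) + a (k + 1) - a (k - 1) - a (k - 2)"

text \<open>The difference \<open>p c (c + 2) - p (c + 1) (c + 3)\<close> changes its sign when c
  moves by one. Adding two adjacent instances of \<open>E_diff\<close> therefore removes every
  \<open>p\<close> and leaves a relation between axes.\<close>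

lemma g_recurrence: "\<eta> *s (g (k + 1) + g (k - 1)) = 2 *s g k"
proof -
  define r where "r c = \<eta> *s (a (c - 2) + a c - a (c + 1) - a (c + 3)) + 2 *s (a (c + 2) - a (c - 1))"
      for c
  have E: "(1 - 2 * \<eta>) *s r c = (2 * (1 + \<eta>)) *s (p c (c + 2) - p (c + 1) (c + 3))" for c
    unfolding r_def by (rule E_diff[symmetric])
  have idx: "k - 1 + 2 = k + 1" "k - 1 + 1 = k" "k - 1 + 3 = k + 2" by simp_all
  have "(1 - 2 * \<eta>) *s (r (k - 1) + r k) = 0"
    unfolding scale_right_distrib[of _ "r (k - 1)"] E idx p_two(2) by (simp flip: scale_right_distrib)
  then have "r (k - 1) + r k = 0" using not_half by simp
  moreover have "r (k - 1) + r k = 2 *s g k - \<eta> *s (g (k + 1) + g (k - 1))"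
    unfolding r_def g_def by (rule coord_eqI) (simp add: coord_linear algebra_simps)
  ultimately show ?thesis by simp
qed

text \<open>The instances of \<open>E_diff\<close> at c and c - 1 are subtracted and multiplied by
  \<open>a c\<close>. The only products at a new distance are those with \<open>a (c + 3)\<close>
  and \<open>a (c - 3)\<close>, and both have \<open>p c (c + 3)\<close> as their p-part.\<close>

lemma p_three:
  "p c (c + 3) = (1 - \<eta>) *s a c - (\<eta> / 2) *s (a (c + 3) + a (c - 3)) - p c (c + 2) + P
    - (\<eta> / 2) *s (a (c + 2) + a (c - 2) - a (c + 1) - a (c - 1))" (is "?L = ?R")
proof -
  have idx: "c - 1 + 2 = c + 1" "c - 1 + 1 = c" "c - 1 + 3 = c + 2" "c - 1 - 2 = c - 3"
      "c - 1 - 1 = c - 2" by simp_all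
  define T0 T1 where T: "T0 = (2 * (1 + \<eta>)) *s (p c (c + 2) - p (c - 1) (c + 1))
    - (1 - 2 * \<eta>) *s (\<eta> *s (a (c - 2) + a c - a (c + 1) - a (c + 3)) + 2 *s (a (c + 2) - a (c - 1)))"
    "T1 = (2 * (1 + \<eta>)) *s (p (c - 1) (c + 1) - p c (c + 2))
    - (1 - 2 * \<eta>) *s (\<eta> *s (a (c - 3) + a (c - 1) - a c - a (c + 2)) + 2 *s (a (c + 1) - a (c - 2)))"
  have "T0 = 0" "T1 = 0"
    using E_diff[of c] E_diff[of "c - 1"] unfolding idx T p_two(2) by simp_all
  then have "0 = a c \<odot> (T0 - T1)" by simp
  also have "\<dots> = (2 * (1 - 2 * \<eta>) * \<eta>) *s (?L - ?R)"
    unfolding T times_bilinear a_times_o a_E a_times_a p_succ p_refl_shift p_self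
    by (rule coord_eqI, simp only: coord_linear hf_simps, use two_hf in algebra)
  finally have "(2 * (1 - 2 * \<eta>) * \<eta>) *s (?L - ?R) = 0" ..
  moreover have "2 * (1 - 2 * \<eta>) * \<eta> \<noteq> 0"
    using not_half \<eta>_neq two_neq_0 by (simp only: mult_eq_0_iff) simp
  ultimately show ?thesis by (simp only: scale_eq_0_iff) simp
qed

text \<open>By period 3 the value \<open>p c (c + 3)\<close> can be computed by
  \<open>p_three\<close> at c and at c + 3, and this shift changes parity. In contrast to
  \<open>E_diff\<close>, the difference of the two parities appears here with coefficient 1, which
  is informative also for \<eta> = -1.\<close>

lemma E_diff_a:
  "p c (c + 2) - p (c + 1) (c + 3) = (1 - \<eta>) *s (a c - a (c + 3)) - (\<eta> / 2) *s (a (c + 3) + a (c - 3)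
      - a (c + 6) - a c)
    - (\<eta> / 2) *s (a (c + 2) + a (c - 2) - a (c + 1) - a (c - 1) - a (c + 5) - a (c + 1) + a (c + 4) + a
        (c + 2))" (is "?L = ?R")
proof -
  have idx: "c + 3 + 3 = c + 6" "c + 3 - 3 = c" "c + 3 + 2 = c + 5" "c + 3 - 2 = c + 1"
      "c + 3 + 1 = c + 4"
    "c + 3 - 1 = c + 2" "c + 1 + 2 = c + 3" "c + 1 + 4 = c + 5" by simp_all
  have "p (c + 3) (c + 6) = p c (c + 3)" using p_shift[of "c + 3" 3] by (simp add: add.commute)
  then have 1: "p c (c + 3) = (1 - \<eta>) *s a (c + 3) - (\<eta> / 2) *s (a (c + 6) + a c) - p (c + 1) (c + 3)
      + P
    - (\<eta> / 2) *s (a (c + 5) + a (c + 1) - a (c + 4) - a (c + 2))"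
    using p_three[of "c + 3"] p_two(1)[of "c + 1"] unfolding idx by simp
  show ?thesis
  proof (rule coord_eqI)
    fix b
    from trans[OF 1[symmetric] p_three[of c], THEN arg_cong, of
        "coord b"] show "coord b ?L = coord b ?R"
      unfolding coord_linear hf_simps by algebra
  qed
qed

text \<open>On solutions of the recurrence \<open>g_recurrence\<close>, the sum of the two neighbours acts as the
  scalar \<open>2 / \<eta>\<close>, which turns further recurrences for \<open>g\<close> into scalar conditions.\<close>

lemma coord_g:
  "\<eta> * (coord b (g (k + 1)) + coord b (g (k - 1))) = 2 * coord b (g k)" (is ?t1)
  "\<eta> * \<eta> * (coord b (g (k + 2)) + coord b (g (k - 2))) = (4 - 2 * \<eta> * \<eta>) * coord b (g k)" (is ?t2)
  "\<eta> * \<eta> * \<eta> * (coord b (g (k + 3)) + coord b (g (k - 3))) = (8 - 6 * \<eta> * \<eta>) * coord b (g k)" (is ?t3)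
proof -
  have r: "\<eta> * (coord b (g (k + 1)) + coord b (g (k - 1))) = 2 * coord b (g k)" for k
    using g_recurrence[of k, THEN arg_cong, of "coord b"] by (simp only: coord_linear)
  have n: "\<eta> * (coord b (g (k + 2)) + coord b (g k)) = 2 * coord b (g (k + 1))"
    "\<eta> * (coord b (g k) + coord b (g (k - 2))) = 2 * coord b (g (k - 1))"
    "\<eta> * (coord b (g (k + 3)) + coord b (g (k + 1))) = 2 * coord b (g (k + 2))"
    "\<eta> * (coord b (g (k - 1)) + coord b (g (k - 3))) = 2 * coord b (g (k - 2))"
    using r[of "k + 1"] r[of "k - 1"] r[of "k + 2"] r[of "k - 2"] by (simp_all add: add.commute)
  show ?t1 by (rule r)
  show h2: ?t2 using r[of k] n(1,2) by algebra
  show ?t3 using r[of k] n(3,4) h2 by algebra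
qed

text \<open>The left side of \<open>E_diff_a\<close> alternates in c, so the right sides for two
  adjacent c add up to zero. Their sum is a linear relation between the values of \<open>g\<close>
  from k - 3 to k + 3.\<close>

lemma g_condition1: "(5 * \<eta> * \<eta> - 2 * \<eta> - 4) *s g k = 0"
proof -
  define w where "w c = (1 - \<eta>) *s (a c - a (c + 3)) - (\<eta> / 2) *s (a (c + 3) + a (c - 3) - a (c + 6)
      - a c)
    - (\<eta> / 2) *s (a (c + 2) + a (c - 2) - a (c + 1) - a (c - 1) - a (c + 5) - a (c + 1) + a (c + 4) + a
        (c + 2))" for c
  have E: "p c (c + 2) - p (c + 1) (c + 3) = w c" for c unfolding w_def by (rule E_diff_a)
  have "w (k - 2) + w (k - 1) = 0"
    using E[of "k - 2"] E[of "k - 1"] p_two(1)[of "k - 2"] by (simp add: algebra_simps)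
  moreover have "w (k - 2) + w (k - 1) = - ((1 - \<eta>) *s g k - (\<eta> / 2) *s (g (k + 3) + g (k - 3))
      - (\<eta> / 2) *s (g (k + 2) + g (k - 2) - g (k + 1) - g (k - 1)))"
    unfolding w_def g_def by (rule coord_eqI) (simp add: coord_linear algebra_simps)
  ultimately have F: "(1 - \<eta>) *s g k - (\<eta> / 2) *s (g (k + 3) + g (k - 3))
      - (\<eta> / 2) *s (g (k + 2) + g (k - 2) - g (k + 1) - g (k - 1)) = 0" by simp
  show ?thesis
  proof (rule coord_eqI)
    fix b
    have f: "(1 - \<eta>) * coord b (g k) - hf * \<eta> * (coord b (g (k + 3)) + coord b (g (k - 3)))
      - hf * \<eta> * (coord b (g (k + 2)) + coord b (g (k - 2)) - coord b (g (k + 1)) - coord b (g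
          (k - 1))) = 0"
      using F[THEN arg_cong, of "coord b"] by (simp only: coord_linear hf_simps)
    have "2 * ((5 * \<eta> * \<eta> - 2 * \<eta> - 4) * coord b (g k)) = 0"
      using coord_g[of b k] f two_hf by algebra
    then show "coord b ((5 * \<eta> * \<eta> - 2 * \<eta> - 4) *s g k) = coord b 0"
      unfolding coord_linear using two_neq_0 by (simp only: mult_eq_0_iff) simp
  qed
qed

text \<open>The recurrence of \<open>g\<close>, written out in axes and centred at c + 1 or c - 1,
  is multiplied by \<open>a c\<close>. It then contains \<open>a (c + 4)\<close> or
  \<open>a (c - 4)\<close> as the only axis at distance 4, and the smaller distances are kept as
  they are.\<close>

lemma p_four:
  "\<eta> *s p c (c + 4) = 2 *s p c (c + 2) - (2 - \<eta>) *s P + (2 - \<eta>) *s p c (c + 3) - ((2 - \<eta>) * (1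
      - 2 * \<eta>)) *s a c"
    (is "?L = ?R")
  and p_four':
  "\<eta> *s p c (c - 4) = 2 *s p c (c + 2) - (2 - \<eta>) *s P + (2 - \<eta>) *s p c (c - 3) - ((2 - \<eta>) * (1
      - 2 * \<eta>)) *s a c"
    (is "?L' = ?R'")
proof -
  define r where "r m = \<eta> *s a (m - 3) + (\<eta> - 2) *s (a (m - 2) + a (m - 1)) + (2 - \<eta>) *s (a (m + 1)
      + a (m + 2)) - \<eta> *s a (m + 3)" for m
  have r0: "r m = 0" for m
  proof -
    have "r m = 2 *s g m - \<eta> *s (g (m + 1) + g (m - 1))"
      unfolding r_def g_def by (rule coord_eqI) (simp add: coord_linear algebra_simps)
    then show ?thesis using g_recurrence by simp
  qed
  have idx: "c + 1 - 3 = c - 2" "c + 1 - 2 = c - 1" "c + 1 - 1 = c" "c + 1 + 1 = c + 2"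
      "c + 1 + 2 = c + 3" "c + 1 + 3 = c + 4"
    "c - 1 - 3 = c - 4" "c - 1 - 2 = c - 3" "c - 1 - 1 = c - 2" "c - 1 + 1 = c" "c - 1 + 2 = c + 1"
        "c - 1 + 3 = c + 2"
    by simp_all
  have p2: "p c (c - 2) = p c (c + 2)" by (rule p_refl_shift)
  have R: "coord b (r m) = 0" for m b using r0 coord_zero by simp
  have "a c \<odot> r (c + 1) = 0" using r0 by simp
  then have "coord b (a c \<odot> r (c + 1)) = 0" for b by (simp add: coord_zero)
  note X = this[unfolded r_def idx times_bilinear a_times_a p2 p_succ p_self coord_linear]
  have "a c \<odot> r (c - 1) = 0" using r0 by simp
  then have "coord b (a c \<odot> r (c - 1)) = 0" for b by (simp add: coord_zero)
  note Y = this[unfolded r_def idx times_bilinear a_times_a p2 p_succ p_self coord_linear]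
  show "?L = ?R"
  proof (rule coord_eqI)
    fix b show "coord b ?L = coord b ?R"
      using X[of b] R[of b "c + 1", unfolded r_def idx coord_linear] unfolding coord_linear by algebra
  qed
  show "?L' = ?R'"
  proof (rule coord_eqI)
    fix b show "coord b ?L' = coord b ?R'"
      using Y[of b] R[of b "c - 1", unfolded r_def idx coord_linear] unfolding coord_linear by algebra
  qed
qed

text \<open>The symmetric element \<open>p c (c + 4)\<close> is computed from both of its ends.
  These have the same parity, so the values at distance 2 and \<open>P\<close> cancel, and a
  relation between axes remains.\<close>

lemma g_condition2: "((2 - \<eta>) * (1 - \<eta> * \<eta>)) *s g k = 0"
proof -
  define c where "c = k - 2"
  define F where "F c = (1 - \<eta>) *s a c - (\<eta> / 2) *s (a (c + 3) + a (c - 3)) - (\<eta> / 2) *s (a (c + 2)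
      + a (c - 2) - a (c + 1) - a (c - 1))" for c
  have 3: "p c (c + 3) = F c - p c (c + 2) + P" for c using p_three[of c] by (simp add: F_def)
  have "p (c + 4) c = p c (c + 4)" "p (c + 4) (c + 4 + 2) = p c (c + 2)"
    using p_commute[of c "c + 4"] p_two(1)[of c] p_two(1)[of "c + 2"] by (simp_all add: add.commute)
  moreover have "p (c + 4) (c + 1) = F (c + 4) - p c (c + 2) + P"
    using 3[of "c + 4"] p_refl_shift[of "c + 4" 3] calculation by (simp add: add.commute)
  ultimately have "\<eta> *s p c (c + 4) = 2 *s p c (c + 2) - (2 - \<eta>) *s P + (2 - \<eta>) *s (F (c + 4) - p c (c
      + 2) + P) - ((2 - \<eta>) * (1 - 2 * \<eta>)) *s a (c + 4)"
    using p_four'[of "c + 4"] by (simp add: add.commute)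
  moreover have "\<eta> *s p c (c + 4) = 2 *s p c (c + 2) - (2 - \<eta>) *s P + (2 - \<eta>) *s (F c - p c (c + 2) + P)
      - ((2 - \<eta>) * (1 - 2 * \<eta>)) *s a c"
    using p_four[of c] 3[of c] by simp
  ultimately have "2 *s p c (c + 2) - (2 - \<eta>) *s P + (2 - \<eta>) *s (F c - p c (c + 2) + P) - ((2 - \<eta>) * (1
      - 2 * \<eta>)) *s a c
      = 2 *s p c (c + 2) - (2 - \<eta>) *s P + (2 - \<eta>) *s (F (c + 4) - p c (c + 2) + P) - ((2 - \<eta>) *
          (1 - 2 * \<eta>)) *s a (c + 4)"
    by simp
  note X = this[THEN arg_cong]
  have idx:
    "k - 2 + 3 = k + 1" "k - 2 - 3 = k - 5" "k - 2 + 2 = k" "k - 2 - 2 = k - 4" "k - 2 + 1 = k - 1" 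
    "k - 2 - 1 = k - 3" "k - 2 + 4 = k + 2" "k + 2 + 3 = k + 5" "k + 2 - 3 = k - 1" "k + 2 + 2 = k + 4" 
    "k + 2 - 2 = k" "k + 2 + 1 = k + 3" "k + 2 - 1 = k + 1" "k + 3 + 2 = k + 5" "k + 3 + 1 = k + 4" 
    "k + 3 - 1 = k + 2" "k + 3 - 2 = k + 1" "k + 1 + 2 = k + 3" "k + 1 + 1 = k + 2" "k + 1 - 1 = k" 
    "k + 1 - 2 = k - 1" "k - 1 + 2 = k + 1" "k - 1 + 1 = k" "k - 1 - 1 = k - 2" "k - 1 - 2 = k - 3" 
    "k - 3 + 2 = k - 1" "k - 3 + 1 = k - 2" "k - 3 - 1 = k - 4" "k - 3 - 2 = k - 5"
    by simp_all
  have "F c - (1 - 2 * \<eta>) *s a c - (F (c + 4) - (1 - 2 * \<eta>) *s a (c + 4)) = (\<eta> / 2) *s (g (k + 3) - g (k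
      + 1) - g (k - 1) + g (k - 3))"
    unfolding F_def g_def c_def idx by (rule coord_eqI, simp only: coord_linear hf_simps,
        use two_hf in algebra)
  note Y = this[THEN arg_cong]
  show ?thesis
  proof (rule coord_eqI)
    fix b
    have z: "(2 - \<eta>) * (hf * \<eta> * (coord b (g (k + 3)) - coord b (g (k + 1)) - coord b (g (k - 1))
        + coord b (g (k - 3)))) = 0"
      using X[of "coord b"] Y[of "coord b"] unfolding coord_linear hf_simps by algebra
    have "2 * (2 * (2 * (((2 - \<eta>) * (1 - \<eta> * \<eta>)) * coord b (g k)))) = 0"
      using coord_g(1,3)[of b k] z two_hf by algebra
    then show "coord b (((2 - \<eta>) * (1 - \<eta> * \<eta>)) *s g k) = coord b 0"
      unfolding coord_linear using two_neq_0 by (simp only: mult_eq_0_iff) simp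
  qed
qed

text \<open>Otherwise both scalars vanish. The second one leaves \<eta> = 2 or \<eta> = -1, for
  which the first one is 12 or 3. So the characteristic is 3, where 2 and -1 are both equal to the
  excluded value 1/2.\<close>

lemma g_zero: "g k = 0"
proof (rule ccontr)
  assume "g k \<noteq> 0"
  then have 1: "5 * \<eta> * \<eta> - 2 * \<eta> - 4 = 0" and "(2 - \<eta>) * (1 - \<eta> * \<eta>) = 0"
    using g_condition1[of k] g_condition2[of k] by simp_all
  then have "(2 - \<eta>) * ((1 - \<eta>) * (1 + \<eta>)) = 0" by algebra
  then have "\<eta> = 2 \<or> \<eta> = -1" using \<eta>_neq by (auto simp: eq_neg_iff_add_eq_0 add.commute)
  then show False
  proof
    assume \<eta>: "\<eta> = 2"
    have "2 * (2 * 3) = (0 :: 'a)" using 1 unfolding \<eta> by simp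
    then have "(3 :: 'a) = 0" using two_neq_0 by (metis mult_eq_0_iff)
    moreover have "2 * \<eta> = 3 + 1" unfolding \<eta> by simp
    ultimately have "2 * \<eta> = 1" by simp
    then show False using not_half by simp
  next
    assume \<eta>: "\<eta> = -1"
    have "(3 :: 'a) = 0" using 1 unfolding \<eta> by simp
    moreover have "2 * \<eta> = 1 - 3" unfolding \<eta> by simp
    ultimately have "2 * \<eta> = 1" by simp
    then show False using not_half by simp
  qed
qed

section \<open>Period six and the splitting of opposite axes\<close>

lemma a_four: "a (k + 4) = a (k + 1) + a k - a (k + 3)"
  using g_zero[of "k + 2"] by (simp add: g_def algebra_simps)

lemma a_six: "a (k + 6) = a k"
proof -
  have idx: "k + 1 + 4 = k + 5" "k + 1 + 1 = k + 2" "k + 1 + 3 = k + 4" "k + 2 + 4 = k + 6"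
      "k + 2 + 1 = k + 3" "k + 2 + 3 = k + 5"
    by simp_all
  have "a (k + 5) = a (k + 2) + a (k + 1) - a (k + 4)" "a (k + 6) = a (k + 3) + a (k + 2) - a (k + 5)"
    using a_four[of "k + 1"] a_four[of "k + 2"] unfolding idx by simp_all
  then show ?thesis using a_four[of k] by simp
qed

text \<open>Opposite axes fix each other under their reflections, so neither has an \<eta>-component
  at the other. Hence \<open>A\<close> is the 1-component of each of them at the other one, and
  \<open>a c - A\<close> and \<open>a (c + 3) - A\<close> are the 0-components.\<close>

lemma opposite_pair:
  fixes c :: int
  defines "A \<equiv> a c \<odot> a (c + 3)"
  shows "A \<odot> A = A" "A \<odot> (a c - A) = 0" "A \<odot> (a (c + 3) - A) = 0"
    "(a c - A) \<odot> (a c - A) = a c - A" "(a (c + 3) - A) \<odot> (a (c + 3) - A) = a (c + 3) - A"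
    "(a c - A) \<odot> (a (c + 3) - A) = 0"
proof -
  have eig: "a c \<odot> (a c \<odot> a (c + 3)) = a c \<odot> a (c + 3)" for c
  proof -
    have "a (2 * c - (c + 3)) = a (c + 3)" using a_six[of "c - 3"] by (simp add: add.commute)
    then have "a c \<odot> a (c + 3) + a c \<odot> a (c + 3) = 2 *s a_part1 c (c + 3)"
      using a_times_z[of c "c + 3"] by (simp add: times_bilinear)
    then have "2 *s (a c \<odot> a (c + 3)) = 2 *s a_part1 c (c + 3)"
      using scale_left_distrib[of 1 1 "a c \<odot> a (c + 3)"] by simp
    then have "a c \<odot> a (c + 3) = a_part1 c (c + 3)" using two_neq_0 by simp
    then show ?thesis using a_part_eig by simp
  qed
  let ?x = "a c" and ?y = "a (c + 3)"
  have xA: "?x \<odot> A = A" unfolding A_def by (rule eig)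
  have yA: "?y \<odot> A = A"
    using eig[of "c + 3"] a_six[of c] unfolding A_def by (simp add: times_comm add.commute)
  define w where "w = ?y - A"
  have xw: "?x \<odot> w = 0" using xA by (simp add: times_bilinear A_def w_def)
  have y: "(A + w) \<odot> (A + w) = A + w" by (simp add: w_def axis_idem[OF axis])
  \<comment> \<open>The idempotent \<open>?y = A + w\<close> is squared and multiplied by
    \<open>?x\<close>, which keeps the 1-part \<open>A \<odot> A\<close> and kills the other two
    products; the mixed one dies because 1 is not in \<open>\<Phi>\<close>.\<close>
  have "?x \<odot> ((A + w) \<odot> (A + w)) = A \<odot> A"
    unfolding times_add_left times_add_right times_comm[of A w]
      axis_11[OF axis xA xA] axis_01_no1[OF axis xw xA no1] axis_00[OF axis xw xw] by simp
  moreover have "?x \<odot> ((A + w) \<odot> (A + w)) = A"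
    unfolding y unfolding times_add_right xA xw by simp
  ultimately show AA: "A \<odot> A = A" by simp
  have Ax: "A \<odot> ?x = A" "A \<odot> ?y = A" using xA yA by (simp_all only: times_comm[of A])
  have x: "?x \<odot> ?x = ?x" "?y \<odot> ?y = ?y" by (rule axis_idem[OF axis])+
  show "A \<odot> (?x - A) = 0" "A \<odot> (?y - A) = 0"
    unfolding times_diff_right Ax AA by simp_all
  show "(?x - A) \<odot> (?x - A) = ?x - A" "(?y - A) \<odot> (?y - A) = ?y - A" "(?x - A) \<odot> (?y - A) = 0"
    unfolding times_diff_right times_diff_left Ax AA x xA yA A_def[symmetric] by simp_all
qed

text \<open>The subtracted remainder depends only on the parity of c, since
  \<open>p c (c + 2)\<close> does and since \<open>a c - a (c + 3)\<close> alternates in sign. This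
  yields the two idempotents shared by all even and by all odd axes.\<close>

lemma opposite_times:
  "a c \<odot> a (c + 3) = a c - (p c (c + 2) - P + \<eta> *s (a c - a (c + 3)))"
proof -
  have r: "a (c - 3) = a (c + 3)" "a (c - 2) = a c + a (c + 1) - a (c + 3)"
      "a (c - 1) = a (c + 3) + a (c + 2) - a c"
  proof -
    have idx: "c - 3 + 6 = c + 3" "c - 2 + 4 = c + 2" "c - 2 + 1 = c - 1" "c - 2 + 3 = c + 1"
        "c - 1 + 4 = c + 3" "c - 1 + 1 = c"
      "c - 1 + 3 = c + 2" by simp_all
    show 1: "a (c - 3) = a (c + 3)" and 2: "a (c - 1) = a (c + 3) + a (c + 2) - a c"
      using a_six[of "c - 3"] a_four[of "c - 1"] unfolding idx by (simp_all add: algebra_simps)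
    show "a (c - 2) = a c + a (c + 1) - a (c + 3)" using a_four[of "c - 2"] unfolding idx 2
        by (simp add: algebra_simps)
  qed
  show ?thesis
    unfolding a_times_a p_three[of c] r
    by (rule coord_eqI, simp only: coord_linear hf_simps, use two_hf in algebra)
qed

end

context total_alg
begin

definition relations_3C00 :: "'f \<Rightarrow> 'v \<Rightarrow> (idx3 \<Rightarrow> 'v) \<Rightarrow> 'v \<Rightarrow> 'v \<Rightarrow> bool" where
  "relations_3C00 \<eta> q A s t \<longleftrightarrow> q \<odot> q = (\<eta> + 1) *s q \<and> (\<forall>i. q \<odot> A i = (\<eta> + 1) *s A i) \<and> (\<forall>i. A i \<odot> A i
      = A i) \<and>
     (\<forall>i j k. {i, j, k} = {IM1, I0, I1} \<longrightarrow>
        A i \<odot> A j = (- (1 / 2)) *s q + ((\<eta> + 1) / 2) *s (A i + A j) + ((1 - \<eta>) / 2) *s A k) \<and>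
     q \<odot> s = 0 \<and> q \<odot> t = 0 \<and> (\<forall>i. A i \<odot> s = 0) \<and> (\<forall>i. A i \<odot> t = 0) \<and> s \<odot> s = s \<and> t \<odot> t = t \<and> s \<odot> t = 0"

end

context axial_sequence_no1
begin

theorem relations_3C00_exist:
  obtains q A s t where "relations_3C00 \<eta> q A s t" "A I0 + s = a 0" "A I1 + t = a 1"
proof -
  \<comment> \<open>All three-step differences are d up to sign. The remainders
    \<open>a i - a i \<odot> a (i + 3)\<close> are s for even i and t for odd i, and the products
    \<open>a i \<odot> a (i + 3)\<close> are X, Y, Z according to i modulo 3. So each axis is one of
    X, Y, Z plus one of s, t.\<close>
  define d where "d = a 0 - a 3"
  define s where "s = p 0 2 - P + \<eta> *s d"
  define t where "t = s - d"
  define X where "X = a 0 - s"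
  define Y where "Y = a 1 - t"
  define Z where "Z = a 2 - s"
  have a3: "a 3 = a 0 - d" by (simp add: d_def)
  have a4: "a 4 = a 1 + d" using a_four[of 0] by (simp add: d_def)
  have a5: "a 5 = a 2 - d" using a_four[of 1] a4 by simp
  have am1: "a (-1) = a 2 - d" using a_six[of "-1"] a5 by simp
  have am2: "a (-2) = a 1 + d" using a_six[of "-2"] a4 by simp
  have am3: "a (-3) = a 0 - d" using a_six[of "-3"] a3 by simp
  have a6: "a 6 = a 0" using a_six[of 0] by simp
  have o: "p 1 3 = p 0 2 - (1 - 2 * \<eta>) *s d"
  proof -
    have "p 0 2 - p 1 3 = (1 - \<eta>) *s d - (\<eta> / 2) *s (- d - d) - (\<eta> / 2) *s (d + d + d + d)"
      using E_diff_a[of 0] by (simp add: a3 a4 a5 a6 am1 am2 am3)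
    also have "\<dots> = (1 - 2 * \<eta>) *s d"
      by (rule coord_eqI, simp only: coord_linear hf_simps, use two_hf in algebra)
    finally have "p 0 2 - p 1 3 = (1 - 2 * \<eta>) *s d" .
    then show ?thesis by (simp add: algebra_simps)
  qed
  have e: "p 2 4 = p 0 2" using p_two(1)[of 0] by simp
  have XA: "X = a 0 \<odot> a 3" using opposite_times[of 0] by (simp add: X_def s_def d_def)
  have YA: "Y = a 1 \<odot> a 4"
  proof -
    have "a 1 \<odot> a 4 = a 1 - (p 0 2 - (1 - 2 * \<eta>) *s d - P + \<eta> *s (- d))"
      using opposite_times[of 1] by (simp add: a4 o)
    also have "\<dots> = Y"
      unfolding Y_def t_def s_def by (rule coord_eqI, simp only: coord_linear, algebra)
    finally show ?thesis ..
  qed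
  have ZA: "Z = a 2 \<odot> a 5"
    using opposite_times[of 2] by (simp add: Z_def s_def a5 e)
  have st: "a 0 - X = s" "a 3 - X = t" "a 1 - Y = t" "a 4 - Y = s" "a 2 - Z = s" "a 5 - Z = t"
    by (simp_all add: X_def Y_def Z_def a3 a4 a5 t_def)
  note px = opposite_pair[of 0, simplified, folded XA, unfolded st]
  note py = opposite_pair[of 1, simplified, folded YA, unfolded st]
  note pz = opposite_pair[of 2, simplified, folded ZA, unfolded st]
  have aa: "a 0 = X + s" "a 1 = Y + t" "a 2 = Z + s" "a 3 = X + t" "a (-1) = Z + t"
    by (simp_all add: X_def Y_def Z_def a3 am1 t_def)
  have idem: "X \<odot> X = X" "Y \<odot> Y = Y" "Z \<odot> Z = Z" "s \<odot> s = s" "t \<odot> t = t" "s \<odot> t = 0" "t \<odot> s = 0"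
    and orth: "X \<odot> s = 0" "X \<odot> t = 0" "Y \<odot> s = 0" "Y \<odot> t = 0" "Z \<odot> s = 0" "Z \<odot> t = 0"
     using px py pz by (simp_all add: times_comm[of t s])
  have orth': "s \<odot> X = 0" "t \<odot> X = 0" "s \<odot> Y = 0" "t \<odot> Y = 0" "s \<odot> Z = 0" "t \<odot> Z = 0"
    using orth by (simp_all add: times_comm)
  have XY: "X \<odot> Y = P + \<eta> *s (X + s + Y + t)"
    using a_times_a[of 0 1] unfolding aa by (simp add: times_bilinear idem orth orth' algebra_simps)
  have YZ: "Y \<odot> Z = P + \<eta> *s (Y + t + Z + s)"
    using a_times_a[of 1 2] p_succ(1)[of 1] unfolding aa
        by (simp add: times_bilinear idem orth orth' algebra_simps)
  have ZX: "Z \<odot> X = P + \<eta> *s (Z + t + X + s)"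
    using a_times_a[of "-1" 0] p_succ(1)[of "-1"] unfolding aa
        by (simp add: times_bilinear idem orth orth' algebra_simps)
  \<comment> \<open>The element s lies in the 1-eigenspace of \<open>a 0\<close>. Its products with
    the 0-part and the 1-part of \<open>a 1\<close> are opposite to each other; the axis kills the
    first and fixes the second, so both are zero.\<close>
  have Ps: "P \<odot> s = - (\<eta> *s s)"
  proof -
    have 1: "a 0 \<odot> s = s" unfolding aa by (simp add: times_bilinear idem orth)
    have "(a 1 + a (-1)) \<odot> s = 0" unfolding aa by (simp add: times_bilinear idem orth)
    then have "a_part0 0 1 \<odot> s = - (P \<odot> s + \<eta> *s s)" "a_part1 0 1 \<odot> s = P \<odot> s + \<eta> *s s"
      unfolding a_part0_def a_part1_def
          by (simp_all add: times_add_left times_diff_left times_scale_left 1)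
    then have "- (a 0 \<odot> (P \<odot> s + \<eta> *s s)) = 0" "a 0 \<odot> (P \<odot> s + \<eta> *s s) = P \<odot> s + \<eta> *s s"
      using axis_01_no1[OF axis a_part_eig(1) 1 no1, of 1] axis_11[OF axis a_part_eig(2) 1, of 1]
      by (simp_all only: times_minus_right)
    then have "P \<odot> s + \<eta> *s s = 0" by (metis neg_equal_0_iff_equal)
    then show ?thesis by (simp only: eq_neg_iff_add_eq_0)
  qed
  have Pt: "P \<odot> t = - (\<eta> *s t)"
  proof -
    have 1: "a 1 \<odot> t = t" unfolding aa by (simp add: times_bilinear idem orth)
    have "(a 2 + a 0) \<odot> t = 0" unfolding aa by (simp add: times_bilinear idem orth)
    then have "a_part0 1 2 \<odot> t = - (P \<odot> t + \<eta> *s t)" "a_part1 1 2 \<odot> t = P \<odot> t + \<eta> *s t"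
      using p_succ(1)[of 1]
      unfolding a_part0_def a_part1_def
          by (simp_all add: times_add_left times_diff_left times_scale_left 1)
    then have "- (a 1 \<odot> (P \<odot> t + \<eta> *s t)) = 0" "a 1 \<odot> (P \<odot> t + \<eta> *s t) = P \<odot> t + \<eta> *s t"
      using axis_01_no1[OF axis a_part_eig(1) 1 no1, of 2] axis_11[OF axis a_part_eig(2) 1, of 2]
      by (simp_all only: times_minus_right)
    then have "P \<odot> t + \<eta> *s t = 0" by (metis neg_equal_0_iff_equal)
    then show ?thesis by (simp only: eq_neg_iff_add_eq_0)
  qed
  have PX: "P \<odot> X = (1 - \<eta>) *s P - (\<eta> * \<eta>) *s (X + s) + (\<eta> * (1 - \<eta>) / 2) *s (Y + t + Z + t) + \<eta> *s s"
    using P_a[of 0] Ps unfolding aa by (simp add: times_bilinear aa algebra_simps)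
  have PY: "P \<odot> Y = (1 - \<eta>) *s P - (\<eta> * \<eta>) *s (Y + t) + (\<eta> * (1 - \<eta>) / 2) *s (Z + s + X + s) + \<eta> *s t"
    using P_a[of 1] Pt by (simp add: times_bilinear aa algebra_simps)
  have PZ: "P \<odot> Z = (1 - \<eta>) *s P - (\<eta> * \<eta>) *s (Z + s) + (\<eta> * (1 - \<eta>) / 2) *s (X + t + Y + t) + \<eta> *s s"
    using P_a[of 2] Ps by (simp add: times_bilinear aa algebra_simps)
  have e': "p 0 2 = s + P - \<eta> *s (s - t)" "p (-1) 1 = t + P + \<eta> *s (s - t)"
  proof -
    show "p 0 2 = s + P - \<eta> *s (s - t)" by (simp add: s_def t_def)
    then have "p (-1) 1 = s + P - \<eta> *s (s - t) - (1 - 2 * \<eta>) *s (s - t)"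
      using p_two(2)[of 0] o by (simp add: t_def)
    also have "\<dots> = t + P + \<eta> *s (s - t)"
      by (rule coord_eqI, simp only: coord_linear, algebra)
    finally show "p (-1) 1 = t + P + \<eta> *s (s - t)" .
  qed
  have am2': "a (-2) = Y + s" by (simp add: am2 aa t_def)
  \<comment> \<open>This is the value forced by the required formula for \<open>X \<odot> Y\<close>
    when \<open>XY\<close> is inserted; it is symmetric in X, Y, Z, so the other two products agree
    with it.\<close>
  define q where "q = - (2 *s P) - (2 * \<eta>) *s (s + t) + (1 - \<eta>) *s (X + Y + Z)"
  have qs: "q \<odot> s = 0" "q \<odot> t = 0"
    unfolding q_def times_bilinear Ps Pt idem orth by (rule coord_eqI, simp only: coord_linear,
        algebra)+
  have qX: "q \<odot> X = (\<eta> + 1) *s X"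
    unfolding q_def times_bilinear PX idem orth' ZX times_comm[of Y X] XY
    by (rule coord_eqI, simp only: coord_linear hf_simps, use two_hf in algebra)
  have qY: "q \<odot> Y = (\<eta> + 1) *s Y"
    unfolding q_def times_bilinear PY idem orth' XY times_comm[of Z Y] YZ
    by (rule coord_eqI, simp only: coord_linear hf_simps, use two_hf in algebra)
  have qZ: "q \<odot> Z = (\<eta> + 1) *s Z"
    unfolding q_def times_bilinear PZ idem orth' YZ times_comm[of X Z] ZX
    by (rule coord_eqI, simp only: coord_linear hf_simps, use two_hf in algebra)
  have qP: "q \<odot> P = - (2 *s (P \<odot> P)) - (2 * \<eta>) *s (P \<odot> s + P \<odot> t) + (1 - \<eta>) *s (P \<odot> X + P \<odot> Y + P \<odot> Z)"
    unfolding times_comm[of q P] by (simp only: q_def times_bilinear)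
  have PP: "P \<odot> P = (1 - 4 * \<eta> + 2 * \<eta> * \<eta>) *s P - (\<eta> * \<eta> / 2) *s (t + P + \<eta> *s (s - t)) + (\<eta> / 2) *s (s
      + P - \<eta> *s (s - t))
    + (\<eta> * \<eta> * (2 * \<eta> - 1) / 4) *s (Z + s + Y + s)
    + (\<eta> * (2 - \<eta>) * (1 - 2 * \<eta>) / 4) *s (Y + t + Z + t)
    + (\<eta> * (1 - \<eta>) * (1 - 2 * \<eta>) / 2) *s (X + s)"
    using P_times_P[of 0] by (simp add: e' aa am2' add.assoc)
  \<comment> \<open>One factor is expanded, which leaves products of q with its constituents. The
    only one that is not linear in earlier results is \<open>P \<odot> P\<close>, taken from the
    centre 0.\<close>
  have "q \<odot> q = - (2 *s (q \<odot> P)) - (2 * \<eta>) *s (q \<odot> s + q \<odot> t) + (1 - \<eta>) *s (q \<odot> X + q \<odot> Y + q \<odot> Z)"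
    by (subst (2) q_def) (simp add: times_bilinear)
  also have "\<dots> = (\<eta> + 1) *s q"
    unfolding qP qs qX qY qZ PP PX PY PZ Ps Pt unfolding q_def
    by (rule coord_eqI, simp only: coord_linear hf_simps, use two_hf in algebra)
  finally have qq: "q \<odot> q = (\<eta> + 1) *s q" .
  define A where "A i = (case i of IM1 \<Rightarrow> Z | I0 \<Rightarrow> X | I1 \<Rightarrow> Y)" for i
  have mult: "X \<odot> Y = (- (1 / 2)) *s q + ((\<eta> + 1) / 2) *s (X + Y) + ((1 - \<eta>) / 2) *s Z"
    "Y \<odot> Z = (- (1 / 2)) *s q + ((\<eta> + 1) / 2) *s (Y + Z) + ((1 - \<eta>) / 2) *s X"
    "Z \<odot> X = (- (1 / 2)) *s q + ((\<eta> + 1) / 2) *s (Z + X) + ((1 - \<eta>) / 2) *s Y"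
    unfolding XY YZ ZX q_def
    by (rule coord_eqI, simp only: coord_linear hf_simps, use two_hf in algebra)+
  have AA: "A i \<odot> A j = (- (1 / 2)) *s q + ((\<eta> + 1) / 2) *s (A i + A j) + ((1 - \<eta>) / 2) *s A k"
    if "{i, j, k} = {IM1, I0, I1}" for i j k
    using that mult by (cases i; cases j; cases k) (auto simp: A_def times_comm add.commute)
  have "relations_3C00 \<eta> q A s t"
    unfolding relations_3C00_def using AA
    by (auto simp: A_def qq qs qX qY qZ idem orth split: idx3.splits)
  moreover have "A I0 + s = a 0" "A I1 + t = a 1" by (simp_all add: A_def aa)
  ultimately show ?thesis by (rule that)
qed

end

section \<open>Duality\<close>

context total_alg
begin

text \<open>Multiplication by \<open>u - a\<close> is one minus multiplication by \<open>a\<close>: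
  it exchanges the eigenvalues 0 and 1 and turns \<eta> into \<open>1 - \<eta>\<close>. Without 0 in
  \<open>\<Phi>\<close>, mixed products lie in the 1-eigenspace of \<open>a\<close>, which is the
  0-eigenspace of \<open>u - a\<close>.\<close>

lemma axis_dual:
  assumes u: "\<And>x. u \<odot> x = x" and a: "axis \<Phi> \<eta> a" and no0: "0 \<notin> \<Phi>"
  shows "axis {0} (1 - \<eta>) (u - a)"
proof -
  have b: "(u - a) \<odot> x = x - a \<odot> x" for x by (simp add: times_diff_left u)
  have 0: "(u - a) \<odot> x = 0 \<longleftrightarrow> a \<odot> x = x" for x unfolding b by auto
  have 1: "(u - a) \<odot> x = x \<longleftrightarrow> a \<odot> x = 0" for x unfolding b by auto
  have h: "(u - a) \<odot> x = (1 - \<eta>) *s x \<longleftrightarrow> a \<odot> x = \<eta> *s x" for x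
    unfolding b scale_left_diff_distrib scale_one by auto
  have e: "(u - a) \<odot> ((u - a) \<odot> x) = (u - a) \<odot> x \<longleftrightarrow> a \<odot> (a \<odot> x) = a \<odot> x" for x
    unfolding 1 unfolding b times_diff_right by auto
  show ?thesis
    unfolding axis_def
  proof (intro conjI)
    have "u \<odot> a = a" "a \<odot> u = a" using u times_comm by metis+
    then show "(u - a) \<odot> (u - a) = u - a" unfolding b times_diff_right using axis_idem[OF a] u by simp
    show "\<forall>x. \<exists>x0 x1 xh. x = x0 + x1 + xh \<and> (u - a) \<odot> x0 = 0 \<and> (u - a) \<odot> x1 = x1 \<and> (u - a) \<odot> xh
        = (1 - \<eta>) *s xh"
    proof
      fix x
      obtain x0 x1 xh where "x = x0 + x1 + xh" "a \<odot> x0 = 0" "a \<odot> x1 = x1" "a \<odot> xh = \<eta> *s xh"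
        using axis_decomp[OF a, of x] by blast
      then show "\<exists>x0 x1 xh. x = x0 + x1 + xh \<and> (u - a) \<odot> x0 = 0 \<and> (u - a) \<odot> x1 = x1 \<and> (u - a) \<odot> xh
          = (1 - \<eta>) *s xh"
        unfolding 0 1 h by (intro exI[of _ x1] exI[of _ x0] exI[of _ xh]) (simp add: add.commute)
    qed
    show "\<forall>x y. (u - a) \<odot> x = 0 \<longrightarrow> (u - a) \<odot> y = 0 \<longrightarrow> (u - a) \<odot> (x \<odot> y) = 0"
      unfolding 0 using axis_11[OF a] by blast
    show "\<forall>x y. (u - a) \<odot> x = x \<longrightarrow> (u - a) \<odot> y = y \<longrightarrow> (u - a) \<odot> (x \<odot> y) = x \<odot> y"
      unfolding 1 using axis_00[OF a] by blast
    show "\<forall>x y. (u - a) \<odot> x = 0 \<longrightarrow> (u - a) \<odot> y = y \<longrightarrow> (u - a) \<odot> ((u - a) \<odot> (x \<odot> y)) = (u - a) \<odot> (x \<odot> y) \<and>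
        (0 \<notin> {0 :: 'f} \<longrightarrow> (u - a) \<odot> (x \<odot> y) = x \<odot> y) \<and> (1 \<notin> {0 :: 'f} \<longrightarrow> (u - a) \<odot> (x \<odot> y) = 0)"
    proof (intro allI impI)
      fix x y assume "(u - a) \<odot> x = 0" "(u - a) \<odot> y = y"
      then have "a \<odot> (y \<odot> x) = y \<odot> x" unfolding 0 1 using axis_01_no0[OF a _ _ no0] by blast
      then have "(u - a) \<odot> (x \<odot> y) = 0" unfolding 0 times_comm[of x y] .
      then show "(u - a) \<odot> ((u - a) \<odot> (x \<odot> y)) = (u - a) \<odot> (x \<odot> y) \<and>
        (0 \<notin> {0 :: 'f} \<longrightarrow> (u - a) \<odot> (x \<odot> y) = x \<odot> y) \<and> (1 \<notin> {0 :: 'f} \<longrightarrow> (u - a) \<odot> (x \<odot> y) = 0)"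
        by (simp only: times_zero_right) simp
    qed
    show "\<forall>x y. (u - a) \<odot> x = 0 \<longrightarrow> (u - a) \<odot> y = (1 - \<eta>) *s y \<longrightarrow> (u - a) \<odot> (x \<odot> y) = (1 - \<eta>) *s (x \<odot> y)"
      unfolding 0 h using axis_1h[OF a] by blast
    show "\<forall>x y. (u - a) \<odot> x = x \<longrightarrow> (u - a) \<odot> y = (1 - \<eta>) *s y \<longrightarrow> (u - a) \<odot> (x \<odot> y) = (1 - \<eta>) *s (x \<odot> y)"
      unfolding 1 h using axis_0h[OF a] by blast
    show "\<forall>x y. (u - a) \<odot> x = (1 - \<eta>) *s x \<longrightarrow> (u - a) \<odot> y = (1 - \<eta>) *s y \<longrightarrow>
        (u - a) \<odot> ((u - a) \<odot> (x \<odot> y)) = (u - a) \<odot> (x \<odot> y)"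
      unfolding e h using axis_hh[OF a] by blast
  qed
qed

text \<open>The element \<open>e = u - s - t\<close> is a unit for q and all \<open>A i\<close> and
  annihilates s and t. From \<open>u - (A i + s) = (e - A i) + t\<close> one sees why s and t change
  places. The new q is the value that the product formula forces on the elements
  \<open>e - A i\<close>.\<close>

lemma relations_3C00_dual:
  assumes u: "\<And>x. u \<odot> x = x" and two: "(2 :: 'f) \<noteq> 0" and r: "relations_3C00 (1 - \<eta>) q A s t"
  shows "relations_3C00 \<eta> (q - (2 - \<eta>) *s (u - s - t) + (3 *s (u - s - t) - A IM1 - A I0 - A I1))
    (\<lambda>i. u - s - t - A i) t s"
proof -
  define X Y Z where d: "X = A I0" "Y = A I1" "Z = A IM1"
  define e where "e = u - s - t"
  have hf: "2 * hf = (1 :: 'f)" using two by (simp add: hf_def)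
  have ur: "x \<odot> u = x" for x using u times_comm by metis
  have q: "q \<odot> q = (2 - \<eta>) *s q" "q \<odot> X = (2 - \<eta>) *s X" "q \<odot> Y = (2 - \<eta>) *s Y" "q \<odot> Z = (2 - \<eta>) *s Z"
    "q \<odot> s = 0" "q \<odot> t = 0"
    and i: "X \<odot> X = X" "Y \<odot> Y = Y" "Z \<odot> Z = Z" "s \<odot> s = s" "t \<odot> t = t" "s \<odot> t = 0" "t \<odot> s = 0"
    "X \<odot> s = 0" "X \<odot> t = 0" "Y \<odot> s = 0" "Y \<odot> t = 0" "Z \<odot> s = 0" "Z \<odot> t = 0"
    using r unfolding relations_3C00_def d by (auto simp: times_comm[of t s])
  have AA: "A i \<odot> A j = (- (1 / 2)) *s q + ((1 - \<eta> + 1) / 2) *s (A i + A j) + ((1 - (1 - \<eta>)) / 2) *s A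
      k"
    if "{i, j, k} = {IM1, I0, I1}" for i j k
    using r that unfolding relations_3C00_def by blast
  have "{I0, I1, IM1} = {IM1, I0, I1}" "{I1, IM1, I0} = {IM1, I0, I1}" "{IM1, I0, I1} = {IM1, I0, I1}"
      by auto
  note m = this[THEN AA, folded d]
  have i': "s \<odot> X = 0" "t \<odot> X = 0" "s \<odot> Y = 0" "t \<odot> Y = 0" "s \<odot> Z = 0" "t \<odot> Z = 0" "s \<odot> q = 0"
      "t \<odot> q = 0"
    using i q times_comm by metis+
  have e: "e \<odot> e = e" "X \<odot> e = X" "Y \<odot> e = Y" "Z \<odot> e = Z" "q \<odot> e = q" "s \<odot> e = 0" "t \<odot> e = 0"
    "e \<odot> X = X" "e \<odot> Y = Y" "e \<odot> Z = Z" "e \<odot> q = q" "e \<odot> s = 0" "e \<odot> t = 0"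
    by (simp_all add: e_def times_bilinear u ur i i' q)
  note eq = q i e m
  define q' where "q' = q - (2 - \<eta>) *s e + (3 *s e - Z - X - Y)"
  have comm: "X \<odot> q = (2 - \<eta>) *s X" "Y \<odot> q = (2 - \<eta>) *s Y" "Z \<odot> q = (2 - \<eta>) *s Z" "Y \<odot> X = X \<odot> Y"
      "Z \<odot> Y = Y \<odot> Z" "X \<odot> Z = Z \<odot> X"
    using q times_comm by metis+
  have 1: "q' \<odot> (e - X) = (\<eta> + 1) *s (e - X)" "q' \<odot> (e - Y) = (\<eta> + 1) *s (e - Y)"
      "q' \<odot> (e - Z) = (\<eta> + 1) *s (e - Z)"
    unfolding q'_def times_bilinear comm eq
    by (rule coord_eqI, simp only: coord_linear hf_simps, use hf in algebra)+
  have 2: "q' \<odot> q' = (\<eta> + 1) *s q'"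
    unfolding q'_def times_bilinear comm eq
    by (rule coord_eqI, simp only: coord_linear hf_simps, use hf in algebra)
  have 3: "q' \<odot> s = 0" "q' \<odot> t = 0"
    unfolding q'_def times_bilinear comm eq by simp_all
  have 4: "(e - X) \<odot> (e - X) = e - X" "(e - Y) \<odot> (e - Y) = e - Y" "(e - Z) \<odot> (e - Z) = e - Z"
    "(e - X) \<odot> s = 0" "(e - X) \<odot> t = 0" "(e - Y) \<odot> s = 0" "(e - Y) \<odot> t = 0" "(e - Z) \<odot> s = 0"
        "(e - Z) \<odot> t = 0"
    unfolding times_bilinear comm eq by simp_all
  have 5: "(e - X) \<odot> (e - Y) = (- (1 / 2)) *s q' + ((\<eta> + 1) / 2) *s (e - X + (e - Y)) + ((1 - \<eta>) / 2) *s
      (e - Z)"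
    "(e - Y) \<odot> (e - Z) = (- (1 / 2)) *s q' + ((\<eta> + 1) / 2) *s (e - Y + (e - Z)) + ((1 - \<eta>) / 2) *s (e
        - X)"
    "(e - Z) \<odot> (e - X) = (- (1 / 2)) *s q' + ((\<eta> + 1) / 2) *s (e - Z + (e - X)) + ((1 - \<eta>) / 2) *s (e
        - Y)"
    unfolding q'_def times_bilinear comm eq
    by (rule coord_eqI, simp only: coord_linear hf_simps, use hf in algebra)+
  have B: "e - A IM1 = e - Z" "e - A I0 = e - X" "e - A I1 = e - Y" by (simp_all add: d)
  have 6: "(e - A i) \<odot> (e - A j) = (- (1 / 2)) *s q' + ((\<eta> + 1) / 2) *s (e - A i + (e - A j)) + ((1
      - \<eta>) / 2) *s (e - A k)"
    if ijk: "{i, j, k} = {IM1, I0, I1}" for i j k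
  proof -
    consider "i = I0" "j = I1" "k = IM1" | "i = I1" "j = I0" "k = IM1" | "i = I1" "j = IM1" "k = I0"
      | "i = IM1" "j = I1" "k = I0" | "i = IM1" "j = I0" "k = I1" | "i = I0" "j = IM1" "k = I1"
      using ijk by (cases i; cases j; cases k) auto
    then show ?thesis
      using 5 by cases (simp_all only: B times_comm[of "e - Y" "e - X"] times_comm[of "e - Z"
          "e - Y"] times_comm[of "e - X" "e - Z"]
          add.commute[of "e - Y" "e - X"] add.commute[of "e - Z" "e - Y"] add.commute[of "e - X"
              "e - Z"])
  qed
  have all: "(\<forall>i. Q i) \<longleftrightarrow> Q IM1 \<and> Q I0 \<and> Q I1" for Q :: "idx3 \<Rightarrow> bool"
    using idx3.exhaust by metis
  have "relations_3C00 \<eta> q' (\<lambda>i. e - A i) t s"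
    unfolding relations_3C00_def
  proof (intro conjI)
    show "\<forall>i j k. {i, j, k} = {IM1, I0, I1} \<longrightarrow> (e - A i) \<odot> (e - A j)
      = (- (1 / 2)) *s q' + ((\<eta> + 1) / 2) *s (e - A i + (e - A j)) + ((1 - \<eta>) / 2) *s (e - A k)"
      using 6 by blast
    show "\<forall>i. q' \<odot> (e - A i) = (\<eta> + 1) *s (e - A i)" "\<forall>i. (e - A i) \<odot> (e - A i) = e - A i"
      "\<forall>i. (e - A i) \<odot> t = 0" "\<forall>i. (e - A i) \<odot> s = 0"
      unfolding all B using 1 4 by simp_all
  qed (fact 2 3 i)+
  then show ?thesis unfolding q'_def d e_def by simp
qed

theorem relations_3C00_from_axes:
  assumes u: "\<And>x. u \<odot> x = x" and two: "(2 :: 'f) \<noteq> 0" and \<eta>: "\<eta> \<noteq> 0" "\<eta> \<noteq> 1" "2 * \<eta> \<noteq> 1"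
    and \<Phi>: "\<Phi> \<subseteq> {0, 1}" "\<Phi> \<noteq> {0, 1}" and a0: "axis \<Phi> \<eta> a0" and a1: "axis \<Phi> \<eta> a1"
  obtains q A s t where "relations_3C00 \<eta> q A s t" "A I0 + s = a0" "A I1 + t = a1"
proof -
  have ex: "\<exists>q A s t. relations_3C00 \<eta> q A s t \<and> A I0 + s = a0 \<and> A I1 + t = a1"
    if no1: "1 \<notin> \<Phi>" and \<eta>: "\<eta> \<noteq> 0" "\<eta> \<noteq> 1" "2 * \<eta> \<noteq> 1" and ax: "axis \<Phi> \<eta> a0" "axis \<Phi> \<eta> a1" for \<Phi> \<eta> a0 a1
  proof -
    obtain a where a: "axial_sequence (*s) (\<odot>) \<Phi> \<eta> a" "a 0 = a0" "a 1 = a1"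
      using axial_sequence_exists[OF two \<eta>(1,2) ax] by blast
    interpret S: axial_sequence_no1 "(*s)" "(\<odot>)" \<Phi> \<eta> a
      using a(1) no1 \<eta>(3) by (simp add: axial_sequence_no1_def axial_sequence_no1_axioms_def)
    show ?thesis using S.relations_3C00_exist a(2,3) by metis
  qed
  show ?thesis
  proof (cases "1 \<in> \<Phi>")
    case False
    then show ?thesis using ex[OF _ \<eta> a0 a1] that by blast
  next
    case True
    then have no0: "0 \<notin> \<Phi>" using \<Phi> by auto
    have "1 - \<eta> \<noteq> 0" "1 - \<eta> \<noteq> 1" "2 * (1 - \<eta>) \<noteq> 1" "(1 :: 'f) \<notin> {0}" using \<eta>
        by (auto simp: algebra_simps)
    then obtain q A s t where r: "relations_3C00 (1 - \<eta>) q A s t" "A I0 + s = u - a0"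
        "A I1 + t = u - a1"
      using ex[OF _ _ _ _ axis_dual[OF u a0 no0] axis_dual[OF u a1 no0]] by blast
    have "u - s - t - A I0 + t = a0" "u - s - t - A I1 + s = a1"
      using r(2,3) by (simp_all add: algebra_simps)
    then show ?thesis using relations_3C00_dual[OF u two r(1)] that by blast
  qed
qed

end

section \<open>The unital hull\<close>

context comm_alg
begin

lemma mul_zero: "x \<in> carrier A \<Longrightarrow> mul A x 0 = 0"
  using mul_smul[of x 0 0] subspace_0[OF subspace_carrier] by simp

lemma mul_add_left: "x \<in> carrier A \<Longrightarrow> y \<in> carrier A \<Longrightarrow> z \<in> carrier A \<Longrightarrow>
    mul A (x + y) z = mul A x z + mul A y z"
  using mul_commute mul_add subspace_add[OF subspace_carrier] by metis

lemma mul_smul_left: "x \<in> carrier A \<Longrightarrow> y \<in> carrier A \<Longrightarrow> mul A (smul A c x) y = smul A c (mul A x y)"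
  using mul_commute mul_smul subspace_scale[OF subspace_carrier] by metis

lemma eigsp_sum_even:
  assumes S: "S \<subseteq> {0, 1}" and a: "a \<in> carrier A" and w: "w \<in> eigsp_sum A a S"
  shows "w \<in> carrier A" "mul A a (mul A a w) = mul A a w"
    "0 \<notin> S \<Longrightarrow> mul A a w = w" "1 \<notin> S \<Longrightarrow> mul A a w = 0"
proof -
  obtain x where ws: "w = (\<Sum>s\<in>S. x s)" and x: "\<forall>s\<in>S. x s \<in> eigsp A a s"
    using w by (auto simp: eigsp_sum_def)
  define x0 x1 where d: "x0 = (if 0 \<in> S then x 0 else 0)" "x1 = (if 1 \<in> S then x 1 else 0)"
  have "S = {} \<or> S = {0} \<or> S = {1} \<or> S = {0, 1}" using S by auto
  then have w: "w = x0 + x1" unfolding ws by (elim disjE) (simp_all add: d)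
  have "x0 \<in> eigsp A a 0" "x1 \<in> eigsp A a 1"
    using x a mul_zero subspace_0[OF subspace_carrier] by (auto simp: d eigsp_def)
  then have e: "x0 \<in> carrier A" "x1 \<in> carrier A" "mul A a x0 = 0" "mul A a x1 = x1"
      by (auto simp: eigsp_def)
  have aw: "mul A a w = x1" unfolding w using e a by (simp add: mul_add)
  show "w \<in> carrier A" unfolding w using e subspace_add[OF subspace_carrier] by simp
  show "mul A a (mul A a w) = mul A a w" unfolding aw by (rule e)
  show "mul A a w = w" if "0 \<notin> S" using aw w that by (simp add: d(1))
  show "mul A a w = 0" if "1 \<notin> S" unfolding aw using that by (simp add: d)
qed

lemma eigsp_sum_singleton: "eigsp_sum A a {s} = eigsp A a s"
  unfolding eigsp_sum_def by (auto intro: exI[of _ "\<lambda>_. _"])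

lemma is_axisD:
  assumes ax: "is_axis \<Phi> \<eta> A a" and \<Phi>: "\<Phi> \<subseteq> {0, 1}" and \<eta>: "\<eta> \<noteq> 0" "\<eta> \<noteq> 1"
  shows "a \<in> carrier A" "mul A a a = a"
    and "x \<in> carrier A \<Longrightarrow> \<exists>x0\<in>carrier A. \<exists>x1\<in>carrier A. \<exists>xh\<in>carrier A. x = x0 + x1 + xh \<and>
      mul A a x0 = 0 \<and> mul A a x1 = x1 \<and> mul A a xh = smul A \<eta> xh"
    and "x \<in> carrier A \<Longrightarrow> y \<in> carrier A \<Longrightarrow> mul A a x = 0 \<Longrightarrow> mul A a y = 0 \<Longrightarrow> mul A a (mul A x y) = 0"
    and "x \<in> carrier A \<Longrightarrow> y \<in> carrier A \<Longrightarrow> mul A a x = x \<Longrightarrow> mul A a y = y \<Longrightarrow> mul A a (mul A x y)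
        = mul A x y"
    and "x \<in> carrier A \<Longrightarrow> y \<in> carrier A \<Longrightarrow> mul A a x = 0 \<Longrightarrow> mul A a y = y \<Longrightarrow>
      mul A a (mul A a (mul A x y)) = mul A a (mul A x y) \<and> (0 \<notin> \<Phi> \<longrightarrow> mul A a (mul A x y) = mul A x y) \<and>
      (1 \<notin> \<Phi> \<longrightarrow> mul A a (mul A x y) = 0)"
    and "x \<in> carrier A \<Longrightarrow> y \<in> carrier A \<Longrightarrow> mul A a x = 0 \<Longrightarrow> mul A a y = smul A \<eta> y \<Longrightarrow>
      mul A a (mul A x y) = smul A \<eta> (mul A x y)"
    and "x \<in> carrier A \<Longrightarrow> y \<in> carrier A \<Longrightarrow> mul A a x = x \<Longrightarrow> mul A a y = smul A \<eta> y \<Longrightarrow>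
      mul A a (mul A x y) = smul A \<eta> (mul A x y)"
    and "x \<in> carrier A \<Longrightarrow> y \<in> carrier A \<Longrightarrow> mul A a x = smul A \<eta> x \<Longrightarrow> mul A a y = smul A \<eta> y \<Longrightarrow>
      mul A a (mul A a (mul A x y)) = mul A a (mul A x y)"
proof -
  show a: "a \<in> carrier A" "mul A a a = a" using ax by (auto simp: is_axis_def)
  have e: "x \<in> eigsp A a 0 \<longleftrightarrow> x \<in> carrier A \<and> mul A a x = 0"
      "x \<in> eigsp A a 1 \<longleftrightarrow> x \<in> carrier A \<and> mul A a x = x"
    "x \<in> eigsp A a \<eta> \<longleftrightarrow> x \<in> carrier A \<and> mul A a x = smul A \<eta> x" for x
    by (auto simp: eigsp_def)
  have f: "mul A x y \<in> eigsp_sum A a (fusion_rule \<Phi> \<eta> s t)"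
    if "s \<in> {0, 1, \<eta>}" "t \<in> {0, 1, \<eta>}" "x \<in> eigsp A a s" "y \<in> eigsp A a t" for s t x y
    using ax that unfolding is_axis_def by blast
  have F: "fusion_rule \<Phi> \<eta> 0 0 = {0}" "fusion_rule \<Phi> \<eta> 1 1 = {1}" "fusion_rule \<Phi> \<eta> 0 1 = \<Phi>"
    "fusion_rule \<Phi> \<eta> 0 \<eta> = {\<eta>}" "fusion_rule \<Phi> \<eta> 1 \<eta> = {\<eta>}" "fusion_rule \<Phi> \<eta> \<eta> \<eta> = {0, 1}"
    using \<eta> by (auto simp: fusion_rule_def doubleton_eq_iff)
  show "mul A a (mul A x y) = 0" if "x \<in> carrier A" "y \<in> carrier A" "mul A a x = 0" "mul A a y = 0"
      for x y
    using eigsp_sum_even(4)[OF _ a(1) f[of 0 0 x y, unfolded F]] that e by simp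
  show "mul A a (mul A x y) = mul A x y" if "x \<in> carrier A" "y \<in> carrier A" "mul A a x = x"
      "mul A a y = y" for x y
    using eigsp_sum_even(3)[OF _ a(1) f[of 1 1 x y, unfolded F]] that e by simp
  show "mul A a (mul A a (mul A x y)) = mul A a (mul A x y) \<and> (0 \<notin> \<Phi> \<longrightarrow> mul A a (mul A x y)
      = mul A x y) \<and>
      (1 \<notin> \<Phi> \<longrightarrow> mul A a (mul A x y) = 0)" if "x \<in> carrier A" "y \<in> carrier A" "mul A a x = 0" "mul A a y =
          y" for x y
    using eigsp_sum_even(2-4)[OF \<Phi> a(1) f[of 0 1 x y, unfolded F]] that e by simp
  show "mul A a (mul A a (mul A x y)) = mul A a (mul A x y)"
    if "x \<in> carrier A" "y \<in> carrier A" "mul A a x = smul A \<eta> x" "mul A a y = smul A \<eta> y" for x y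
    using eigsp_sum_even(2)[OF _ a(1) f[of \<eta> \<eta> x y, unfolded F]] that e by simp
  show "mul A a (mul A x y) = smul A \<eta> (mul A x y)"
    if "x \<in> carrier A" "y \<in> carrier A" "mul A a x = 0" "mul A a y = smul A \<eta> y" for x y
    using f[of 0 \<eta> x y, unfolded F eigsp_sum_singleton] that e by simp
  show "mul A a (mul A x y) = smul A \<eta> (mul A x y)"
    if "x \<in> carrier A" "y \<in> carrier A" "mul A a x = x" "mul A a y = smul A \<eta> y" for x y
    using f[of 1 \<eta> x y, unfolded F eigsp_sum_singleton] that e by simp
  show "\<exists>x0\<in>carrier A. \<exists>x1\<in>carrier A. \<exists>xh\<in>carrier A. x = x0 + x1 + xh \<and>
      mul A a x0 = 0 \<and> mul A a x1 = x1 \<and> mul A a xh = smul A \<eta> xh" if "x \<in> carrier A"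
  proof -
    have "x \<in> eigsp_sum A a {0, 1, \<eta>}" using ax that by (simp add: is_axis_def)
    then obtain y where y: "x = (\<Sum>s\<in>{0, 1, \<eta>}. y s)" "\<forall>s\<in>{0, 1, \<eta>}. y s \<in> eigsp A a s"
      by (auto simp: eigsp_sum_def)
    then have "x = y 0 + y 1 + y \<eta>" using \<eta> by (simp add: add.assoc)
    then show ?thesis using y(2) e by (intro bexI[of _ "y 0"] bexI[of _ "y 1"] bexI[of _ "y \<eta>"]) auto
  qed
qed

end

section \<open>Extending the product to the ambient space\<close>

locale projected_alg = comm_alg +
  fixes \<pi> :: "'b \<Rightarrow> 'b"
  assumes \<pi>_add: "\<pi> (x + y) = \<pi> x + \<pi> y"
    and \<pi>_smul: "\<pi> (smul A c x) = smul A c (\<pi> x)"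
    and \<pi>_carrier: "\<pi> x \<in> carrier A"
    and \<pi>_id: "x \<in> carrier A \<Longrightarrow> \<pi> x = x"

lemma (in comm_alg) projected_alg_exists:
  obtains \<pi> where "projected_alg A \<pi>"
proof -
  interpret vector_space_pair "smul A" "smul A" by unfold_locales
  have "Vector_Spaces.linear (smul A) (smul A) id" by (rule linear_id)
  then obtain \<pi> where \<pi>: "range \<pi> \<subseteq> carrier A" "Vector_Spaces.linear (smul A) (smul A) \<pi>"
      "\<forall>v\<in>carrier A. \<pi> (id v) = v"
    using linear_exists_left_inverse_on[OF _ subspace_carrier, of id] by auto
  have "projected_alg A \<pi>"
    using \<pi> linear_add[OF \<pi>(2)] linear_scale[OF \<pi>(2)] by unfold_locales auto
  then show ?thesis by (rule that)
qed

context projected_alg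
begin

lemmas closed = subspace_0[OF subspace_carrier] subspace_add[OF subspace_carrier]
  subspace_diff[OF subspace_carrier] subspace_scale[OF subspace_carrier] mul_closed

text \<open>Projecting both factors linearly keeps the product bilinear on the whole type while it
  agrees with the given one on the carrier, so everything proved for \<open>total_alg\<close>
  becomes available.\<close>

definition ptimes :: "'b \<Rightarrow> 'b \<Rightarrow> 'b" where
  "ptimes x y = mul A (\<pi> x) (\<pi> y)"

lemma ptimes_mul: "x \<in> carrier A \<Longrightarrow> y \<in> carrier A \<Longrightarrow> ptimes x y = mul A x y"
  by (simp add: ptimes_def \<pi>_id)

lemma ptimes_total_alg: "total_alg (smul A) ptimes"
  by unfold_locales
    (simp_all add: ptimes_def \<pi>_add \<pi>_smul \<pi>_carrier mul_add mul_smul mul_commute)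

text \<open>The kernel of the projection annihilates everything, so axes of \<open>A\<close> stay axes.\<close>

lemma ptimes_axis:
  assumes ax: "is_axis \<Phi> \<eta> A a" and \<Phi>: "\<Phi> \<subseteq> {0, 1}" and \<eta>: "\<eta> \<noteq> 0" "\<eta> \<noteq> 1"
  shows "total_alg.axis (smul A) ptimes \<Phi> \<eta> a"
proof -
  interpret H: total_alg "smul A" ptimes by (rule ptimes_total_alg)
  note D = is_axisD[OF ax \<Phi> \<eta>]
  have a: "ptimes a x = mul A a (\<pi> x)" for x using D(1) by (simp add: ptimes_def \<pi>_id)
  have c: "ptimes x y \<in> carrier A" for x y by (simp add: ptimes_def \<pi>_carrier mul_closed)
  have E1: "ptimes a x = x \<longleftrightarrow> x \<in> carrier A \<and> mul A a x = x" for x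
    using c[of a x] a[of x] by (auto simp: \<pi>_id)
  have Eh: "ptimes a x = smul A \<eta> x \<longleftrightarrow> x \<in> carrier A \<and> mul A a x = smul A \<eta> x" for x
  proof -
    have "x \<in> carrier A" if "ptimes a x = smul A \<eta> x"
    proof -
      have "smul A (1 / \<eta>) (smul A \<eta> x) \<in> carrier A" using that c closed(4) by metis
      then show ?thesis using \<eta> by simp
    qed
    then show ?thesis using a[of x] by (auto simp: \<pi>_id)
  qed
  have aa: "ptimes a (ptimes x y) = mul A a (mul A (\<pi> x) (\<pi> y))" for x y
    using c[of x y] by (simp add: a \<pi>_id) (simp add: ptimes_def)
  have aaa: "ptimes a (ptimes a (ptimes x y)) = mul A a (mul A a (mul A (\<pi> x) (\<pi> y)))" for x y
    unfolding aa using D(1) \<pi>_carrier closed by (simp add: a \<pi>_id)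
  have p: "ptimes x y = mul A (\<pi> x) (\<pi> y)" for x y by (simp add: ptimes_def)
  show ?thesis
    unfolding H.axis_def
  proof (intro conjI)
    show "ptimes a a = a" using D(1,2) by (simp add: ptimes_mul)
    show "\<forall>x. \<exists>x0 x1 xh. x = x0 + x1 + xh \<and> ptimes a x0 = 0 \<and> ptimes a x1 = x1 \<and> ptimes a xh
        = smul A \<eta> xh"
    proof
      fix x
      obtain x0 x1 xh where x: "x0 \<in> carrier A" "x1 \<in> carrier A" "xh \<in> carrier A" "\<pi> x = x0 + x1 + xh"
        "mul A a x0 = 0" "mul A a x1 = x1" "mul A a xh = smul A \<eta> xh"
        using D(3)[OF \<pi>_carrier, of x] by blast
      have "\<pi> (x - \<pi> x) = 0" using \<pi>_add[of "x - \<pi> x" "\<pi> x"] \<pi>_id[OF \<pi>_carrier] by simp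
      then have "\<pi> (x - \<pi> x + x0) = x0" unfolding \<pi>_add[of "x - \<pi> x" x0] using x(1) \<pi>_id by simp
      then have "ptimes a (x - \<pi> x + x0) = 0" unfolding a using x by simp
      moreover have "x = (x - \<pi> x + x0) + x1 + xh" using x(4) by (simp add: algebra_simps)
      ultimately show "\<exists>x0 x1 xh. x = x0 + x1 + xh \<and> ptimes a x0 = 0 \<and> ptimes a x1 = x1 \<and> ptimes a xh
          = smul A \<eta> xh"
        using x E1 Eh by blast
    qed
    show "\<forall>x y. ptimes a x = 0 \<longrightarrow> ptimes a y = 0 \<longrightarrow> ptimes a (ptimes x y) = 0"
      unfolding aa using D(4)[OF \<pi>_carrier \<pi>_carrier] a by simp
    show "\<forall>x y. ptimes a x = x \<longrightarrow> ptimes a y = y \<longrightarrow> ptimes a (ptimes x y) = ptimes x y"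
      unfolding aa E1 using D(5) by (simp add: p \<pi>_id)
    show "\<forall>x y. ptimes a x = 0 \<longrightarrow> ptimes a y = y \<longrightarrow> ptimes a (ptimes a (ptimes x y))
        = ptimes a (ptimes x y) \<and>
        (0 \<notin> \<Phi> \<longrightarrow> ptimes a (ptimes x y) = ptimes x y) \<and> (1 \<notin> \<Phi> \<longrightarrow> ptimes a (ptimes x y) = 0)"
      unfolding aaa unfolding aa E1 using D(6)[OF \<pi>_carrier] a
          by (simp add: p \<pi>_id \<pi>_carrier mul_closed D(1))
    show "\<forall>x y. ptimes a x = 0 \<longrightarrow> ptimes a y = smul A \<eta> y \<longrightarrow> ptimes a (ptimes x y)
        = smul A \<eta> (ptimes x y)"
      unfolding aa Eh using D(7)[OF \<pi>_carrier] a by (simp add: p \<pi>_id)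
    show "\<forall>x y. ptimes a x = x \<longrightarrow> ptimes a y = smul A \<eta> y \<longrightarrow> ptimes a (ptimes x y)
        = smul A \<eta> (ptimes x y)"
      unfolding aa Eh E1 using D(8) by (simp add: p \<pi>_id)
    show "\<forall>x y. ptimes a x = smul A \<eta> x \<longrightarrow> ptimes a y = smul A \<eta> y \<longrightarrow> ptimes a (ptimes a (ptimes x y))
        = ptimes a (ptimes x y)"
      unfolding aaa unfolding aa Eh using D(9) by (simp add: \<pi>_id)
  qed
qed

end

section \<open>Adjoining a unit\<close>

context total_alg
begin

text \<open>A pair \<open>(v, c)\<close> stands for v plus c times a new unit, which is
  \<open>(0, 1)\<close>.\<close>

definition hull_scale :: "'f \<Rightarrow> 'v \<times> 'f \<Rightarrow> 'v \<times> 'f" where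
  "hull_scale c x = (c *s fst x, c * snd x)"

definition hull_times :: "'v \<times> 'f \<Rightarrow> 'v \<times> 'f \<Rightarrow> 'v \<times> 'f" where
  "hull_times x y = (fst x \<odot> fst y + snd x *s fst y + snd y *s fst x, snd x * snd y)"

lemma hull_total_alg: "total_alg hull_scale hull_times"
proof unfold_locales
  fix x y z :: "'v \<times> 'f" and c d :: 'f
  show "hull_scale c (x + y) = hull_scale c x + hull_scale c y"
    "hull_scale (c + d) x = hull_scale c x + hull_scale d x"
    "hull_scale c (hull_scale d x) = hull_scale (c * d) x" "hull_scale 1 x = x"
    by (simp_all add: hull_scale_def prod_eq_iff algebra_simps)
  show "hull_times x y = hull_times y x"
    by (simp add: hull_times_def prod_eq_iff times_comm[of "fst x"] mult.commute add.assoc add.commute)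
  show "hull_times x (y + z) = hull_times x y + hull_times x z"
    "hull_times x (hull_scale c y) = hull_scale c (hull_times x y)"
    by (simp_all add: hull_times_def hull_scale_def prod_eq_iff times_bilinear algebra_simps)
qed

lemma hull_unit: "hull_times (0, 1) x = x"
  by (simp add: hull_times_def)

text \<open>The hull adds one new direction, spanned by the unit minus \<open>a\<close>, which is a
  0-eigenvector. Splitting \<open>(y, l)\<close> into \<open>y + l *s a\<close> and l times this
  vector reduces each claim to the vector \<open>y + l *s a\<close> of the old algebra. Eigenvectors
  for 1 and for the nonzero \<eta> have l = 0.\<close>

lemma hull_axis:
  assumes ax: "axis \<Phi> \<eta> a" and \<eta>: "\<eta> \<noteq> 0"
  shows "total_alg.axis hull_scale hull_times \<Phi> \<eta> (a, 0)"
proof -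
  interpret H: total_alg hull_scale hull_times by (rule hull_total_alg)
  have aw: "hull_times (a, 0) (y, l) = (a \<odot> (y + l *s a), 0)" for y l
    by (simp add: hull_times_def times_bilinear axis_idem[OF ax])
  have E0: "hull_times (a, 0) (y, l) = 0 \<longleftrightarrow> a \<odot> (y + l *s a) = 0" for y l
    unfolding aw by (simp add: zero_prod_def)
  have E1: "hull_times (a, 0) (y, l) = (y, l) \<longleftrightarrow> l = 0 \<and> a \<odot> y = y" for y l
    unfolding aw by auto
  have Eh: "hull_times (a, 0) (y, l) = hull_scale \<eta> (y, l) \<longleftrightarrow> l = 0 \<and> a \<odot> y = \<eta> *s y" for y l
    unfolding aw hull_scale_def using \<eta> by auto
  have T: "hull_times (y, l) (y', l') = (y \<odot> y' + l *s y' + l' *s y, l * l')" for y l y' l'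
    by (simp add: hull_times_def)
  have T0: "hull_times (y, l) (y', 0) = ((y + l *s a) \<odot> y' + l *s (y' - a \<odot> y'), 0)" for y l y'
    by (simp add: hull_times_def times_bilinear algebra_simps)
  have S: "hull_scale c (y, 0) = (c *s y, 0)" for c y by (simp add: hull_scale_def)
  have aw0: "hull_times (a, 0) (y, 0) = (a \<odot> y, 0)" for y using aw[of y 0] by simp
  show ?thesis
    unfolding H.axis_def split_paired_All
  proof (intro conjI allI impI)
    show "hull_times (a, 0) (a, 0) = (a, 0)" using aw[of a 0] axis_idem[OF ax] by simp
  next
    fix y l
    obtain v0 v1 vh where v: "y + l *s a = v0 + v1 + vh" "a \<odot> v0 = 0" "a \<odot> v1 = v1" "a \<odot> vh = \<eta> *s vh"
      using axis_decomp[OF ax] by blast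
    have "y - v1 - vh + l *s a = v0" using v(1) by (simp add: algebra_simps)
    then have "hull_times (a, 0) (y - v1 - vh, l) = 0" unfolding E0 using v by simp
    moreover have "hull_times (a, 0) (v1, 0) = (v1, 0)"
        "hull_times (a, 0) (vh, 0) = hull_scale \<eta> (vh, 0)"
      unfolding E1 Eh using v by simp_all
    moreover have "(y, l) = (y - v1 - vh, l) + (v1, 0) + (vh, 0)" by simp
    ultimately show "\<exists>x0 x1 xh. (y, l) = x0 + x1 + xh \<and> hull_times (a, 0) x0 = 0 \<and>
        hull_times (a, 0) x1 = x1 \<and> hull_times (a, 0) xh = hull_scale \<eta> xh"
      by blast
  next
    fix y l y' l'
    assume "hull_times (a, 0) (y, l) = 0" "hull_times (a, 0) (y', l') = 0"
    then have v: "a \<odot> (y + l *s a) = 0" "a \<odot> (y' + l' *s a) = 0" unfolding E0 .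
    then have "a \<odot> ((y + l *s a) \<odot> (y' + l' *s a)) = 0" using axis_00[OF ax] by blast
    then have "a \<odot> ((y + l *s a) \<odot> (y' + l' *s a) + l *s (y' + l' *s a) + l' *s (y + l *s a)) = 0"
      using v by (simp only: times_add_right[of a] times_scale_right) simp
    \<comment> \<open>The right side is the vector that \<open>E0\<close> attaches to the product of
      the two pairs, so killing it by \<open>a\<close> is the claim.\<close>
    moreover have "(y + l *s a) \<odot> (y' + l' *s a) + l *s (y' + l' *s a) + l' *s (y + l *s a)
      = y \<odot> y' + l *s y' + l' *s y + (l * l') *s a"
    proof -
      have "a \<odot> y = - (l *s a)" "a \<odot> y' = - (l' *s a)"
        using v by (simp_all add: times_bilinear axis_idem[OF ax] eq_neg_iff_add_eq_0)
      then show ?thesis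
        unfolding times_bilinear axis_idem[OF ax] times_comm[of y a]
        by (intro coord_eqI) (simp add: coord_linear algebra_simps)
    qed
    ultimately show "hull_times (a, 0) (hull_times (y, l) (y', l')) = 0"
      unfolding T[of y l y' l'] E0 by simp
  next
    fix y l y' l'
    assume "hull_times (a, 0) (y, l) = (y, l)" "hull_times (a, 0) (y', l') = (y', l')"
    then show "hull_times (a, 0) (hull_times (y, l) (y', l')) = hull_times (y, l) (y', l')"
      unfolding E1 using axis_11[OF ax] by (simp add: T aw)
  next
    fix y l y' l'
    assume "hull_times (a, 0) (y, l) = 0" "hull_times (a, 0) (y', l') = (y', l')"
    then have v: "a \<odot> (y + l *s a) = 0" "a \<odot> y' = y'" "l' = 0" unfolding E0 E1 by auto
    have t: "hull_times (y, l) (y', l') = ((y + l *s a) \<odot> y', 0)"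
      unfolding v(3) T0 v(2) by simp
    show "hull_times (a, 0) (hull_times (a, 0) (hull_times (y, l) (y', l')))
        = hull_times (a, 0) (hull_times (y, l) (y', l'))"
      unfolding t aw0 using axis_01[OF ax v(1,2)] by simp
    show "hull_times (a, 0) (hull_times (y, l) (y', l')) = hull_times (y, l) (y', l')" if "0 \<notin> \<Phi>"
      unfolding t aw0 using axis_01_no0[OF ax v(1,2) that] by simp
    show "hull_times (a, 0) (hull_times (y, l) (y', l')) = 0" if "1 \<notin> \<Phi>"
      unfolding t aw0 using axis_01_no1[OF ax v(1,2) that] by (simp add: zero_prod_def)
  next
    fix y l y' l'
    assume "hull_times (a, 0) (y, l) = 0" "hull_times (a, 0) (y', l') = hull_scale \<eta> (y', l')"
    then have v: "a \<odot> (y + l *s a) = 0" "a \<odot> y' = \<eta> *s y'" "l' = 0" unfolding E0 Eh by auto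
    have t: "hull_times (y, l) (y', l') = ((y + l *s a) \<odot> y' + (l * (1 - \<eta>)) *s y', 0)"
      unfolding v(3) T0 v(2) by (simp add: algebra_simps)
    show "hull_times (a, 0) (hull_times (y, l) (y', l')) = hull_scale \<eta> (hull_times (y, l) (y', l'))"
      unfolding t aw0 S using axis_0h[OF ax v(1,2)] v(2)
      by (simp only: times_add_right[of a] times_scale_right) (simp add: algebra_simps)
  next
    fix y l y' l'
    assume "hull_times (a, 0) (y, l) = (y, l)" "hull_times (a, 0) (y', l') = hull_scale \<eta> (y', l')"
    then show "hull_times (a, 0) (hull_times (y, l) (y', l')) = hull_scale \<eta> (hull_times (y, l) (y',
        l'))"
      unfolding E1 Eh using axis_1h[OF ax] by (simp add: T aw S)
  next
    fix y l y' l'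
    assume "hull_times (a, 0) (y, l) = hull_scale \<eta> (y, l)"
        "hull_times (a, 0) (y', l') = hull_scale \<eta> (y', l')"
    then show "hull_times (a, 0) (hull_times (a, 0) (hull_times (y, l) (y', l')))
        = hull_times (a, 0) (hull_times (y, l) (y', l'))"
      unfolding Eh using axis_hh[OF ax] by (simp add: T aw)
  qed
qed

end

section \<open>Recognising axes\<close>

context total_alg
begin

lemma times_span:
  assumes T: "subspace T" and EF: "\<And>x y. x \<in> E \<Longrightarrow> y \<in> F \<Longrightarrow> x \<odot> y \<in> T"
    and x: "x \<in> span E" and y: "y \<in> span F"
  shows "x \<odot> y \<in> T"
proof -
  have 1: "x \<odot> y \<in> T" if "x \<in> E" for x
    using y
  proof (induction rule: span_induct)
    show "subspace {y. x \<odot> y \<in> T}"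
      using T by (auto simp: subspace_def times_add_right times_scale_right)
  qed (use that EF in auto)
  show ?thesis
    using x
  proof (induction rule: span_induct)
    show "subspace {x. x \<odot> y \<in> T}"
      using T by (auto simp: subspace_def times_add_left times_scale_left)
  qed (use 1 in auto)
qed

text \<open>Since eigenspaces for different eigenvalues are independent and the given eigenvectors
  span, each eigenspace is exactly the span of its given vectors. The fusion rules then follow
  bilinearly from products of these vectors. Mixed products are asked to be zero, which serves every
  \<open>\<Phi>\<close> at once.\<close>

lemma is_axisI:
  fixes A :: "('f, 'v) alg"
  assumes A: "smul A = scale" "mul A = times" "comm_alg A"
    and a: "a \<in> carrier A" "a \<odot> a = a" and \<eta>: "\<eta> \<noteq> 0" "\<eta> \<noteq> 1"
    and E0: "\<And>x. x \<in> E0 \<Longrightarrow> x \<in> carrier A \<and> a \<odot> x = 0"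
    and E1: "\<And>x. x \<in> E1 \<Longrightarrow> x \<in> carrier A \<and> a \<odot> x = x"
    and Eh: "\<And>x. x \<in> Eh \<Longrightarrow> x \<in> carrier A \<and> a \<odot> x = \<eta> *s x"
    and sp: "carrier A \<subseteq> span (E0 \<union> E1 \<union> Eh)"
    and f00: "\<And>x y. x \<in> E0 \<Longrightarrow> y \<in> E0 \<Longrightarrow> a \<odot> (x \<odot> y) = 0"
    and f11: "\<And>x y. x \<in> E1 \<Longrightarrow> y \<in> E1 \<Longrightarrow> a \<odot> (x \<odot> y) = x \<odot> y"
    and f01: "\<And>x y. x \<in> E0 \<Longrightarrow> y \<in> E1 \<Longrightarrow> x \<odot> y = 0"
    and f0h: "\<And>x y. x \<in> E0 \<Longrightarrow> y \<in> Eh \<Longrightarrow> a \<odot> (x \<odot> y) = \<eta> *s (x \<odot> y)"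
    and f1h: "\<And>x y. x \<in> E1 \<Longrightarrow> y \<in> Eh \<Longrightarrow> a \<odot> (x \<odot> y) = \<eta> *s (x \<odot> y)"
    and fhh: "\<And>x y. x \<in> Eh \<Longrightarrow> y \<in> Eh \<Longrightarrow> a \<odot> (a \<odot> (x \<odot> y)) = a \<odot> (x \<odot> y)"
  shows "is_axis \<Phi> \<eta> A a"
proof -
  interpret A: comm_alg A by (rule A)
  have C: "subspace (carrier A)" using A.subspace_carrier unfolding A .
  have closed: "x \<odot> y \<in> carrier A" if "x \<in> carrier A" "y \<in> carrier A" for x y
      using A.mul_closed[OF that] unfolding A .
  have eig: "eigsp A a s = {x \<in> carrier A. a \<odot> x = s *s x}" for s by (simp add: eigsp_def A)
  have sub: "subspace (eigsp A a s)" for s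
    unfolding eig using C by (auto simp: subspace_def times_bilinear scale_right_distrib mult.commute)
  have sub': "subspace {w \<in> carrier A. a \<odot> (a \<odot> w) = a \<odot> w}"
    using C by (auto simp: subspace_def times_bilinear)
  have S: "span E0 \<subseteq> eigsp A a 0" "span E1 \<subseteq> eigsp A a 1" "span Eh \<subseteq> eigsp A a \<eta>"
    using E0 E1 Eh by (intro span_minimal sub; auto simp: eig)+
  have dec: "\<exists>x0 x1 xh. x = x0 + x1 + xh \<and> x0 \<in> span E0 \<and> x1 \<in> span E1 \<and> xh \<in> span Eh" if x:
      "x \<in> carrier A" for x
  proof -
    from x sp have "x \<in> span (E0 \<union> E1 \<union> Eh)" by blast
    then show ?thesis unfolding span_Un by blast
  qed
  have indep: "x0 = 0 \<and> x1 = 0 \<and> xh = 0"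
    if "x0 \<in> eigsp A a 0" "x1 \<in> eigsp A a 1" "xh \<in> eigsp A a \<eta>" "x0 + x1 + xh = 0" for x0 x1 xh
  proof -
    have e: "a \<odot> x0 = 0" "a \<odot> x1 = x1" "a \<odot> xh = \<eta> *s xh" using that by (auto simp: eig)
    have 1: "x1 + \<eta> *s xh = 0" using arg_cong[OF that(4), of
        "\<lambda>x. a \<odot> x"] e by (simp add: times_add_right)
    have 2: "x1 + (\<eta> * \<eta>) *s xh = 0" using arg_cong[OF 1, of
        "\<lambda>x. a \<odot> x"] e by (simp add: times_add_right times_scale_right)
    have "(\<eta> * \<eta> - \<eta>) *s xh = 0" 
    proof -
      have "x1 + \<eta> *s xh = x1 + (\<eta> * \<eta>) *s xh" using 1 2 by simp
      then show ?thesis unfolding scale_left_diff_distrib by (simp only: add_left_cancel) simp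
    qed
    moreover have "\<eta> * \<eta> - \<eta> \<noteq> 0" using \<eta> by (simp add: right_diff_distrib[symmetric])
    ultimately have "xh = 0" by (simp only: scale_eq_0_iff) simp
    then show ?thesis using 1 that(4) by simp
  qed
  have z: "0 \<in> eigsp A a s" for s using sub by (rule subspace_0)
  have dif: "x - y \<in> eigsp A a s" if "x \<in> eigsp A a s" "y \<in> eigsp A a s" for x y s using sub that
      by (rule subspace_diff)
  have eigs: "x \<in> span E0" if xe: "x \<in> eigsp A a 0" for x
  proof -
    obtain x0 x1 xh where x: "x = x0 + x1 + xh" "x0 \<in> span E0" "x1 \<in> span E1" "xh \<in> span Eh"
      using dec[of x] xe by (auto simp: eig)
    have "(x0 - x) + x1 + xh = 0" using x(1) by simp
    then have "x0 - x = 0" using indep[of "x0 - x" x1 xh] dif[of x0 0 x] that x S by blast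
    then have "x0 = x" by (simp only: right_minus_eq)
    then show ?thesis using x(2) by simp
  qed
  have eigs1: "x \<in> span E1" if xe: "x \<in> eigsp A a 1" for x
  proof -
    obtain x0 x1 xh where x: "x = x0 + x1 + xh" "x0 \<in> span E0" "x1 \<in> span E1" "xh \<in> span Eh"
      using dec[of x] xe by (auto simp: eig)
    have "x0 + (x1 - x) + xh = 0" using x(1) by simp
    then have "x1 - x = 0" using indep[of x0 "x1 - x" xh] dif[of x1 1 x] that x S by blast
    then have "x1 = x" by (simp only: right_minus_eq)
    then show ?thesis using x(3) by simp
  qed
  have eigsh: "x \<in> span Eh" if xe: "x \<in> eigsp A a \<eta>" for x
  proof -
    obtain x0 x1 xh where x: "x = x0 + x1 + xh" "x0 \<in> span E0" "x1 \<in> span E1" "xh \<in> span Eh"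
      using dec[of x] xe by (auto simp: eig)
    have "x0 + x1 + (xh - x) = 0" using x(1) by simp
    then have "xh - x = 0" using indep[of x0 x1 "xh - x"] dif[of xh \<eta> x] that x S by blast
    then have "xh = x" by (simp only: right_minus_eq)
    then show ?thesis using x(4) by simp
  qed
  have sum3: "(\<Sum>s\<in>{0, 1, \<eta>}. x s) = x 0 + x 1 + x \<eta>" for x :: "'f \<Rightarrow> 'v"
    using \<eta> by (simp add: add.assoc)
  have even: "w \<in> eigsp_sum A a {0, 1}" if "w \<in> carrier A" "a \<odot> (a \<odot> w) = a \<odot> w" for w
  proof -
    define x where "x s = (if s = 0 then w - a \<odot> w else a \<odot> w)" for s :: 'f
    have "(\<Sum>s\<in>{0, 1}. x s) = w" by (simp add: x_def)
    moreover have "\<forall>s\<in>{0, 1}. x s \<in> eigsp A a s"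
      using that a closed subspace_diff[OF C] by (auto simp: x_def eig times_bilinear)
    ultimately show ?thesis unfolding eigsp_sum_def by blast
  qed
  have single: "eigsp_sum A a {s} = eigsp A a s" for s by (rule A.eigsp_sum_singleton)
  have F: "fusion_rule \<Phi> \<eta> 0 0 = {0}" "fusion_rule \<Phi> \<eta> 1 1 = {1}" "fusion_rule \<Phi> \<eta> 0 1 = \<Phi>"
      "fusion_rule \<Phi> \<eta> 1 0 = \<Phi>"
    "fusion_rule \<Phi> \<eta> 0 \<eta> = {\<eta>}" "fusion_rule \<Phi> \<eta> \<eta> 0 = {\<eta>}" "fusion_rule \<Phi> \<eta> 1 \<eta> = {\<eta>}"
        "fusion_rule \<Phi> \<eta> \<eta> 1 = {\<eta>}"
    "fusion_rule \<Phi> \<eta> \<eta> \<eta> = {0, 1}"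
    using \<eta> by (auto simp: fusion_rule_def doubleton_eq_iff)
  have "(\<Sum>s\<in>\<Phi>. (\<lambda>_. 0) s) \<in> eigsp_sum A a \<Phi>"
    unfolding eigsp_sum_def by (intro CollectI exI[of _ "\<lambda>_. 0"]) (simp add: z)
  then have zero: "0 \<in> eigsp_sum A a \<Phi>" by simp
  note ts = times_span
  have g00: "x \<odot> y \<in> eigsp A a 0" if "x \<in> eigsp A a 0" "y \<in> eigsp A a 0" for x y
    using eigs[OF that(1)] eigs[OF that(2)] by (rule ts[OF sub,
        rotated]) (use f00 E0 closed in \<open>auto simp: eig\<close>)
  have g11: "x \<odot> y \<in> eigsp A a 1" if "x \<in> eigsp A a 1" "y \<in> eigsp A a 1" for x y
    using eigs1[OF that(1)] eigs1[OF that(2)] by (rule ts[OF sub,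
        rotated]) (use f11 E1 closed in \<open>auto simp: eig\<close>)
  have g01: "x \<odot> y = 0" if "x \<in> eigsp A a 0" "y \<in> eigsp A a 1" for x y
    using ts[OF subspace_single_0, of E0 E1 x y] f01 eigs[OF that(1)] eigs1[OF that(2)] by simp
  have g0h: "x \<odot> y \<in> eigsp A a \<eta>" if "x \<in> eigsp A a 0" "y \<in> eigsp A a \<eta>" for x y
    using eigs[OF that(1)] eigsh[OF that(2)] by (rule ts[OF sub,
        rotated]) (use f0h E0 Eh closed in \<open>auto simp: eig\<close>)
  have g1h: "x \<odot> y \<in> eigsp A a \<eta>" if "x \<in> eigsp A a 1" "y \<in> eigsp A a \<eta>" for x y
    using eigs1[OF that(1)] eigsh[OF that(2)] by (rule ts[OF sub,
        rotated]) (use f1h E1 Eh closed in \<open>auto simp: eig\<close>)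
  have ghh: "x \<odot> y \<in> eigsp_sum A a {0, 1}" if "x \<in> eigsp A a \<eta>" "y \<in> eigsp A a \<eta>" for x y
  proof -
    have "x \<odot> y \<in> {w \<in> carrier A. a \<odot> (a \<odot> w) = a \<odot> w}"
      using eigsh[OF that(1)] eigsh[OF that(2)] by (rule ts[OF sub',
          rotated]) (use fhh Eh closed in auto)
    then show ?thesis using even by blast
  qed
  show ?thesis
    unfolding is_axis_def
  proof (intro conjI ballI)
    show "a \<in> carrier A" "mul A a a = a" using a by (simp_all add: A)
    show "carrier A = eigsp_sum A a {0, 1, \<eta>}"
    proof (intro equalityI subsetI)
      fix x assume "x \<in> carrier A"
      then obtain x0 x1 xh where x: "x = x0 + x1 + xh" "x0 \<in> span E0" "x1 \<in> span E1" "xh \<in> span Eh"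
        using dec by blast
      define f where "f s = (if s = 0 then x0 else if s = 1 then x1 else xh)" for s :: 'f
      have "x = (\<Sum>s\<in>{0, 1, \<eta>}. f s)" unfolding sum3 using \<eta> x by (simp add: f_def)
      moreover have "\<forall>s\<in>{0, 1, \<eta>}. f s \<in> eigsp A a s" using x S \<eta> by (auto simp: f_def)
      ultimately show "x \<in> eigsp_sum A a {0, 1, \<eta>}" unfolding eigsp_sum_def by blast
    next
      fix x assume "x \<in> eigsp_sum A a {0, 1, \<eta>}"
      then obtain f where "x = f 0 + f 1 + f \<eta>" "\<forall>s\<in>{0, 1, \<eta>}. f s \<in> eigsp A a s"
        unfolding eigsp_sum_def sum3 by blast
      then show "x \<in> carrier A" using subspace_add[OF C] by (auto simp: eig)
    qed
    show "eigsp_independent A a {0, 1, \<eta>}"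
      unfolding eigsp_independent_def sum3 using indep by auto
    fix s t x y
    assume st: "s \<in> {0, 1, \<eta>}" "t \<in> {0, 1, \<eta>}" and x: "x \<in> eigsp A a s" and y: "y \<in> eigsp A a t"
    have "x \<odot> y \<in> eigsp_sum A a (fusion_rule \<Phi> \<eta> s t)"
    proof -
      consider "s = 0" "t = 0" | "s = 1" "t = 1" | "s = 0" "t = 1" | "s = 1" "t = 0" | "s = 0" "t = \<eta>" |
          "s = \<eta>" "t = 0"
        | "s = 1" "t = \<eta>" | "s = \<eta>" "t = 1" | "s = \<eta>" "t = \<eta>"
        using st by blast
      then show ?thesis
      proof cases
        case 1 then show ?thesis using g00 x y by (simp add: F single)
      next
        case 2 then show ?thesis using g11 x y by (simp add: F single)
      next
        case 3 then show ?thesis using g01[of x y] x y zero by (simp add: F)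
      next
        case 4 then show ?thesis using g01[of y x] x y zero by (simp add: F times_comm[of x])
      next
        case 5 then show ?thesis using g0h x y by (simp add: F single)
      next
        case 6 then show ?thesis using g0h[of y x] x y by (simp add: F single times_comm[of x])
      next
        case 7 then show ?thesis using g1h x y by (simp add: F single)
      next
        case 8 then show ?thesis using g1h[of y x] x y by (simp add: F single times_comm[of x])
      next
        case 9 then show ?thesis using ghh x y by (simp add: F)
      qed
    qed
    then show "mul A x y \<in> eigsp_sum A a (fusion_rule \<Phi> \<eta> s t)" by (simp add: A)
  qed
qed

lemma comm_algI:
  fixes A :: "('f, 'v) alg"
  assumes "smul A = scale" "mul A = times" "subspace (carrier A)"
    and "\<And>x y. x \<in> carrier A \<Longrightarrow> y \<in> carrier A \<Longrightarrow> x \<odot> y \<in> carrier A"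
  shows "comm_alg A"
proof -
  have "vector_space (smul A)" unfolding assms(1) by unfold_locales
  then show ?thesis
    unfolding comm_alg_def comm_alg_axioms_def assms(1,2)
    using assms(3,4) times_comm times_add_right times_scale_right by blast
qed

end

section \<open>Algebras given by structure constants\<close>

lemma basis_alg_simps [simp]:
  "carrier (basis_alg B t) = {x. Poly_Mapping.keys x \<subseteq> B}" "smul (basis_alg B t) = pscale"
  by (simp_all add: basis_alg_def)

text \<open>With a common index set for x, y and x + y, additivity can be compared term by term even
  when the supports differ.\<close>

lemma mul_basis_alg_superset:
  fixes t :: "'b \<Rightarrow> 'b \<Rightarrow> ('b \<Rightarrow>\<^sub>0 'f::field)"
  assumes "finite K" "finite L" "Poly_Mapping.keys x \<subseteq> K" "Poly_Mapping.keys y \<subseteq> L"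
  shows "mul (basis_alg B t) x y
    = (\<Sum>i\<in>K. \<Sum>j\<in>L. pscale (Poly_Mapping.lookup x i * Poly_Mapping.lookup y j) (t i j))"
proof -
  have z: "pscale 0 v = 0" for v :: "'b \<Rightarrow>\<^sub>0 'f" by (rule poly_mapping_eqI) simp
  have "(\<Sum>i\<in>Poly_Mapping.keys x. \<Sum>j\<in>Poly_Mapping.keys y. pscale (Poly_Mapping.lookup x i *
      Poly_Mapping.lookup y j) (t i j))
    = (\<Sum>i\<in>Poly_Mapping.keys x. \<Sum>j\<in>L. pscale (Poly_Mapping.lookup x i * Poly_Mapping.lookup y j)
        (t i j))"
    by (intro sum.cong refl sum.mono_neutral_left) (use assms in \<open>auto simp: z in_keys_iff\<close>)
  also have "\<dots> = (\<Sum>i\<in>K. \<Sum>j\<in>L. pscale (Poly_Mapping.lookup x i * Poly_Mapping.lookup y j) (t i j))"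
    by (intro sum.mono_neutral_left) (use assms in \<open>auto simp: z in_keys_iff\<close>)
  finally show ?thesis by (simp add: basis_alg_def)
qed

lemma basis_alg_total:
  assumes "\<And>i j. t i j = t j i"
  shows "total_alg pscale (mul (basis_alg B t))"
proof -
  interpret vector_space pscale by (rule vector_space_pscale)
  let ?m = "mul (basis_alg B t)"
  show ?thesis
  proof unfold_locales
    fix x y z :: "'a \<Rightarrow>\<^sub>0 'b" and c
    show "?m x y = ?m y x"
      unfolding basis_alg_def using assms
      by (simp, subst sum.swap) (simp add: mult.commute)
    let ?K = "Poly_Mapping.keys x" and ?L = "Poly_Mapping.keys y \<union> Poly_Mapping.keys z"
    have "Poly_Mapping.keys (y + z) \<subseteq> ?L" by (rule Poly_Mapping.keys_add)
    then show "?m x (y + z) = ?m x y + ?m x z"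
      using mul_basis_alg_superset[of ?K ?L x "y + z"] mul_basis_alg_superset[of ?K ?L x y]
        mul_basis_alg_superset[of ?K ?L x z]
      by (simp add: lookup_add distrib_left scale_left_distrib sum.distrib)
    have "Poly_Mapping.keys (pscale c y) \<subseteq> Poly_Mapping.keys y" by (auto simp: in_keys_iff)
    then show "?m x (pscale c y) = pscale c (?m x y)"
      using mul_basis_alg_superset[of ?K "Poly_Mapping.keys y" x
          "pscale c y"] mul_basis_alg_superset[of ?K "Poly_Mapping.keys y" x y]
      by (simp add: scale_sum_right mult.left_commute)
  qed
qed

lemma mul_basis_alg_bvec:
  fixes t :: "'b \<Rightarrow> 'b \<Rightarrow> ('b \<Rightarrow>\<^sub>0 'f::field)"
  shows "mul (basis_alg B t) (bvec i) (bvec j) = t i j"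
proof -
  have "pscale 1 v = v" for v :: "'b \<Rightarrow>\<^sub>0 'f" by (rule poly_mapping_eqI) simp
  then show ?thesis by (simp add: basis_alg_def)
qed

context total_alg
begin

definition lin :: "('c \<Rightarrow> 'v) \<Rightarrow> ('c \<Rightarrow>\<^sub>0 'f) \<Rightarrow> 'v" where
  "lin g x = (\<Sum>k\<in>Poly_Mapping.keys x. Poly_Mapping.lookup x k *s g k)"

lemma lin_superset:
  assumes "finite K" "Poly_Mapping.keys x \<subseteq> K"
  shows "lin g x = (\<Sum>k\<in>K. Poly_Mapping.lookup x k *s g k)"
  unfolding lin_def by (intro sum.mono_neutral_left) (use assms in \<open>auto simp: in_keys_iff\<close>)

lemma lin_add: "lin g (x + y) = lin g x + lin g y"
proof -
  let ?K = "Poly_Mapping.keys x \<union> Poly_Mapping.keys y"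
  have "Poly_Mapping.keys (x + y) \<subseteq> ?K" by (rule Poly_Mapping.keys_add)
  then show ?thesis
    using lin_superset[of ?K "x + y" g] lin_superset[of ?K x g] lin_superset[of ?K y g]
    by (simp add: lookup_add scale_left_distrib sum.distrib)
qed

lemma lin_pscale: "lin g (pscale c x) = c *s lin g x"
proof -
  have "Poly_Mapping.keys (pscale c x) \<subseteq> Poly_Mapping.keys x" by (auto simp: in_keys_iff)
  then show ?thesis
    using lin_superset[of "Poly_Mapping.keys x" "pscale c x" g] by (simp add: lin_def scale_sum_right)
qed

lemma lin_zero: "lin g 0 = 0"
  by (simp add: lin_def)

lemma lin_diff: "lin g (x - y) = lin g x - lin g y"
  using lin_add[of g "x - y" y] by simp

lemma lin_bvec: "lin g (bvec k) = g k"
  by (simp add: lin_def)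

lemmas lin_simps = lin_add lin_pscale lin_zero lin_diff lin_bvec

lemma lin_sum: "lin g (\<Sum>i\<in>I. f i) = (\<Sum>i\<in>I. lin g (f i))"
  by (induction I rule: infinite_finite_induct) (simp_all add: lin_simps)

lemma times_sum_right: "x \<odot> (\<Sum>i\<in>I. f i) = (\<Sum>i\<in>I. x \<odot> f i)"
  by (induction I rule: infinite_finite_induct) (simp_all add: times_add_right)

lemma times_sum_left: "(\<Sum>i\<in>I. f i) \<odot> x = (\<Sum>i\<in>I. f i \<odot> x)"
  by (induction I rule: infinite_finite_induct) (simp_all add: times_add_left)

lemma lin_mul:
  assumes g: "\<And>i j. i \<in> B \<Longrightarrow> j \<in> B \<Longrightarrow> g i \<odot> g j = lin g (t i j)"
    and x: "Poly_Mapping.keys x \<subseteq> B" and y: "Poly_Mapping.keys y \<subseteq> B"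
  shows "lin g (mul (basis_alg B t) x y) = lin g x \<odot> lin g y"
proof -
  have "lin g (mul (basis_alg B t) x y) = (\<Sum>i\<in>Poly_Mapping.keys x. \<Sum>j\<in>Poly_Mapping.keys y.
      (Poly_Mapping.lookup x i * Poly_Mapping.lookup y j) *s lin g (t i j))"
    by (simp add: basis_alg_def lin_sum lin_pscale)
  also have "\<dots> = (\<Sum>i\<in>Poly_Mapping.keys x. \<Sum>j\<in>Poly_Mapping.keys y.
      (Poly_Mapping.lookup x i * Poly_Mapping.lookup y j) *s (g i \<odot> g j))"
    using x y by (intro sum.cong refl) (metis g subsetD)
  also have "\<dots> = lin g x \<odot> lin g y"
    by (simp add: lin_def times_sum_left times_sum_right times_bilinear scale_sum_right mult.commute)
        (rule sum.swap)
  finally show ?thesis .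
qed

end

section \<open>Isomorphism with the universal algebra\<close>

lemma generates_subset:
  assumes "generates A S" "subalgebra A B" "S \<subseteq> B"
  shows "carrier A \<subseteq> B"
  using assms hull_minimal[of S B "subalgebra A"] by (simp add: generates_def)

lemma alg_hom_eq_on_generators:
  assumes A: "comm_alg A" and B: "comm_alg B" and gen: "generates A S" and f: "alg_hom A B f" and g:
      "alg_hom A B g"
    and eq: "\<And>x. x \<in> S \<Longrightarrow> f x = g x" and x: "x \<in> carrier A"
  shows "f x = g x"
proof -
  interpret A: comm_alg A by (rule A)
  interpret B: comm_alg B by (rule B)
  have z: "0 \<in> carrier A" by (rule A.subspace_0[OF A.subspace_carrier])
  have h0: "h 0 = 0" if "alg_hom A B h" for h
  proof -
    have "h (0 + 0) = h 0 + h 0" using that z unfolding alg_hom_def by blast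
    then show ?thesis by simp
  qed
  have "f 0 = g 0" using h0[OF f] h0[OF g] by simp
  then have "A.subspace {x \<in> carrier A. f x = g x}"
    using A.subspace_carrier f g unfolding A.subspace_def alg_hom_def by auto
  then have "subalgebra A {x \<in> carrier A. f x = g x}"
    using f g A.mul_closed by (auto simp: subalgebra_def alg_hom_def)
  moreover have "S \<subseteq> {x \<in> carrier A. f x = g x}" using gen eq by (auto simp: generates_def)
  ultimately show ?thesis using generates_subset[OF gen] x by blast
qed

lemma alg_hom_comp: "alg_hom A B u \<Longrightarrow> alg_hom B C v \<Longrightarrow> alg_hom A C (v \<circ> u)"
  unfolding alg_hom_def by (auto simp: Pi_def)

lemma alg_hom_id: "alg_hom A A id"
  unfolding alg_hom_def by auto

text \<open>Universality of \<open>M\<close> provides a map to \<open>X\<close>, and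
  \<open>h\<close> is a map back. Both composites fix the generators, hence are the identity, so
  these maps are mutually inverse.\<close>

lemma universal_isomorphic:
  fixes M :: "('f::field, 'm::ab_group_add) alg" and X :: "('f, 'w::ab_group_add) alg"
  assumes fin: "finite \<Phi>" and M: "universal_axial_alg2 \<Phi> \<eta> M a" and X: "axial_alg2 \<Phi> \<eta> X b"
    and h: "axial_hom X b M a h"
  shows "axial_isomorphic M a X b"
proof -
  obtain a0 a1 b0 b1 where ab: "a = (a0, a1)" "b = (b0, b1)" by (cases a; cases b)
  have M2: "axial_alg2 \<Phi> \<eta> M a" using M by (simp add: universal_axial_alg2_def)
  have cM: "comm_alg M" and cX: "comm_alg X" and gM: "generates M {a0, a1}" and gX:
      "generates X {b0, b1}"
    using M2 X by (auto simp: axial_alg2_def ab)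
  obtain f where f: "axial_hom M a X b f" using universal_axial_alg2D[OF fin M X] by blast
  have "(h \<circ> f) x = id x" if "x \<in> carrier M" for x
    by (rule alg_hom_eq_on_generators[OF cM cM gM alg_hom_comp alg_hom_id _ that])
      (use f h in \<open>auto simp: axial_hom_def ab\<close>)
  then have hf: "h (f x) = x" if "x \<in> carrier M" for x using that by simp
  have "(f \<circ> h) x = id x" if "x \<in> carrier X" for x
    by (rule alg_hom_eq_on_generators[OF cX cX gX alg_hom_comp alg_hom_id _ that])
      (use f h in \<open>auto simp: axial_hom_def ab\<close>)
  then have fh: "f (h x) = x" if "x \<in> carrier X" for x using that by simp
  have "bij_betw f (carrier M) (carrier X)"
    by (rule bij_betw_byWitness[of _ h]) (use hf fh f h in \<open>auto simp: axial_hom_def alg_hom_def\<close>)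
  then show ?thesis using f unfolding axial_isomorphic_def by blast
qed

text \<open>The relations are found in the unital hull, so \<open>h\<close> could leave
  \<open>M\<close>. The elements whose image lies in \<open>M\<close> form a subalgebra, and it
  contains the two generators.\<close>

lemma hom_into_hull:
  fixes M :: "('f::field, 'm::ab_group_add) alg" and X :: "('f, 'w::ab_group_add) alg"
  assumes M: "projected_alg M \<pi>" and X: "comm_alg X" and gen: "generates X {b0, b1}"
    and a: "a0 \<in> carrier M" "a1 \<in> carrier M"
    and h: "h b0 = (a0, 0)" "h b1 = (a1, 0)"
    and h_add: "\<And>x y. x \<in> carrier X \<Longrightarrow> y \<in> carrier X \<Longrightarrow> h (x + y) = h x + h y"
    and h_scale: "\<And>c x. x \<in> carrier X \<Longrightarrow> h (smul X c x) = total_alg.hull_scale (smul M) c (h x)"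
    and h_mul: "\<And>x y. x \<in> carrier X \<Longrightarrow> y \<in> carrier X \<Longrightarrow>
      h (mul X x y) = total_alg.hull_times (smul M) (projected_alg.ptimes M \<pi>) (h x) (h y)"
  shows "axial_hom X (b0, b1) M (a0, a1) (fst \<circ> h)"
proof -
  interpret M: projected_alg M \<pi> by (rule M)
  interpret X: comm_alg X by (rule X)
  interpret V: total_alg "smul M" "M.ptimes" by (rule M.ptimes_total_alg)
  let ?D = "{x \<in> carrier X. fst (h x) \<in> carrier M \<and> snd (h x) = 0}"
  have z: "0 \<in> carrier X" by (rule X.subspace_0[OF X.subspace_carrier])
  have h0: "h 0 = 0" using h_add[OF z z] by simp
  have "X.subspace ?D"
    using X.subspace_carrier h_add h_scale h0 M.closed
    by (auto simp: X.subspace_def V.hull_scale_def)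
  moreover have "mul X x y \<in> ?D" if "x \<in> ?D" "y \<in> ?D" for x y
    using that h_mul X.mul_closed M.closed by (auto simp: V.hull_times_def M.ptimes_mul)
  ultimately have "subalgebra X ?D" by (auto simp: subalgebra_def)
  moreover have "{b0, b1} \<subseteq> ?D" using gen a h by (auto simp: generates_def)
  ultimately have "carrier X \<subseteq> ?D" by (rule generates_subset[OF gen])
  then have D: "fst (h x) \<in> carrier M" "snd (h x) = 0" if "x \<in> carrier X" for x using that by auto
  show ?thesis
    unfolding axial_hom_def alg_hom_def
    using D h_add h_scale h_mul h by (auto simp: V.hull_scale_def V.hull_times_def M.ptimes_mul)
qed

lemma generatesI:
  assumes "comm_alg A" "S \<subseteq> carrier A" "\<And>B. subalgebra A B \<Longrightarrow> S \<subseteq> B \<Longrightarrow> carrier A \<subseteq> B"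
  shows "generates A S"
proof -
  interpret comm_alg A by fact
  have "subalgebra A (carrier A)" using subspace_carrier mul_closed by (auto simp: subalgebra_def)
  then show ?thesis unfolding generates_def using assms by (intro conjI hull_unique) auto
qed

lemma poly_mapping_in_span: "x \<in> module.span pscale (bvec ` Poly_Mapping.keys x)"
proof -
  interpret vector_space pscale by (rule vector_space_pscale)
  have "x = (\<Sum>k\<in>Poly_Mapping.keys x. pscale (Poly_Mapping.lookup x k) (bvec k))"
    by (rule poly_mapping_eqI)
      (auto simp: lookup_sum lookup_single when_def in_keys_iff if_distrib[of
          "\<lambda>c. _ * c"] cong: if_cong)
  also have "\<dots> \<in> span (bvec ` Poly_Mapping.keys x)"
    by (intro span_sum span_scale span_base) auto
  finally show ?thesis .
qed

section \<open>The algebra \<open>3C\<^sup>0\<^sup>0\<close>\<close>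

context total_alg
begin

lemma relations_3C00_swap: "relations_3C00 \<eta> q A s t \<Longrightarrow> relations_3C00 \<eta> q A t s"
  unfolding relations_3C00_def by (simp add: times_comm[of t s])

lemma relations_3C00D:
  assumes "relations_3C00 \<eta> q A s t" "{i, j, k} = {IM1, I0, I1}"
  shows "q \<odot> q = (\<eta> + 1) *s q" "q \<odot> A l = (\<eta> + 1) *s A l" "A l \<odot> q = (\<eta> + 1) *s A l" "A l \<odot> A l = A l"
    "A i \<odot> A j = (- (1 / 2)) *s q + ((\<eta> + 1) / 2) *s (A i + A j) + ((1 - \<eta>) / 2) *s A k"
    "A j \<odot> A k = (- (1 / 2)) *s q + ((\<eta> + 1) / 2) *s (A j + A k) + ((1 - \<eta>) / 2) *s A i"
    "A k \<odot> A i = (- (1 / 2)) *s q + ((\<eta> + 1) / 2) *s (A k + A i) + ((1 - \<eta>) / 2) *s A j"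
    "A j \<odot> A i = (- (1 / 2)) *s q + ((\<eta> + 1) / 2) *s (A i + A j) + ((1 - \<eta>) / 2) *s A k"
    "A k \<odot> A j = (- (1 / 2)) *s q + ((\<eta> + 1) / 2) *s (A j + A k) + ((1 - \<eta>) / 2) *s A i"
    "A i \<odot> A k = (- (1 / 2)) *s q + ((\<eta> + 1) / 2) *s (A k + A i) + ((1 - \<eta>) / 2) *s A j"
    "q \<odot> s = 0" "q \<odot> t = 0" "s \<odot> q = 0" "t \<odot> q = 0" "A l \<odot> s = 0" "A l \<odot> t = 0" "s \<odot> A l = 0"
        "t \<odot> A l = 0"
    "s \<odot> s = s" "t \<odot> t = t" "s \<odot> t = 0" "t \<odot> s = 0"
proof -
  have r: "q \<odot> q = (\<eta> + 1) *s q" "q \<odot> A l = (\<eta> + 1) *s A l" "A l \<odot> A l = A l" "q \<odot> s = 0" "q \<odot> t = 0"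
    "A l \<odot> s = 0" "A l \<odot> t = 0" "s \<odot> s = s" "t \<odot> t = t" "s \<odot> t = 0" for l
    using assms(1) unfolding relations_3C00_def by blast+
  have m: "A i \<odot> A j = (- (1 / 2)) *s q + ((\<eta> + 1) / 2) *s (A i + A j) + ((1 - \<eta>) / 2) *s A k"
    if "{i, j, k} = {IM1, I0, I1}" for i j k
    using assms(1) that unfolding relations_3C00_def by blast
  have "{j, k, i} = {IM1, I0, I1}" "{k, i, j} = {IM1, I0, I1}" using assms(2) by auto
  note m = m[OF assms(2)] this[THEN m]
  show "q \<odot> q = (\<eta> + 1) *s q" "q \<odot> A l = (\<eta> + 1) *s A l" "A l \<odot> A l = A l"
    "A i \<odot> A j = (- (1 / 2)) *s q + ((\<eta> + 1) / 2) *s (A i + A j) + ((1 - \<eta>) / 2) *s A k"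
    "A j \<odot> A k = (- (1 / 2)) *s q + ((\<eta> + 1) / 2) *s (A j + A k) + ((1 - \<eta>) / 2) *s A i"
    "A k \<odot> A i = (- (1 / 2)) *s q + ((\<eta> + 1) / 2) *s (A k + A i) + ((1 - \<eta>) / 2) *s A j"
    "q \<odot> s = 0" "q \<odot> t = 0" "A l \<odot> s = 0" "A l \<odot> t = 0"
    "s \<odot> s = s" "t \<odot> t = t" "s \<odot> t = 0"
    by (fact r m)+
  show "A l \<odot> q = (\<eta> + 1) *s A l"
    "A j \<odot> A i = (- (1 / 2)) *s q + ((\<eta> + 1) / 2) *s (A i + A j) + ((1 - \<eta>) / 2) *s A k"
    "A k \<odot> A j = (- (1 / 2)) *s q + ((\<eta> + 1) / 2) *s (A j + A k) + ((1 - \<eta>) / 2) *s A i"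
    "A i \<odot> A k = (- (1 / 2)) *s q + ((\<eta> + 1) / 2) *s (A k + A i) + ((1 - \<eta>) / 2) *s A j"
    "s \<odot> q = 0" "t \<odot> q = 0" "s \<odot> A l = 0" "t \<odot> A l = 0" "t \<odot> s = 0"
    using r m times_comm by metis+
qed

lemma relations_3C00_is_axis:
  fixes M :: "('f, 'v) alg"
  assumes M: "smul M = scale" "mul M = times" "comm_alg M" "carrier M = UNIV"
    and two: "(2 :: 'f) \<noteq> 0" and \<eta>: "\<eta> \<noteq> 0" "\<eta> \<noteq> 1"
    and r: "relations_3C00 \<eta> q A s t" and ijk: "{i, j, k} = {IM1, I0, I1}"
    and sp: "span {q, A i, A j, A k, s, t} = UNIV"
  shows "is_axis \<Phi> \<eta> M (A i + s)"
proof -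
  note R = relations_3C00D[OF r ijk]
  have hf: "2 * hf = (1 :: 'f)" using two by (simp add: hf_def)
  \<comment> \<open>The reflection exchanges \<open>A j\<close> and \<open>A k\<close>, so their
    difference is odd. For the even part, \<open>A i \<odot> (A j + A k) = A j + A k - q + (\<eta> +
    1) *s A i\<close>, and \<open>A i\<close> acts on q as on \<open>(\<eta> + 1) *s A i\<close>;
    this suggests the remaining vectors.\<close>
  let ?E0 = "{q - (\<eta> + 1) *s A i, t}" and ?E1 = "{A i, s, A j + A k - q}" and ?Eh = "{A j - A k}"
  show ?thesis
  proof (rule is_axisI[OF M(1-3), where ?E0.0 = ?E0 and ?E1.0 = ?E1 and Eh = ?Eh])
    show "A i + s \<in> carrier M" by (simp add: M)
    show "(A i + s) \<odot> (A i + s) = A i + s" unfolding times_bilinear R by simp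
    let ?S = "span (?E0 \<union> ?E1 \<union> ?Eh)"
    have b: "q - (\<eta> + 1) *s A i \<in> ?S" "A i \<in> ?S" "A j + A k - q \<in> ?S" "A j - A k \<in> ?S" "s \<in> ?S" "t \<in> ?S"
      by (auto intro: span_base)
    have "q - (\<eta> + 1) *s A i + (\<eta> + 1) *s A i \<in> ?S" using b by (intro span_add span_scale)
    then have q: "q \<in> ?S" by simp
    have "(1 / 2) *s (A j + A k - q + (A j - A k) + q) \<in> ?S"
        "(1 / 2) *s (A j + A k - q - (A j - A k) + q) \<in> ?S"
      by (rule span_scale[OF span_add[OF span_add[OF b(3,4)] q]] span_scale[OF span_add[OF span_diff[OF
          b(3,4)] q]])+
    moreover have "(1 / 2) *s (A j + A k - q + (A j - A k) + q) = A j"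
        "(1 / 2) *s (A j + A k - q - (A j - A k) + q) = A k"
      by (rule coord_eqI, simp only: coord_linear hf_simps, (algebra | use hf in algebra))+
    ultimately have "{q, A i, A j, A k, s, t} \<subseteq> ?S" using b q by auto
    then have "span {q, A i, A j, A k, s, t} \<subseteq> ?S" by (rule span_minimal) (rule subspace_span)
    then show "carrier M \<subseteq> ?S" unfolding sp by (rule order_trans[OF subset_UNIV])
  next
    fix x assume "x \<in> ?E0"
    moreover have "(A i + s) \<odot> (q - (\<eta> + 1) *s A i) = 0" "(A i + s) \<odot> t = 0"
      unfolding times_bilinear R by simp_all
    ultimately show "x \<in> carrier M \<and> (A i + s) \<odot> x = 0" by (auto simp: M)
  next
    fix x assume "x \<in> ?E1"
    moreover have "(A i + s) \<odot> A i = A i" "(A i + s) \<odot> s = s" unfolding times_bilinear R by simp_all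
    moreover have "(A i + s) \<odot> (A j + A k - q) = A j + A k - q"
      unfolding times_bilinear R by (rule coord_eqI, simp only: coord_linear hf_simps,
          (algebra | use hf in algebra))+
    ultimately show "x \<in> carrier M \<and> (A i + s) \<odot> x = x" by (auto simp: M)
  next
    fix x assume "x \<in> ?Eh"
    moreover have "(A i + s) \<odot> (A j - A k) = \<eta> *s (A j - A k)"
      unfolding times_bilinear R by (rule coord_eqI, simp only: coord_linear hf_simps,
          (algebra | use hf in algebra))
    ultimately show "x \<in> carrier M \<and> (A i + s) \<odot> x = \<eta> *s x" by (auto simp: M)
  next
    fix x y assume "x \<in> ?E0" "y \<in> ?E0"
    moreover have "(q - (\<eta> + 1) *s A i) \<odot> (q - (\<eta> + 1) *s A i) = (\<eta> + 1) *s (q - (\<eta> + 1) *s A i)"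
      "(q - (\<eta> + 1) *s A i) \<odot> t = 0" "t \<odot> (q - (\<eta> + 1) *s A i) = 0"
      unfolding times_bilinear R by (simp_all add: scale_right_diff_distrib)
    moreover have "t \<odot> t = t" by (rule R)
    moreover have "(A i + s) \<odot> (q - (\<eta> + 1) *s A i) = 0" "(A i + s) \<odot> t = 0"
      unfolding times_bilinear R by simp_all
    ultimately show "(A i + s) \<odot> (x \<odot> y) = 0" by (auto simp: times_scale_right)
  next
    fix x y assume xy: "x \<in> ?E1" "y \<in> ?E1"
    define c where "c = A j + A k - q"
    have p: "A i \<odot> c = c - s \<odot> c" "c \<odot> c = (1 - \<eta>) *s A i - \<eta> *s c"
      unfolding c_def times_bilinear R
      by (rule coord_eqI, simp only: coord_linear hf_simps, (algebra | use hf in algebra))+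
    have "s \<odot> c = 0" unfolding c_def times_bilinear R by simp
    note p = p this
    have c: "A i \<odot> c = c" "c \<odot> A i = c" "c \<odot> s = 0" "s \<odot> c = 0" "c \<odot> c = (1 - \<eta>) *s A i - \<eta> *s c"
      using p times_comm by (metis diff_zero)+
    show "(A i + s) \<odot> (x \<odot> y) = x \<odot> y"
      using xy unfolding c_def[symmetric] by (auto simp: R c times_bilinear)
  next
    fix x y assume "x \<in> ?E0" "y \<in> ?E1"
    moreover have "(q - (\<eta> + 1) *s A i) \<odot> A i = 0" "(q - (\<eta> + 1) *s A i) \<odot> s = 0"
      "t \<odot> A i = 0" "t \<odot> s = 0" "t \<odot> (A j + A k - q) = 0"
      unfolding times_bilinear R by simp_all
    moreover have "(q - (\<eta> + 1) *s A i) \<odot> (A j + A k - q) = 0"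
      unfolding times_bilinear R by (rule coord_eqI, simp only: coord_linear hf_simps,
          (algebra | use hf in algebra))
    ultimately show "x \<odot> y = 0" by auto
  next
    fix x y assume "x \<in> ?E0" "y \<in> ?Eh"
    moreover have "t \<odot> (A j - A k) = 0" unfolding times_bilinear R by simp
    moreover have "(q - (\<eta> + 1) *s A i) \<odot> (A j - A k) = ((\<eta> + 1) * (1 - \<eta>)) *s (A j - A k)"
      unfolding times_bilinear R by (rule coord_eqI, simp only: coord_linear hf_simps,
          (algebra | use hf in algebra))+
    moreover have "(A i + s) \<odot> (A j - A k) = \<eta> *s (A j - A k)"
      unfolding times_bilinear R by (rule coord_eqI, simp only: coord_linear hf_simps,
          (algebra | use hf in algebra))
    ultimately show "(A i + s) \<odot> (x \<odot> y) = \<eta> *s (x \<odot> y)" by (auto simp: times_scale_right mult.commute)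
  next
    fix x y assume "x \<in> ?E1" "y \<in> ?Eh"
    moreover have "s \<odot> (A j - A k) = 0" unfolding times_bilinear R by simp
    moreover have "A i \<odot> (A j - A k) = \<eta> *s (A j - A k)"
      "(A j + A k - q) \<odot> (A j - A k) = (- \<eta>) *s (A j - A k)"
      unfolding times_bilinear R by (rule coord_eqI, simp only: coord_linear hf_simps,
          (algebra | use hf in algebra))+
    moreover have "(A i + s) \<odot> (A j - A k) = \<eta> *s (A j - A k)"
      unfolding times_bilinear R by (rule coord_eqI, simp only: coord_linear hf_simps,
          (algebra | use hf in algebra))
    ultimately show "(A i + s) \<odot> (x \<odot> y) = \<eta> *s (x \<odot> y)"
        by (auto simp: times_scale_right times_minus_right)
  next
    fix x y assume "x \<in> ?Eh" "y \<in> ?Eh"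
    moreover have "(A j - A k) \<odot> (A j - A k) = q - \<eta> *s (A j + A k) - (1 - \<eta>) *s A i"
      unfolding times_bilinear R by (rule coord_eqI, simp only: coord_linear hf_simps,
          (algebra | use hf in algebra))
    moreover have "(A i + s) \<odot> (q - \<eta> *s (A j + A k) - (1 - \<eta>) *s A i)
        = (\<eta> + 1) *s A i - \<eta> *s (A j + A k - q + (\<eta> + 1) *s A i) - (1 - \<eta>) *s A i"
      unfolding times_bilinear R by (rule coord_eqI, simp only: coord_linear hf_simps,
          (algebra | use hf in algebra))
    moreover have "(A i + s) \<odot> ((\<eta> + 1) *s A i - \<eta> *s (A j + A k - q + (\<eta> + 1) *s A i) - (1 - \<eta>) *s A i)
        = (\<eta> + 1) *s A i - \<eta> *s (A j + A k - q + (\<eta> + 1) *s A i) - (1 - \<eta>) *s A i"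
      unfolding times_bilinear R by (rule coord_eqI, simp only: coord_linear hf_simps,
          (algebra | use hf in algebra))
    ultimately show "(A i + s) \<odot> ((A i + s) \<odot> (x \<odot> y)) = (A i + s) \<odot> (x \<odot> y)" by auto
  qed (fact \<eta>)+
qed

text \<open>Products of the generators first yield \<open>X \<odot> Y\<close>, since s and t are
  orthogonal to everything else. Multiplying it by the generators gives \<open>X \<odot> Z\<close>
  and \<open>Y \<odot> Z\<close>, after division by \<open>1 - \<eta>\<close>. Differences of these
  products give \<open>Y - Z\<close> and \<open>X - Z\<close>, after division by \<eta>. One more
  product isolates Y, and the rest follows linearly.\<close>

lemma relations_3C00_generated:
  assumes two: "(2 :: 'f) \<noteq> 0" and \<eta>: "\<eta> \<noteq> 0" "\<eta> \<noteq> 1" and r: "relations_3C00 \<eta> q A s t"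
    and S: "subspace S" "\<And>x y. x \<in> S \<Longrightarrow> y \<in> S \<Longrightarrow> x \<odot> y \<in> S" and a: "A I0 + s \<in> S" "A I1 + t \<in> S"
  shows "span {q, A I0, A I1, A IM1, s, t} \<subseteq> S"
proof -
  define X Y Z where d: "X = A I0" "Y = A I1" "Z = A IM1"
  have "{I0, I1, IM1} = {IM1, I0, I1}" by auto
  note R = relations_3C00D[OF r this]
  note R' = R[folded d] R(2-4,15-18)[of I0, folded d] R(2-4,15-18)[of I1, folded d] R(2-4,15-18)[of IM1,
      folded d]
  have hf: "2 * hf = (1 :: 'f)" using two by (simp add: hf_def)
  note [intro] = subspace_add[OF S(1)] subspace_diff[OF S(1)] subspace_scale[OF S(1)] S(2)
  have a: "X + s \<in> S" "Y + t \<in> S" using a by (simp_all add: d)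
  have div: "x \<in> S" if "c *s x \<in> S" "c \<noteq> 0" for c x
    using subspace_scale[OF S(1) that(1), of "1 / c"] that(2) by simp
  have "(X + s) \<odot> (Y + t) = X \<odot> Y" unfolding times_bilinear R' by simp
  then have b: "X \<odot> Y \<in> S" using a S(2) by metis
  have "(X + s) \<odot> (X \<odot> Y) - ((\<eta> + 1) / 2) *s (X \<odot> Y) = ((1 - \<eta>) / 2) *s (X \<odot> Z)"
    unfolding R' times_bilinear by (rule coord_eqI, simp only: coord_linear hf_simps,
        (algebra | use hf in algebra))
  moreover have "(X + s) \<odot> (X \<odot> Y) - ((\<eta> + 1) / 2) *s (X \<odot> Y) \<in> S" using a b by blast
  ultimately have b': "X \<odot> Z \<in> S" using div[of "(1 - \<eta>) / 2" "X \<odot> Z"] \<eta> two by simp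
  have "(Y + t) \<odot> (X \<odot> Y) - ((\<eta> + 1) / 2) *s (X \<odot> Y) = ((1 - \<eta>) / 2) *s (Y \<odot> Z)"
    unfolding R' times_bilinear by (rule coord_eqI, simp only: coord_linear hf_simps,
        (algebra | use hf in algebra))
  moreover have "(Y + t) \<odot> (X \<odot> Y) - ((\<eta> + 1) / 2) *s (X \<odot> Y) \<in> S" using a b by blast
  ultimately have b'': "Y \<odot> Z \<in> S" using div[of "(1 - \<eta>) / 2" "Y \<odot> Z"] \<eta> two by simp
  have "X \<odot> Y - X \<odot> Z = \<eta> *s (Y - Z)" "X \<odot> Y - Y \<odot> Z = \<eta> *s (X - Z)"
    unfolding R' times_bilinear by (rule coord_eqI, simp only: coord_linear hf_simps,
        (algebra | use hf in algebra))+
  moreover have "X \<odot> Y - X \<odot> Z \<in> S" "X \<odot> Y - Y \<odot> Z \<in> S" using b b' b'' by blast+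
  ultimately have c: "Y - Z \<in> S" "X - Z \<in> S" using div[of \<eta>] \<eta> by simp_all
  have "(Y + t) \<odot> (Y - Z) + Y \<odot> Z = Y" unfolding times_bilinear R' by simp
  moreover have "(Y + t) \<odot> (Y - Z) + Y \<odot> Z \<in> S" using a c b'' by blast
  ultimately have Y: "Y \<in> S" by simp
  have "Y - (Y - Z) \<in> S" "X - Z + (Y - (Y - Z)) \<in> S" using Y c by blast+
  then have XZ: "Z \<in> S" "X \<in> S" by simp_all
  have "X + s - X \<in> S" "Y + t - Y \<in> S" using a XZ Y by blast+
  then have st: "s \<in> S" "t \<in> S" by simp_all
  have "(\<eta> + 1) *s (X + Y) + (1 - \<eta>) *s Z - 2 *s (X \<odot> Y) \<in> S" using b XZ Y by blast
  moreover have "(\<eta> + 1) *s (X + Y) + (1 - \<eta>) *s Z - 2 *s (X \<odot> Y) = q"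
    unfolding R' by (rule coord_eqI, simp only: coord_linear hf_simps, (algebra | use hf in algebra))
  ultimately have "{q, A I0, A I1, A IM1, s, t} \<subseteq> S" using Y XZ st by (auto simp: d)
  then show ?thesis using S(1) by (rule span_minimal)
qed

end

section \<open>The concrete direct sum and its maps\<close>

lemma direct_sum_alg_simps [simp]:
  "carrier (direct_sum_alg A B) = carrier A \<times> carrier B"
  "smul (direct_sum_alg A B) c x = (smul A c (fst x), smul B c (snd x))"
  "mul (direct_sum_alg A B) x y = (mul A (fst x) (fst y), mul B (snd x) (snd y))"
  by (simp_all add: direct_sum_alg_def split_beta)

lemma direct_sum_total:
  assumes "total_alg (smul A) (mul A)" "total_alg (smul B) (mul B)"
  shows "total_alg (smul (direct_sum_alg A B)) (mul (direct_sum_alg A B))"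
proof -
  interpret A: total_alg "smul A" "mul A" by fact
  interpret B: total_alg "smul B" "mul B" by fact
  show ?thesis
    by unfold_locales
      (auto simp: prod_eq_iff A.times_bilinear B.times_bilinear A.scale_right_distrib
          B.scale_right_distrib
        A.scale_left_distrib B.scale_left_distrib intro: A.times_comm B.times_comm)
qed

lemma the_third:
  assumes "{i, j, k} = {IM1, I0, I1}"
  shows "(THE k. {i, j, k} = {IM1, I0, I1}) = k"
  using assms by (intro the_equality) (cases i; cases j; cases k; auto)+

lemma table_3C_commute: "table_3C \<eta> i j = table_3C \<eta> j i"
  by (cases i; cases j) (auto simp: add.commute insert_commute)

lemma total_3C: "total_alg (smul (alg_3C_hat \<eta>)) (mul (alg_3C_hat \<eta>))"
  unfolding alg_3C_hat_def basis_alg_simps by (rule basis_alg_total) (rule table_3C_commute)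

lemma total_2A: "total_alg (smul alg_2A) (mul (alg_2A :: ('f::field, basis_2A \<Rightarrow>\<^sub>0 'f) alg))"
  unfolding alg_2A_def basis_alg_simps by (rule basis_alg_total) auto

lemma total_3C00: "total_alg (smul (alg_3C00_hat \<eta>)) (mul (alg_3C00_hat \<eta>))"
  unfolding alg_3C00_hat_def by (rule direct_sum_total[OF total_3C total_2A])

lemma relations_3C00_hat:
  fixes \<eta> :: "'f::field"
  shows "total_alg.relations_3C00 (smul (alg_3C00_hat \<eta>)) (mul (alg_3C00_hat \<eta>)) \<eta>
    (bvec Q3, 0) (\<lambda>i. (bvec (A3 i), 0)) (0, bvec S0) (0, bvec S1)"
proof -
  interpret X: total_alg "smul (alg_3C00_hat \<eta>)" "mul (alg_3C00_hat \<eta>)" by (rule total_3C00)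
  interpret A: total_alg "smul (alg_3C_hat \<eta>)" "mul (alg_3C_hat \<eta>)" by (rule total_3C)
  interpret B: total_alg "smul alg_2A" "mul (alg_2A :: ('f, basis_2A \<Rightarrow>\<^sub>0 'f) alg)" by (rule total_2A)
  have m: "mul (alg_3C_hat \<eta>) (bvec i) (bvec j) = table_3C \<eta> i j" for i j
    by (simp add: alg_3C_hat_def mul_basis_alg_bvec)
  have m': "mul alg_2A (bvec i) (bvec j) = (if i = j then bvec i else 0 :: basis_2A \<Rightarrow>\<^sub>0 'f)" for i j
    by (simp add: alg_2A_def mul_basis_alg_bvec)
  have s: "smul (alg_3C_hat \<eta>) = pscale" "smul (alg_2A :: ('f, basis_2A \<Rightarrow>\<^sub>0 'f) alg) = pscale"
    by (simp_all add: alg_3C_hat_def alg_2A_def)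
  have zero: "pscale c (0 :: basis_3C \<Rightarrow>\<^sub>0 'f) = 0" "pscale c (0 :: basis_2A \<Rightarrow>\<^sub>0 'f) = 0" for c
    by (rule poly_mapping_eqI, simp)+
  have "table_3C \<eta> (A3 i) (A3 j) = pscale (- (1 / 2)) (bvec Q3) + pscale ((\<eta> + 1) / 2) (bvec (A3 i)
      + bvec (A3 j))
       + pscale ((1 - \<eta>) / 2) (bvec (A3 k))" if "{i, j, k} = {IM1, I0, I1}" for i j k
  proof -
    have "i \<noteq> j" using that by (cases i; cases j; cases k) auto
    then show ?thesis by (simp add: the_third[OF that])
  qed
  then show ?thesis
    unfolding X.relations_3C00_def unfolding alg_3C00_hat_def by (auto simp: prod_eq_iff m m' s zero)
qed

lemma axial_3C00:
  fixes \<eta> :: "'f::field"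
  assumes two: "(2 :: 'f) \<noteq> 0" and \<eta>: "\<eta> \<noteq> 0" "\<eta> \<noteq> 1"
  shows "axial_alg2 \<Phi> \<eta> (alg_3C00_hat \<eta>) axes_3C00_hat"
proof -
  let ?X = "alg_3C00_hat \<eta>"
  interpret X: total_alg "smul ?X" "mul ?X" by (rule total_3C00)
  have C: "carrier ?X = UNIV" by (simp add: alg_3C00_hat_def alg_3C_hat_def alg_2A_def)
  have comm: "comm_alg ?X" by (rule X.comm_algI) (simp_all add: C)
  let ?q = "(bvec Q3, 0) :: (basis_3C \<Rightarrow>\<^sub>0 'f) \<times> (basis_2A \<Rightarrow>\<^sub>0 'f)"
  let ?A = "\<lambda>i. (bvec (A3 i), 0) :: (basis_3C \<Rightarrow>\<^sub>0 'f) \<times> (basis_2A \<Rightarrow>\<^sub>0 'f)"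
  let ?s = "(0, bvec S0) :: (basis_3C \<Rightarrow>\<^sub>0 'f) \<times> (basis_2A \<Rightarrow>\<^sub>0 'f)"
  let ?t = "(0, bvec S1) :: (basis_3C \<Rightarrow>\<^sub>0 'f) \<times> (basis_2A \<Rightarrow>\<^sub>0 'f)"
  note r = relations_3C00_hat[of \<eta>]
  have sm: "smul ?X c x = (pscale c (fst x), pscale c (snd x))" for c x
    by (simp add: alg_3C00_hat_def alg_3C_hat_def alg_2A_def)
  have sp: "X.span {?q, ?A I0, ?A I1, ?A IM1, ?s, ?t} = UNIV"
  proof -
    have "x \<in> X.span {?q, ?A I0, ?A I1, ?A IM1, ?s, ?t}" for x
    proof -
      let ?S = "X.span {?q, ?A I0, ?A I1, ?A IM1, ?s, ?t}"
      let ?l = "Poly_Mapping.lookup (fst x)" and ?m = "Poly_Mapping.lookup (snd x)"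
      have e: "x = smul ?X (?l Q3) ?q + smul ?X (?l (A3 I0)) (?A I0) + smul ?X (?l (A3 I1)) (?A I1)
        + smul ?X (?l (A3 IM1)) (?A IM1) + smul ?X (?m S0) ?s + smul ?X (?m S1) ?t" (is "_ = ?r")
      proof (rule prod_eqI)
        show "fst x = fst ?r"
        proof (rule poly_mapping_eqI)
          fix k show "Poly_Mapping.lookup (fst x) k = Poly_Mapping.lookup (fst ?r) k"
          proof (cases k)
            case (A3 i)
            then show ?thesis by (cases i) (simp_all add: sm lookup_add lookup_single)
          qed (simp add: sm lookup_add lookup_single)
        qed
        show "snd x = snd ?r"
        proof (rule poly_mapping_eqI)
          fix k show "Poly_Mapping.lookup (snd x) k = Poly_Mapping.lookup (snd ?r) k"
            by (cases k) (simp_all add: sm lookup_add lookup_single)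
        qed
      qed
      have "?r \<in> ?S" by (intro X.span_add X.span_scale X.span_base) auto
      then show ?thesis using e by simp
    qed
    then show ?thesis by blast
  qed
  have "is_axis \<Phi> \<eta> ?X (?A I0 + ?s)"
    by (rule X.relations_3C00_is_axis[OF refl refl comm C two \<eta> r _ sp]) auto
  moreover have "is_axis \<Phi> \<eta> ?X (?A I1 + ?t)"
    by (rule X.relations_3C00_is_axis[OF refl refl comm C two \<eta> X.relations_3C00_swap[OF r],
        of I1 I0 IM1])
      (use sp in \<open>auto simp: insert_commute\<close>)
  moreover have "generates ?X {?A I0 + ?s, ?A I1 + ?t}"
  proof (rule generatesI[OF comm])
    fix B assume "subalgebra ?X B" "{?A I0 + ?s, ?A I1 + ?t} \<subseteq> B"
    then show "carrier ?X \<subseteq> B"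
      using X.relations_3C00_generated[OF two \<eta> r, of B] unfolding subalgebra_def sp C by blast
  qed (simp add: C)
  ultimately show ?thesis
    unfolding axial_alg2_def axes_3C00_hat_def using comm by simp
qed

lemma hom_from_3C00:
  fixes M :: "('f::field, 'm::ab_group_add) alg"
  assumes two: "(2 :: 'f) \<noteq> 0" and \<eta>: "\<eta> \<noteq> 0" "\<eta> \<noteq> 1" "2 * \<eta> \<noteq> 1" and \<Phi>: "\<Phi> \<subseteq> {0, 1}" "\<Phi> \<noteq> {0, 1}"
    and M: "axial_alg2 \<Phi> \<eta> M (a0, a1)"
  shows "\<exists>h. axial_hom (alg_3C00_hat \<eta>) axes_3C00_hat M (a0, a1) h"
proof -
  have cM: "comm_alg M" and ax: "is_axis \<Phi> \<eta> M a0" "is_axis \<Phi> \<eta> M a1" using M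
      by (auto simp: axial_alg2_def)
  obtain \<pi> where \<pi>: "projected_alg M \<pi>" using comm_alg.projected_alg_exists[OF cM] by blast
  interpret M: projected_alg M \<pi> by (rule \<pi>)
  interpret V: total_alg "smul M" M.ptimes by (rule M.ptimes_total_alg)
  interpret H: total_alg V.hull_scale V.hull_times by (rule V.hull_total_alg)
  have "H.axis \<Phi> \<eta> (a0, 0)" "H.axis \<Phi> \<eta> (a1, 0)"
    using V.hull_axis M.ptimes_axis ax \<Phi>(1) \<eta> by blast+
  then obtain q A s t where r: "H.relations_3C00 \<eta> q A s t" and g: "A I0 + s = (a0, 0)"
      "A I1 + t = (a1, 0)"
    using H.relations_3C00_from_axes[OF V.hull_unit two \<eta> \<Phi>] by blast
  define g1 where "g1 k = (case k of Q3 \<Rightarrow> q | A3 i \<Rightarrow> A i)" for k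
  define g2 where "g2 k = (case k of S0 \<Rightarrow> s | S1 \<Rightarrow> t)" for k
  define h where "h x = H.lin g1 (fst x) + H.lin g2 (snd x)" for x
  have R: "V.hull_times q q = V.hull_scale (\<eta> + 1) q"
      "V.hull_times q (A i) = V.hull_scale (\<eta> + 1) (A i)"
    "V.hull_times (A i) q = V.hull_scale (\<eta> + 1) (A i)"
    "V.hull_times (A i) (A i) = A i" "V.hull_times q s = 0" "V.hull_times q t = 0"
        "V.hull_times (A i) s = 0"
    "V.hull_times (A i) t = 0" "V.hull_times s s = s" "V.hull_times t t = t" "V.hull_times s t = 0"
        "V.hull_times t s = 0" for i
    using H.relations_3C00D[OF r, of IM1 I0 I1] by blast+
  have R': "V.hull_times (A i) (A j) = V.hull_scale (- (1 / 2)) q + V.hull_scale ((\<eta> + 1) / 2) (A i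
      + A j) + V.hull_scale ((1 - \<eta>) / 2) (A k)"
    if "{i, j, k} = {IM1, I0, I1}" for i j k
    using H.relations_3C00D(5)[OF r that] .
  have lin1: "V.hull_times (g1 i) (g1 j) = H.lin g1 (table_3C \<eta> i j)" for i j
  proof (cases i)
    case Q3
    then show ?thesis by (cases j) (simp_all add: g1_def H.lin_simps R)
  next
    case (A3 i')
    show ?thesis
    proof (cases j)
      case Q3
      then show ?thesis using A3 by (simp add: g1_def H.lin_simps R)
    next
      case (A3 j')
      show ?thesis
      proof (cases "i' = j'")
        case True
        then show ?thesis using A3 \<open>i = A3 i'\<close> by (simp add: g1_def H.lin_simps R)
      next
        case False
        then obtain k where k: "{i', j', k} = {IM1, I0, I1}"
          by (cases i'; cases j') auto
        show ?thesis
          using A3 \<open>i = A3 i'\<close> False by (simp add: the_third[OF k] H.lin_simps)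
              (simp add: g1_def R'[OF k])
      qed
    qed
  qed
  have lin2: "V.hull_times (g2 i) (g2 j) = H.lin g2 (if i = j then bvec i else 0)" for i j
    by (cases i; cases j) (simp_all add: g2_def H.lin_simps R)
  have orth: "V.hull_times (H.lin g1 x) (H.lin g2 y) = 0" for x y
  proof -
    have "V.hull_times (g1 i) (g2 j) = 0" for i j by (cases i; cases j) (simp_all add: g1_def g2_def R)
    then show ?thesis by (simp add: H.lin_def H.times_sum_left H.times_sum_right H.times_scale_left
        H.times_scale_right)
  qed
  then have orth': "V.hull_times (H.lin g2 y) (H.lin g1 x) = 0" for x y by (metis H.times_comm)
  have gen: "comm_alg (alg_3C00_hat \<eta>)"
      "generates (alg_3C00_hat \<eta>) {(bvec (A3 I0), bvec S0), (bvec (A3 I1), bvec S1)}"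
    using axial_3C00[OF two \<eta>(1,2), of \<Phi>] by (auto simp: axial_alg2_def axes_3C00_hat_def)
  have "axial_hom (alg_3C00_hat \<eta>) axes_3C00_hat M (a0, a1) (fst \<circ> h)"
    unfolding axes_3C00_hat_def
  proof (rule hom_into_hull[OF \<pi> gen])
    show "a0 \<in> carrier M" "a1 \<in> carrier M" using ax by (auto simp: is_axis_def)
    show "h (bvec (A3 I0), bvec S0) = (a0, 0)" "h (bvec (A3 I1), bvec S1) = (a1, 0)"
      using g by (simp_all add: h_def H.lin_simps g1_def g2_def)
    show "h (x + y) = h x + h y" for x y by (simp add: h_def H.lin_add algebra_simps)
    show "h (smul (alg_3C00_hat \<eta>) c x) = V.hull_scale c (h x)" for c x
      by (simp add: h_def alg_3C00_hat_def alg_3C_hat_def alg_2A_def H.lin_pscale H.scale_right_distrib)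
    show "h (mul (alg_3C00_hat \<eta>) x y) = V.hull_times (h x) (h y)" for x y
    proof -
      have "H.lin g1 (mul (alg_3C_hat \<eta>) (fst x) (fst y)) = V.hull_times (H.lin g1 (fst x)) (H.lin g1
          (fst y))"
        unfolding alg_3C_hat_def by (rule H.lin_mul) (simp_all add: lin1)
      moreover have "H.lin g2 (mul alg_2A (snd x) (snd y)) = V.hull_times (H.lin g2 (snd x)) (H.lin g2
          (snd y))"
        unfolding alg_2A_def by (rule H.lin_mul) (simp_all add: lin2)
      ultimately show ?thesis by (simp add: h_def alg_3C00_hat_def H.times_bilinear orth orth')
    qed
  qed
  then show ?thesis by blast
qed

section \<open>The algebra \<open>Z\<^sub>n\<^sub>p\<close>\<close>

abbreviation basis_Znp :: "basis_Z set" where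
  "basis_Znp \<equiv> {PZ i | i. i > 0} \<union> {AZ i | i. True}"

lemma table_Z_commute: "(table_Z i j :: basis_Z \<Rightarrow>\<^sub>0 'f::field) = table_Z j i"
  by (cases i; cases j) (simp_all add: add.commute abs_minus_commute)

lemma total_Znp: "total_alg pscale (mul (alg_Znp :: ('f::field, basis_Z \<Rightarrow>\<^sub>0 'f) alg))"
  unfolding alg_Znp_def by (rule basis_alg_total) (rule table_Z_commute)

text \<open>An even extension of \<open>pZ\<close> to all integers, zero at 0. With it the
  multiplication table is uniform in \<open>m + n\<close> and \<open>m - n\<close>, without absolute
  values or case distinctions.\<close>

definition pz :: "int \<Rightarrow> (basis_Z \<Rightarrow>\<^sub>0 'f::field)" where
  "pz k = pZ (nat \<bar>k\<bar>)"

locale Znp = total_alg "pscale :: 'f::field \<Rightarrow> _" "mul (alg_Znp :: ('f, basis_Z \<Rightarrow>\<^sub>0 'f) alg)" +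
  assumes two_neq_0: "(2 :: 'f) \<noteq> 0"
begin

abbreviation Z :: "('f, basis_Z \<Rightarrow>\<^sub>0 'f) alg" where "Z \<equiv> alg_Znp"
abbreviation az :: "int \<Rightarrow> (basis_Z \<Rightarrow>\<^sub>0 'f)" where "az \<equiv> aZ"
abbreviation prd (infixl \<open>\<odot>\<close> 70) where "x \<odot> y \<equiv> mul Z x y"
abbreviation scl (infixr \<open>*s\<close> 75) where "c *s x \<equiv> pscale c x"

lemma hf: "2 * hf = (1 :: 'f)"
  using two_neq_0 by (simp add: hf_def)

lemma pz_0: "pz 0 = 0" and pz_minus: "pz (- k) = pz k"
  by (simp_all add: pz_def pZ_def)

lemma bvec_mul: "bvec i \<odot> bvec j = table_Z i j"
  by (simp add: alg_Znp_def mul_basis_alg_bvec)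

lemma az_az: "az i \<odot> az j = pz (i - j) + (1 / 2) *s (az i + az j)"
  by (simp add: aZ_def bvec_mul pz_def)

text \<open>The convention that the vector with index 0 is zero is consistent with the product
  formulas, whose right sides also vanish at that index.\<close>

lemma quarter: "- ((1 / 4) *s x) + (1 / 8) *s (x + x) = 0" for x :: "basis_Z \<Rightarrow>\<^sub>0 'f"
  by (rule coord_eqI, simp only: coord_linear hf_simps, (algebra | use hf in algebra))

lemma az_pZ: "az i \<odot> pZ n = (1 / 2) *s pZ n - (1 / 4) *s az i + (1 / 8) *s (az (i - int n) + az (i
    + int n))"
proof (cases "n = 0")
  case True
  then show ?thesis using quarter[of "az i"] by (simp add: pZ_def)
next
  case False
  then show ?thesis by (simp add: aZ_def[of i] bvec_mul prod_ap_def pZ_def)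
qed

lemma az_pz: "az i \<odot> pz k = (1 / 2) *s pz k - (1 / 4) *s az i + (1 / 8) *s (az (i - k) + az (i + k))"
  by (cases "k \<ge> 0") (simp_all add: pz_def az_pZ add.commute)

lemma pz_az: "pz k \<odot> az i = (1 / 2) *s pz k - (1 / 4) *s az i + (1 / 8) *s (az (i - k) + az (i + k))"
  using az_pz times_comm by metis

lemma pZ_pZ: "pZ m \<odot> pZ n = - ((1 / 4) *s (pZ m + pZ n)) + (1 / 8) *s (pZ (m + n) + pZ (nat \<bar>int m
    - int n\<bar>))"
proof (cases "m = 0 \<or> n = 0")
  case True
  then show ?thesis using quarter[of "pZ m"] quarter[of "pZ n"] by (auto simp: pZ_def)
next
  case False
  have "pZ m \<odot> pZ n = table_Z (PZ m) (PZ n)" using False by (simp add: pZ_def bvec_mul)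
  then show ?thesis by simp
qed

lemma pz_pz: "pz m \<odot> pz n = - ((1 / 4) *s (pz m + pz n)) + (1 / 8) *s (pz (m + n) + pz (m - n))"
proof -
  have "pZ (nat \<bar>m\<bar> + nat \<bar>n\<bar>) + pZ (nat \<bar>int (nat \<bar>m\<bar>) - int (nat \<bar>n\<bar>)\<bar>) = (pz (m + n) + pz (m
      - n) :: basis_Z \<Rightarrow>\<^sub>0 'f)"
  \<comment> \<open>The sum and the distance of the absolute values are the absolute values of
    \<open>m + n\<close> and \<open>m - n\<close>, in this order for equal signs and exchanged for
    opposite ones.\<close>
  proof (cases "m \<ge> 0 \<longleftrightarrow> n \<ge> 0")
    case True
    then have "nat \<bar>m\<bar> + nat \<bar>n\<bar> = nat \<bar>m + n\<bar>" "\<bar>int (nat \<bar>m\<bar>) - int (nat \<bar>n\<bar>)\<bar> = \<bar>m - n\<bar>" by auto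
    then show ?thesis by (simp add: pz_def)
  next
    case False
    then have "nat \<bar>m\<bar> + nat \<bar>n\<bar> = nat \<bar>m - n\<bar>" "\<bar>int (nat \<bar>m\<bar>) - int (nat \<bar>n\<bar>)\<bar> = \<bar>m + n\<bar>" by auto
    then show ?thesis by (simp add: pz_def add.commute)
  qed
  then show ?thesis using pZ_pZ[of "nat \<bar>m\<bar>" "nat \<bar>n\<bar>"] by (simp only: pz_def[of m] pz_def[of n])
qed

lemma carrier_Z: "carrier Z = {x. Poly_Mapping.keys x \<subseteq> basis_Znp}"
  by (simp add: alg_Znp_def)

lemma az_carrier: "az i \<in> carrier Z"
  by (auto simp: carrier_Z aZ_def)

lemma pz_carrier: "pz k \<in> carrier Z"
  by (auto simp: carrier_Z pz_def pZ_def)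

lemma subspace_Z: "subspace (carrier Z)"
  unfolding subspace_def carrier_Z
proof (intro conjI ballI allI)
  fix x y :: "basis_Z \<Rightarrow>\<^sub>0 'f" and c
  assume x: "x \<in> {x. Poly_Mapping.keys x \<subseteq> basis_Znp}"
  have "Poly_Mapping.keys (pscale c x) \<subseteq> Poly_Mapping.keys x" by (auto simp: in_keys_iff)
  then show "pscale c x \<in> {x. Poly_Mapping.keys x \<subseteq> basis_Znp}" using x by auto
  assume "y \<in> {x. Poly_Mapping.keys x \<subseteq> basis_Znp}"
  then show "x + y \<in> {x. Poly_Mapping.keys x \<subseteq> basis_Znp}" using x Poly_Mapping.keys_add[of x y]
      by blast
qed simp

lemma carrier_Z_span: "carrier Z = span (range az \<union> range pz)"
proof
  show "span (range az \<union> range pz) \<subseteq> carrier Z"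
    by (rule span_minimal[OF _ subspace_Z]) (auto simp: az_carrier pz_carrier)
  show "carrier Z \<subseteq> span (range az \<union> range pz)"
  proof
    fix x assume "x \<in> carrier Z"
    then have k: "Poly_Mapping.keys x \<subseteq> basis_Znp" by (simp add: carrier_Z)
    have "bvec ` Poly_Mapping.keys x \<subseteq> range az \<union> (range pz :: (basis_Z \<Rightarrow>\<^sub>0 'f) set)"
    proof (clarify)
      fix b assume "b \<in> Poly_Mapping.keys x" "bvec b \<notin> (range pz :: (basis_Z \<Rightarrow>\<^sub>0 'f) set)"
      moreover have "bvec (PZ n) = (pz (int n) :: basis_Z \<Rightarrow>\<^sub>0 'f)" if "n > 0" for n using that
          by (simp add: pz_def pZ_def)
      ultimately obtain i where "b = AZ i" using k by blast
      then show "bvec b \<in> range az" by (auto simp: aZ_def)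
    qed
    then have "span (bvec ` Poly_Mapping.keys x) \<subseteq> span (range az \<union> range pz)" by (rule span_mono)
    then show "x \<in> span (range az \<union> range pz)" using poly_mapping_in_span[of x] by blast
  qed
qed

lemma times_carrier: "x \<in> carrier Z \<Longrightarrow> y \<in> carrier Z \<Longrightarrow> x \<odot> y \<in> carrier Z"
proof (rule times_span[OF subspace_Z])
  fix x y :: "basis_Z \<Rightarrow>\<^sub>0 'f"
  note [intro] = subspace_add[OF subspace_Z] subspace_diff[OF subspace_Z] subspace_neg[OF subspace_Z]
    subspace_scale[OF subspace_Z] az_carrier pz_carrier
  assume "x \<in> range az \<union> range pz" "y \<in> range az \<union> range pz"
  then show "x \<odot> y \<in> carrier Z"
    by (elim UnE rangeE) (simp_all only: az_az az_pz pz_az pz_pz, blast+)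
qed (simp_all only: carrier_Z_span)

lemma smul_Z: "smul Z = pscale"
  by (simp add: alg_Znp_def)

lemma comm_alg_Z: "comm_alg Z"
  by (rule comm_algI) (simp_all add: smul_Z subspace_Z times_carrier)

text \<open>For eigenvalue 1/2, \<open>x0\<close> and \<open>x1\<close> are the counterparts of
  \<open>a_part0\<close> and \<open>a_part1\<close> for \<open>az (c + k)\<close> at the axis
  \<open>az c\<close>, and \<open>xh\<close> is twice the remaining component.\<close>

definition x0 :: "int \<Rightarrow> int \<Rightarrow> basis_Z \<Rightarrow>\<^sub>0 'f" where
  "x0 c k = (1 / 4) *s (az (c + k) + az (c - k)) - pz k - (1 / 2) *s az c"

definition x1 :: "int \<Rightarrow> int \<Rightarrow> basis_Z \<Rightarrow>\<^sub>0 'f" where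
  "x1 c k = (1 / 4) *s (az (c + k) + az (c - k)) + pz k + (1 / 2) *s az c"

definition xh :: "int \<Rightarrow> int \<Rightarrow> basis_Z \<Rightarrow>\<^sub>0 'f" where
  "xh c k = az (c + k) - az (c - k)"

lemma az_self: "az i \<odot> az i = az i"
  unfolding az_az by (simp add: pz_0, rule coord_eqI, simp only: coord_linear hf_simps,
      (algebra | use hf in algebra))

lemma az_az_shift: "az c \<odot> az (c + k) = pz k + (1 / 2) *s (az c + az (c + k))"
  "az c \<odot> az (c - k) = pz k + (1 / 2) *s (az c + az (c - k))"
  "az (c + k) \<odot> az c = pz k + (1 / 2) *s (az (c + k) + az c)"
  "az (c - k) \<odot> az c = pz k + (1 / 2) *s (az (c - k) + az c)"
  unfolding az_az using pz_minus[of k] by simp_all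

lemma eig0: "az c \<odot> x0 c k = 0" and eig1: "az c \<odot> x1 c k = x1 c k" and eigh:
    "az c \<odot> xh c k = (1 / 2) *s xh c k"
  unfolding x0_def x1_def xh_def times_bilinear az_az_shift az_pz az_self
  by (rule coord_eqI, simp only: coord_linear hf_simps, (algebra | use hf in algebra))+

lemma shift_products:
  "az (c + i) \<odot> az (c + j) = pz (i - j) + (1 / 2) *s (az (c + i) + az (c + j))"
  "az (c + i) \<odot> az (c - j) = pz (i + j) + (1 / 2) *s (az (c + i) + az (c - j))"
  "az (c - i) \<odot> az (c + j) = pz (i + j) + (1 / 2) *s (az (c - i) + az (c + j))"
  "az (c - i) \<odot> az (c - j) = pz (i - j) + (1 / 2) *s (az (c - i) + az (c - j))"
  "az (c + i) \<odot> pz j = (1 / 2) *s pz j - (1 / 4) *s az (c + i) + (1 / 8) *s (az (c + (i - j)) + az (c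
      + (i + j)))"
  "az (c - i) \<odot> pz j = (1 / 2) *s pz j - (1 / 4) *s az (c - i) + (1 / 8) *s (az (c - (i + j)) + az (c
      - (i - j)))"
  "pz i \<odot> az (c + j) = (1 / 2) *s pz i - (1 / 4) *s az (c + j) + (1 / 8) *s (az (c - (i - j)) + az (c
      + (i + j)))"
  "pz i \<odot> az (c - j) = (1 / 2) *s pz i - (1 / 4) *s az (c - j) + (1 / 8) *s (az (c - (i + j)) + az (c
      + (i - j)))"
proof -
  have "pz (- i - j) = pz (i + j)" "pz (j - i) = pz (i - j)"
    using pz_minus[of "i + j"] pz_minus[of "i - j"] by simp_all
  then show "az (c + i) \<odot> az (c + j) = pz (i - j) + (1 / 2) *s (az (c + i) + az (c + j))"
    "az (c + i) \<odot> az (c - j) = pz (i + j) + (1 / 2) *s (az (c + i) + az (c - j))"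
    "az (c - i) \<odot> az (c + j) = pz (i + j) + (1 / 2) *s (az (c - i) + az (c + j))"
    "az (c - i) \<odot> az (c - j) = pz (i - j) + (1 / 2) *s (az (c - i) + az (c - j))"
    unfolding az_az by (simp_all add: algebra_simps)
qed (simp_all add: az_pz pz_az algebra_simps)

text \<open>The products close up with the indices \<open>i + j\<close> and \<open>i - j\<close>, as
  for products of cosines and sines. The right sides of the first five identities are eigenvectors
  of the required kind or zero, so the corresponding fusion rules can be read off.\<close>

lemma prod_00: "x0 c i \<odot> x0 c j = (1 / 2) *s (x0 c i + x0 c j) - (1 / 4) *s (x0 c (i + j) + x0 c (i
    - j))"
  and prod_11: "x1 c i \<odot> x1 c j = (1 / 2) *s (x1 c i + x1 c j) + (1 / 4) *s (x1 c (i + j) + x1 c (i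
      - j)) - (1 / 2) *s az c"
  and prod_01: "x0 c i \<odot> x1 c j = 0"
  and prod_0h: "x0 c i \<odot> xh c j = (1 / 4) *s xh c j - (1 / 8) *s (xh c (i + j) - xh c (i - j))"
  and prod_1h: "x1 c i \<odot> xh c j = (1 / 4) *s xh c j + (1 / 8) *s (xh c (i + j) - xh c (i - j))"
  and prod_hh: "xh c i \<odot> xh c j = 2 *s (pz (i - j) - pz (i + j))"
  unfolding x0_def x1_def xh_def times_bilinear shift_products az_az_shift az_pz[of c] pz_az[of _ c]
      az_self pz_pz
  by (rule coord_eqI, simp only: coord_linear hf_simps, (algebra | use hf in algebra))+

lemma is_axis_Z: "is_axis \<Phi> (1 / 2) Z (az c)"
proof (rule is_axisI[OF smul_Z refl comm_alg_Z az_carrier, where ?E0.0 = "range (x0 c)" and ?E1.0 =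
    "range (x1 c)" and Eh = "range (xh c)"])
  show "(1 :: 'f) / 2 \<noteq> 0" using two_neq_0 by simp
  show "(1 :: 'f) / 2 \<noteq> 1"
  proof
    assume "(1 :: 'f) / 2 = 1"
    then have "(1 :: 'f) = 2" using two_neq_0 by (simp add: divide_eq_eq)
    then have "(1 :: 'f) + 0 = 1 + 1" by simp
    then show False by (simp only: add_left_cancel) simp
  qed
  show "az c \<odot> az c = az c" by (rule az_self)
  note [intro] = subspace_add[OF subspace_Z] subspace_diff[OF subspace_Z] subspace_neg[OF subspace_Z]
    subspace_scale[OF subspace_Z] az_carrier pz_carrier
  fix x :: "basis_Z \<Rightarrow>\<^sub>0 'f"
  show "x \<in> carrier Z \<and> az c \<odot> x = 0" if "x \<in> range (x0 c)" using that eig0 unfolding x0_def by blast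
  show "x \<in> carrier Z \<and> az c \<odot> x = x" if "x \<in> range (x1 c)" using that eig1 unfolding x1_def by blast
  show "x \<in> carrier Z \<and> az c \<odot> x = (1 / 2) *s x" if "x \<in> range (xh c)" using that eigh unfolding xh_def
      by blast
next
  let ?S = "span (range (x0 c) \<union> range (x1 c) \<union> range (xh c))"
  have b: "x0 c k \<in> ?S" "x1 c k \<in> ?S" "xh c k \<in> ?S" for k by (auto intro: span_base)
  have a: "az i \<in> ?S" for i
  proof -
    have "x0 c (i - c) + x1 c (i - c) + (1 / 2) *s xh c (i - c) \<in> ?S" by (intro span_add span_scale b)
    moreover have "x0 c (i - c) + x1 c (i - c) + (1 / 2) *s xh c (i - c) = az i"
      unfolding x0_def x1_def xh_def by (simp, rule coord_eqI, simp only: coord_linear hf_simps,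
          (algebra | use hf in algebra))
    ultimately show ?thesis by simp
  qed
  have "pz k \<in> ?S" for k
  proof -
    have "(1 / 2) *s (x1 c k - x0 c k) - (1 / 2) *s az c \<in> ?S" by (intro span_diff span_scale b a)
    moreover have "(1 / 2) *s (x1 c k - x0 c k) - (1 / 2) *s az c = pz k"
      unfolding x0_def x1_def by (rule coord_eqI, simp only: coord_linear hf_simps,
          (algebra | use hf in algebra))
    ultimately show ?thesis by simp
  qed
  then show "carrier Z \<subseteq> ?S" unfolding carrier_Z_span using a by (intro span_minimal subspace_span) auto
next
  fix x y assume "x \<in> range (x0 c)" "y \<in> range (x0 c)"
  then show "az c \<odot> (x \<odot> y) = 0"
    by (elim rangeE) (simp only: prod_00 times_bilinear eig0, simp)
next
  fix x y assume "x \<in> range (x1 c)" "y \<in> range (x1 c)"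
  then show "az c \<odot> (x \<odot> y) = x \<odot> y"
    by (elim rangeE) (simp only: prod_11 times_bilinear eig1 az_self)
next
  fix x y assume "x \<in> range (x0 c)" "y \<in> range (x1 c)"
  then show "x \<odot> y = 0" by (elim rangeE) (simp only: prod_01)
next
  fix x y assume "x \<in> range (x0 c)" "y \<in> range (xh c)"
  then obtain i j where xy: "x = x0 c i" "y = xh c j" by auto
  show "az c \<odot> (x \<odot> y) = (1 / 2) *s (x \<odot> y)"
    unfolding xy prod_0h times_bilinear eigh by (rule coord_eqI, simp only: coord_linear hf_simps,
        algebra)
next
  fix x y assume "x \<in> range (x1 c)" "y \<in> range (xh c)"
  then obtain i j where xy: "x = x1 c i" "y = xh c j" by auto
  show "az c \<odot> (x \<odot> y) = (1 / 2) *s (x \<odot> y)"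
    unfolding xy prod_1h times_bilinear eigh by (rule coord_eqI, simp only: coord_linear hf_simps,
        algebra)
next
  fix x y assume "x \<in> range (xh c)" "y \<in> range (xh c)"
  \<comment> \<open>\<open>pz k\<close> is half of \<open>x1 c k - x0 c k - az c\<close>. It
    therefore has no odd component, and so have the products of odd vectors, which are combinations
    of such elements.\<close>
  moreover have "az c \<odot> pz k = (1 / 2) *s x1 c k - (1 / 2) *s az c" for k
    unfolding x1_def az_pz by (rule coord_eqI, simp only: coord_linear hf_simps,
        (algebra | use hf in algebra))
  ultimately show "az c \<odot> (az c \<odot> (x \<odot> y)) = az c \<odot> (x \<odot> y)"
    by (elim rangeE) (simp only: prod_hh times_bilinear eig1 az_self)
qed

text \<open>The product of the two generators contains \<open>pz 1\<close>. Multiplying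
  \<open>az i\<close> by \<open>pz 1\<close> gives the sum of its two neighbours, so one can walk
  from two adjacent axes to all others in both directions. Products of axes then give all
  \<open>pz k\<close>.\<close>

lemma generates_Z: "generates Z {az 0, az 1}"
proof (rule generatesI[OF comm_alg_Z])
  show "{az 0, az 1} \<subseteq> carrier Z" by (simp add: az_carrier)
  fix S assume "subalgebra Z S" and a: "{az 0, az 1} \<subseteq> S"
  then have S: "subspace S" "\<And>x y. x \<in> S \<Longrightarrow> y \<in> S \<Longrightarrow> x \<odot> y \<in> S" by (auto simp: subalgebra_def smul_Z)
  note [intro] = subspace_add[OF S(1)] subspace_diff[OF S(1)] subspace_scale[OF S(1)] S(2)
  have pz_eq: "pz (i - j) = az i \<odot> az j - (1 / 2) *s (az i + az j)" for i j unfolding az_az by simp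
  have pz_S: "pz (i - j) \<in> S" if "az i \<in> S" "az j \<in> S" for i j unfolding pz_eq using that by blast
  have p1: "pz 1 \<in> S" using pz_S[of 1 0] a by simp
  have sum: "az (i - 1) + az (i + 1) \<in> S" if "az i \<in> S" for i
  proof -
    have "8 *s (az i \<odot> pz 1 - (1 / 2) *s pz 1 + (1 / 4) *s az i) \<in> S" using that p1 by blast
    moreover have "8 *s (az i \<odot> pz 1 - (1 / 2) *s pz 1 + (1 / 4) *s az i) = az (i - 1) + az (i + 1)"
      unfolding az_pz by (rule coord_eqI, simp only: coord_linear hf_simps,
          (algebra | use hf in algebra))
    ultimately show ?thesis by simp
  qed
  have "az i \<in> S \<and> az (i + 1) \<in> S" for i
  proof (induction i rule: int_induct[where k = 0])
    case base then show ?case using a by simp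
  next
    case (step1 i)
    then have "az i + az (i + 2) - az i \<in> S" using sum[of "i + 1"] by (intro subspace_diff[OF S(1)])
        (simp_all add: add.commute)
    then show ?case using step1 by (simp add: add.commute)
  next
    case (step2 i)
    then have "az (i - 1) + az (i + 1) - az (i + 1) \<in> S" using sum[of i] by blast
    then show ?case using step2 by simp
  qed
  then have az: "az i \<in> S" for i by blast
  moreover have "pz k \<in> S" for k using pz_S[of k 0] az by simp
  ultimately show "carrier Z \<subseteq> S" unfolding carrier_Z_span using S(1) by (intro span_minimal) auto
qed

lemma axial_Z: "axial_alg2 \<Phi> (1 / 2) Z (az 0, az 1)"
  unfolding axial_alg2_def using comm_alg_Z is_axis_Z generates_Z by simp

end

lemma hom_from_Znp:
  fixes M :: "('f::field, 'm::ab_group_add) alg"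
  assumes two: "(2 :: 'f) \<noteq> 0" and \<Phi>: "\<Phi> \<subseteq> {0, 1}" "\<Phi> = {} \<or> ((3 :: 'f) \<noteq> 0 \<and> (5 :: 'f) \<noteq> 0)"
    and M: "axial_alg2 \<Phi> (1 / 2) M (a0, a1)" and \<eta>: "(1 / 2 :: 'f) \<noteq> 0" "(1 / 2 :: 'f) \<noteq> 1"
  shows "\<exists>h. axial_hom alg_Znp (aZ 0, aZ 1) M (a0, a1) h"
proof -
  interpret Z: Znp using total_Znp two by (simp add: Znp_def Znp_axioms_def)
  have cM: "comm_alg M" and ax: "is_axis \<Phi> (1 / 2) M a0" "is_axis \<Phi> (1 / 2) M a1" using M
      by (auto simp: axial_alg2_def)
  obtain \<pi> where \<pi>: "projected_alg M \<pi>" using comm_alg.projected_alg_exists[OF cM] by blast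
  interpret M: projected_alg M \<pi> by (rule \<pi>)
  interpret V: total_alg "smul M" M.ptimes by (rule M.ptimes_total_alg)
  interpret H: total_alg V.hull_scale V.hull_times by (rule V.hull_total_alg)
  have "H.axis \<Phi> (1 / 2) (a0, 0)" "H.axis \<Phi> (1 / 2) (a1, 0)"
    using V.hull_axis M.ptimes_axis ax \<Phi>(1) \<eta> by blast+
  then obtain a where a: "axial_sequence V.hull_scale V.hull_times \<Phi> (1 / 2) a" "a 0 = (a0, 0)"
      "a 1 = (a1, 0)"
    using H.axial_sequence_exists[OF two \<eta>] by metis
  interpret S: axial_sequence_half V.hull_scale V.hull_times \<Phi> "1 / 2" a
    using a(1) by (simp add: axial_sequence_half_def axial_sequence_half_axioms_def)
  note r = S.half_relations[OF \<Phi>(2)]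
  define g where "g b = (case b of PZ n \<Rightarrow> S.p 0 (int n) | AZ i \<Rightarrow> a i)" for b
  \<comment> \<open>For n = 0 both sides vanish: \<open>pZ 0\<close> by convention and
    \<open>S.p 0 0\<close> by \<open>S.p_self\<close>.\<close>
  have gp: "H.lin g (pZ n) = S.p 0 (int n)" for n
    by (simp add: pZ_def H.lin_simps g_def S.p_self)
  have ga: "H.lin g (aZ i) = a i" for i by (simp add: aZ_def H.lin_simps g_def)
  have lin: "V.hull_times (g i) (g j) = H.lin g (table_Z i j)" for i j
  proof (cases i; cases j)
    fix m n assume "i = PZ m" "j = PZ n"
    then show ?thesis using r(3)[of "int m"
        "int n"] by (simp add: g_def H.lin_simps gp H.scale_minus_left)
  next
    fix m n assume "i = AZ m" "j = AZ n"
    then show ?thesis using r(1)[of m n] by (simp add: g_def H.lin_simps gp ga)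
  next
    fix m n assume "i = AZ m" "j = PZ n"
    then show ?thesis using r(2)[of m "int n"] by (simp add: g_def H.lin_simps gp ga prod_ap_def)
  next
    fix m n assume "i = PZ m" "j = AZ n"
    then show ?thesis using r(2)[of n
        "int m"] by (simp add: g_def H.lin_simps gp ga prod_ap_def H.times_comm[of "S.p 0 (int m)"])
  qed
  have "axial_hom alg_Znp (aZ 0, aZ 1) M (a0, a1) (fst \<circ> H.lin g)"
  proof (rule hom_into_hull[OF \<pi> Z.comm_alg_Z Z.generates_Z])
    show "a0 \<in> carrier M" "a1 \<in> carrier M" using ax by (auto simp: is_axis_def)
    show "H.lin g (aZ 0) = (a0, 0)" "H.lin g (aZ 1) = (a1, 0)" using a by (simp_all add: ga)
    show "H.lin g (x + y) = H.lin g x + H.lin g y" for x y by (rule H.lin_add)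
    show "H.lin g (smul alg_Znp c x) = V.hull_scale c (H.lin g x)" for c x
      by (simp add: Z.smul_Z H.lin_pscale)
    show "H.lin g (mul alg_Znp x y) = V.hull_times (H.lin g x) (H.lin g y)" if "x \<in> carrier alg_Znp"
        "y \<in> carrier alg_Znp" for x y
      using that unfolding alg_Znp_def by (intro H.lin_mul lin) simp_all
  qed
  then show ?thesis by blast
qed

lemma numeral_neq_0_by_CHAR:
  assumes "CHAR('f::field) \<noteq> p" "prime p"
  shows "of_nat p \<noteq> (0 :: 'f)"
proof
  assume "of_nat p = (0 :: 'f)"
  then have "CHAR('f) dvd p" by (simp add: of_nat_eq_0_iff_char_dvd)
  then show False using assms by (auto simp: prime_nat_iff)
qed

theorem theorem2:
  fixes \<Phi> :: "'f::field set" and \<eta> :: 'f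
    and M :: "('f, 'm::ab_group_add) alg" and a :: "'m \<times> 'm"
  assumes "CHAR('f) \<noteq> 2"
    and "\<Phi> \<subseteq> {0, 1}"
    and "\<eta> \<notin> {0, 1}"
    and "universal_axial_alg2 \<Phi> \<eta> M a"
  shows "(\<Phi> \<noteq> {0, 1} \<and> \<eta> \<noteq> 1 / 2 \<longrightarrow>
            axial_isomorphic M a (alg_3C00_hat \<eta>) axes_3C00_hat) \<and>
         (\<eta> = 1 / 2 \<and> (\<Phi> = {} \<or> (CHAR('f) \<noteq> 3 \<and> CHAR('f) \<noteq> 5)) \<longrightarrow>
            axial_isomorphic M a alg_Znp (aZ 0, aZ 1))"
proof (intro conjI impI; elim conjE)
  obtain a0 a1 where a: "a = (a0, a1)" by (cases a)
  have two: "(2 :: 'f) \<noteq> 0" using numeral_neq_0_by_CHAR[OF assms(1)] by simp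
  have fin: "finite \<Phi>" using assms(2) finite_subset by blast
  have \<eta>: "\<eta> \<noteq> 0" "\<eta> \<noteq> 1" using assms(3) by auto
  have M: "axial_alg2 \<Phi> \<eta> M (a0, a1)" using assms(4) by (simp add: universal_axial_alg2_def a)
  {
    assume "\<Phi> \<noteq> {0, 1}" "\<eta> \<noteq> 1 / 2"
    moreover from this have "2 * \<eta> \<noteq> 1" using two by (auto simp: field_simps)
    ultimately obtain h where "axial_hom (alg_3C00_hat \<eta>) axes_3C00_hat M a h"
      using hom_from_3C00[OF two \<eta> _ assms(2) _ M] unfolding a by blast
    then show "axial_isomorphic M a (alg_3C00_hat \<eta>) axes_3C00_hat"
      by (rule universal_isomorphic[OF fin assms(4) axial_3C00[OF two \<eta>]])
  next
    assume h: "\<eta> = 1 / 2" and "\<Phi> = {} \<or> (CHAR('f) \<noteq> 3 \<and> CHAR('f) \<noteq> 5)"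
    then have "\<Phi> = {} \<or> ((3 :: 'f) \<noteq> 0 \<and> (5 :: 'f) \<noteq> 0)"
      using numeral_neq_0_by_CHAR[where 'f = 'f, of 3] numeral_neq_0_by_CHAR[where 'f = 'f, of 5]
          by auto
    then obtain f where "axial_hom alg_Znp (aZ 0, aZ 1) M a f"
      using hom_from_Znp[OF two assms(2) _ M[unfolded h] \<eta>[unfolded h]] unfolding a by blast
    moreover interpret Z: Znp using total_Znp two by (simp add: Znp_def Znp_axioms_def)
    have "axial_alg2 \<Phi> \<eta> alg_Znp (aZ 0, aZ 1)" unfolding h by (rule Z.axial_Z)
    ultimately show "axial_isomorphic M a alg_Znp (aZ 0, aZ 1)"
      by (intro universal_isomorphic[OF fin assms(4)])
  }
qed

end
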